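(* Let $x\in\mathbb{R}$ be such that $f(x)\neq 0$. Assume: (i) $K:\mathbb{R}\to\mathbb{R}$ is nonnegative, continuous and bounded, with $\int_{\mathbb{R}}K(z)\,dz=1$, $\int_{\mathbb{R}}zK(z)\,dz=0$ and $\int_{\mathbb{R}}z^2K(z)\,dz<\infty$; (ii) $(\gamma_n)\in\mathcal{GS}(-\alpha)$ with $\alpha\in(\tfrac34,1]$, and the limit of $(n\gamma_n)^{-1}$ as $n\to\infty$ exists; $(h_n)\in\mathcal{GS}(-a)$ with $a\in(\tfrac{1-\alpha}{4},\tfrac{\alpha}{3})$ and moreover $a\geq 1/5$; (iii) $g(s,t)$ is two times continuously differentiable with respect to $s$; for $q'\in\{0,1,2\}$, $s\mapsto\int_{\mathbb{R}}t^{q'} g(s,t)\,dt$ is a bounded function continuous at $s=x$; for $q'\in[2,3]$, $s\mapsto\int_{\mathbb{R}}|t|^{q'} g(s,t)\,dt$ is bounded; for $q'\in\{0,1\}$, $\int_{\mathbb{R}}|t|^{q'}\left|\frac{\partial g}{\partial s}(x,t)\right|dt<\infty$ and $s\mapsto\int_{\mathbb{R}}t^{q'}\frac{\partial^2 g}{\partial s^2}(s,t)\,dt$ is a bounded function continuous at $s=x$; (iv) $\lim_{n\to\infty}n\gamma_n\left(\ln\left(\sum_{k=1}^n\gamma_k\right)\right)^{-1}=\infty$ and $a\in\left(1-\alpha,\tfrac{4\alpha-3}{2}\right)$; (v) $(q_n)\in\mathcal{GS}(-q)$ with $q<\min\left\{1-2a,\tfrac{1+a}{2}\right\}$. Then,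 to minimize the asymptotic variance of $\bar r_n$, $q$ must be chosen equal to $a$; that is, over the admissible values $q<\min\{1-2a,\tfrac{1+a}{2}\}$, the factor $\frac{(1-q)^2}{1+a-2q}$ (through which the asymptotic variance depends on $q$) reaches its minimum at the point $q=a$. Moreover, if $q=a$ and $\lim_{n\to\infty}nh_n^5=0$, then $$\sqrt{nh_n}\,\bigl(\bar r_n(x)-r(x)\bigr)\xrightarrow{\mathcal{D}}\mathcal{N}\left(0,\ (1-a)\frac{\mathrm{Var}[Y\mid X=x]}{f(x)}\int_{\mathbb{R}}K^2(z)\,dz\right).$$
   Context: $(X,Y),(X_1,Y_1),(X_2,Y_2),\ldots$ are independent, identically distributed pairs of real random variables with joint density $g(s,t)$; $f(s)=\int_{\mathbb{R}}g(s,t)\,dt$ is the density of $X$ and $r(x)=\mathbb{E}(Y\mid X=x)$ (that is, $r(x)=f(x)^{-1}\int_{\mathbb{R}}t\,g(x,t)\,dt$ when $f(x)\neq0$). $K$ is a kernel; the stepsize $(\gamma_n)$ and the bandwidth $(h_n)$ are nonrandom sequences of positive reals going to zero. For $n\ge1$ set $Z_n(x)=h_n^{-1}K\left(\frac{x-X_n}{h_n}\right)$ and $W_n(x)=h_n^{-1}Y_nK\left(\frac{x-X_n}{h_n}\right)$. The generalized Révész estimator is defined by setting $r_0(x)\in\mathbb{R}$ and, for $n\geq1$, $r_n(x)=r_{n-1}(x)+\gamma_n\left[W_n(x)-Z_n(x)r_{n-1}(x)\right]$. Given a nonrandom positive sequence $(q_n)$ with $\sum q_n=\infty$, the averaged Révész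 estimator is $\bar r_n(x)=\frac{1}{\sum_{k=1}^nq_k}\sum_{k=1}^nq_kr_k(x)$. For $\gamma\in\mathbb{R}$, a nonrandom positive sequence $(v_n)_{n\ge1}$ belongs to $\mathcal{GS}(\gamma)$ if $\lim_{n\to\infty}n\left[1-\frac{v_{n-1}}{v_n}\right]=\gamma$. The asymptotic variance of $\bar r_n$ is the variance of the Gaussian limit of $\sqrt{nh_n}(\bar r_n(x)-r(x))$ when $nh_n^5$ has a finite limit, namely $\frac{(1-q)^2}{1+a-2q}\frac{\mathrm{Var}[Y\mid X=x]}{f(x)}\int_{\mathbb{R}}K^2(z)dz$. $\xrightarrow{\mathcal{D}}$ is convergence in distribution, $\mathcal{N}(\mu,\sigma^2)$ the Gaussian distribution with mean $\mu$ and variance $\sigma^2$.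
   Formalization: The formal theorem adds to (iii) that, for q' in {0,1}, t^{q'} ∂²g/∂s²(s,t) is jointly integrable over [x−δ,x+δ]×ℝ for some δ>0; without it the bias need not be O(h_n²) and the limit theorem can fail. *)

theory Defs
  imports "HOL-Probability.Probability"
begin

(* Sequences are indexed by n \<ge> 1; the value at index 0 is irrelevant. *)
definition GS :: "real \<Rightarrow> (nat \<Rightarrow> real) set" where
  "GS \<gamma> = {v. (\<forall>n\<ge>1. 0 < v n) \<and> (\<lambda>n. real n * (1 - v (n - 1) / v n)) \<longlonglongrightarrow> \<gamma>}"

definition marginal_density :: "(real \<Rightarrow> real \<Rightarrow> real) \<Rightarrow> real \<Rightarrow> real" where
  "marginal_density g s = (LINT t|lborel. g s t)"

(* Mean and variance of the conditional law of Y given X = x, which for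
   marginal_density g x \<noteq> 0 has density g x / marginal_density g x. *)
definition regression :: "(real \<Rightarrow> real \<Rightarrow> real) \<Rightarrow> real \<Rightarrow> real" where
  "regression g x = (LINT t|lborel. t * g x t) / marginal_density g x"

definition cond_variance :: "(real \<Rightarrow> real \<Rightarrow> real) \<Rightarrow> real \<Rightarrow> real" where
  "cond_variance g x =
     (LINT t|lborel. (t - regression g x)\<^sup>2 * g x t) / marginal_density g x"

definition diff1 :: "(real \<Rightarrow> real \<Rightarrow> real) \<Rightarrow> real \<Rightarrow> real \<Rightarrow> real" where
  "diff1 g s t = deriv (\<lambda>u. g u t) s"

definition diff2 :: "(real \<Rightarrow> real \<Rightarrow> real) \<Rightarrow> real \<Rightarrow> real \<Rightarrow> real" where
  "diff2 g s t = deriv (\<lambda>u. diff1 g u t) s"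

definition C2_in_first :: "(real \<Rightarrow> real \<Rightarrow> real) \<Rightarrow> bool" where
  "C2_in_first g \<longleftrightarrow>
     (\<forall>t. (\<forall>s. (\<lambda>u. g u t) field_differentiable at s) \<and>
          (\<forall>s. (\<lambda>u. diff1 g u t) field_differentiable at s) \<and>
          continuous_on UNIV (\<lambda>s. diff2 g s t))"

(* The Bochner integral is 0 by convention for non-integrable functions, so
   existence of the integrals is part of the following two properties. *)
definition bdd_integral :: "(real \<Rightarrow> real \<Rightarrow> real) \<Rightarrow> bool" where
  "bdd_integral \<phi> \<longleftrightarrow>
     (\<forall>s. integrable lborel (\<phi> s)) \<and> bounded (range (\<lambda>s. LINT t|lborel. \<phi> s t))"

definition bdd_cont_integral :: "(real \<Rightarrow> real \<Rightarrow> real) \<Rightarrow> real \<Rightarrow> bool" where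
  "bdd_cont_integral \<phi> x \<longleftrightarrow> bdd_integral \<phi> \<and> isCont (\<lambda>s. LINT t|lborel. \<phi> s t) x"

definition Z :: "(real \<Rightarrow> real) \<Rightarrow> (nat \<Rightarrow> real) \<Rightarrow> (nat \<Rightarrow> 'w \<Rightarrow> real) \<Rightarrow> real
    \<Rightarrow> nat \<Rightarrow> 'w \<Rightarrow> real" where
  "Z K h Xs x n \<omega> = K ((x - Xs n \<omega>) / h n) / h n"

definition W :: "(real \<Rightarrow> real) \<Rightarrow> (nat \<Rightarrow> real) \<Rightarrow> (nat \<Rightarrow> 'w \<Rightarrow> real) \<Rightarrow> (nat \<Rightarrow> 'w \<Rightarrow> real)
    \<Rightarrow> real \<Rightarrow> nat \<Rightarrow> 'w \<Rightarrow> real" where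
  "W K h Xs Ys x n \<omega> = Ys n \<omega> * K ((x - Xs n \<omega>) / h n) / h n"

primrec revesz :: "(real \<Rightarrow> real) \<Rightarrow> (nat \<Rightarrow> real) \<Rightarrow> (nat \<Rightarrow> real) \<Rightarrow> (nat \<Rightarrow> 'w \<Rightarrow> real)
    \<Rightarrow> (nat \<Rightarrow> 'w \<Rightarrow> real) \<Rightarrow> (real \<Rightarrow> real) \<Rightarrow> real \<Rightarrow> nat \<Rightarrow> 'w \<Rightarrow> real" where
  "revesz K \<gamma> h Xs Ys r0 x 0 \<omega> = r0 x"
| "revesz K \<gamma> h Xs Ys r0 x (Suc n) \<omega> =
     revesz K \<gamma> h Xs Ys r0 x n \<omega> +
     \<gamma> (Suc n) * (W K h Xs Ys x (Suc n) \<omega> - Z K h Xs x (Suc n) \<omega> * revesz K \<gamma> h Xs Ys r0 x n \<omega>)"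

definition averaged_revesz :: "(nat \<Rightarrow> real) \<Rightarrow> (real \<Rightarrow> real) \<Rightarrow> (nat \<Rightarrow> real) \<Rightarrow> (nat \<Rightarrow> real)
    \<Rightarrow> (nat \<Rightarrow> 'w \<Rightarrow> real) \<Rightarrow> (nat \<Rightarrow> 'w \<Rightarrow> real) \<Rightarrow> (real \<Rightarrow> real) \<Rightarrow> real \<Rightarrow> nat \<Rightarrow> 'w \<Rightarrow> real" where
  "averaged_revesz qs K \<gamma> h Xs Ys r0 x n \<omega> =
     (\<Sum>k=1..n. qs k * revesz K \<gamma> h Xs Ys r0 x k \<omega>) / (\<Sum>k=1..n. qs k)"

definition variance_factor :: "real \<Rightarrow> real \<Rightarrow> real" where
  "variance_factor a q = (1 - q)\<^sup>2 / (1 + a - 2 * q)"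

(* Variance of the Gaussian limit of sqrt (n h_n) times the error of the averaged
   estimator with weights in GS (-q), when n h_n^5 has a finite limit. *)
definition asymptotic_variance ::
    "(real \<Rightarrow> real \<Rightarrow> real) \<Rightarrow> (real \<Rightarrow> real) \<Rightarrow> real \<Rightarrow> real \<Rightarrow> real \<Rightarrow> real" where
  "asymptotic_variance g K x a q =
     variance_factor a q * (cond_variance g x / marginal_density g x) * (LINT z|lborel. (K z)\<^sup>2)"

(* normal_density takes the standard deviation. For v = 0 this would not be a
   probability measure. *)
definition gaussian :: "real \<Rightarrow> real \<Rightarrow> real measure" where
  "gaussian \<mu> v =
     (if v = 0 then return borel \<mu> else density lborel (normal_density \<mu> (sqrt v)))"

end

theory Submission
  imports Defs
begin

text \<open>
  Fix the point \<open>x\<close> and write \<open>e\<^sub>n = r\<^sub>n(x) - r(x)\<close>, \<open>\<zeta>\<^sub>n = Z\<^sub>n(x)\<close> and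
  \<open>\<xi>\<^sub>n = W\<^sub>n(x) - r(x) Z\<^sub>n(x)\<close>. The error obeys the linear recursion
  \<open>e\<^sub>n = (1 - \<gamma>\<^sub>n \<zeta>\<^sub>n) e\<^sub>n\<^sub>-\<^sub>1 + \<gamma>\<^sub>n \<xi>\<^sub>n\<close>, whose driving pairs \<open>(\<zeta>\<^sub>n, \<xi>\<^sub>n)\<close> are independent.
  Solving the recursion for \<open>f e\<^sub>k\<close>, where \<open>f = f(x)\<close>, and setting \<open>c\<^sub>k = q\<^sub>k/\<gamma>\<^sub>k - f q\<^sub>k\<close> gives

    \<open>f q\<^sub>k e\<^sub>k = c\<^sub>k (e\<^sub>k\<^sub>-\<^sub>1 - e\<^sub>k) + q\<^sub>k (f - E \<zeta>\<^sub>k) e\<^sub>k\<^sub>-\<^sub>1 + q\<^sub>k (E \<zeta>\<^sub>k - \<zeta>\<^sub>k) e\<^sub>k\<^sub>-\<^sub>1 + q\<^sub>k E \<xi>\<^sub>k + q\<^sub>k (\<xi>\<^sub>k - E \<xi>\<^sub>k)\<close>.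

  Sum over \<open>k \<le> n\<close> and multiply by \<open>sqrt(n h\<^sub>n) / \<Sum>q\<^sub>k\<close>, which is of the order \<open>sqrt(n h\<^sub>n) / (n q\<^sub>n)\<close>.
  The last term becomes a sum of independent centred variables, asymptotically Gaussian by
  Lyapunov's theorem; every other term tends to 0 in \<open>L\<^sup>1\<close>. The one probabilistic estimate behind this is
  \<open>E e\<^sub>n\<^sup>2 = O(\<gamma>\<^sub>n / h\<^sub>n)\<close> (\<open>e_second_moment_bound\<close>): the recursion contracts by \<open>1 - f \<gamma>\<^sub>n\<close>, its noise
  contributes \<open>\<gamma>\<^sub>n\<^sup>2 / h\<^sub>n\<close>, and the squared bias \<open>h\<^sub>n\<^sup>4\<close> is of smaller order because \<open>n h\<^sub>n\<^sup>5 \<rightarrow> 0\<close> while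
  \<open>n \<gamma>\<^sub>n \<rightarrow> \<infinity>\<close>. With it, the first term is removed by summation by parts, the second and fourth by the
  kernel bias \<open>O(h\<^sub>n\<^sup>2)\<close>, and the third, a martingale, by orthogonality of its increments.

  The deterministic sums are evaluated by Karamata's theorem: \<open>\<Sum>\<^bsub>k\<le>n\<^esub> v\<^sub>k\<close> is equivalent to
  \<open>n v\<^sub>n / (1 + \<beta>)\<close> if \<open>v \<in> GS \<beta>\<close> and \<open>\<beta> > -1\<close> (\<open>GS_sum_tendsto\<close>). Applied to \<open>q\<^sub>k\<close> and to \<open>q\<^sub>k\<^sup>2 / h\<^sub>k\<close>, both in
  \<open>GS (-a)\<close> when \<open>q = a\<close>, it yields the factor \<open>(1 - a)\<^sup>2 / (1 - a) = 1 - a\<close> in the limit variance. That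
  \<open>a\<close> is the best exponent is the identity \<open>(1 - p)\<^sup>2 = (1 - a)(1 + a - 2p) + (p - a)\<^sup>2\<close>, together with the
  positivity of the conditional variance and of \<open>\<integral>K\<^sup>2\<close>.

  The moments of \<open>\<zeta>\<^sub>n\<close> and \<open>\<xi>\<^sub>n\<close> are kernel averages of \<open>s \<mapsto> \<integral>\<psi>(t) g(s,t) dt\<close> around \<open>x\<close>; differentiating twice
  under the integral sign (\<open>second_order_at_moment\<close>) and the centring of \<open>K\<close> give the bias \<open>O(h\<^sub>n\<^sup>2)\<close>.
\<close>


section \<open>Regularly varying sequences\<close>

lemma GS_D:
  assumes "v \<in> GS \<beta>"
  shows GS_pos: "\<And>n. n \<ge> 1 \<Longrightarrow> 0 < v n"
    and GS_lim: "(\<lambda>n. real n * (1 - v (n - 1) / v n)) \<longlonglongrightarrow> \<beta>"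
  using assms by (auto simp: GS_def)

text \<open>
  The value at index 0 enters the defining condition only at \<open>n = 1\<close>, which no limit sees; hence agreement
  from index 1 on suffices.
\<close>

lemma GS_cong:
  assumes "v \<in> GS \<beta>" and "\<And>n. n \<ge> 1 \<Longrightarrow> v n = w n" and "\<beta> = \<beta>'"
  shows "w \<in> GS \<beta>'"
proof -
  have "\<forall>\<^sub>F n in sequentially. real n * (1 - v (n - 1) / v n) = real n * (1 - w (n - 1) / w n)"
    using eventually_ge_at_top[of 2] by eventually_elim (simp add: assms(2))
  then have "(\<lambda>n. real n * (1 - w (n - 1) / w n)) \<longlonglongrightarrow> \<beta>"
    using GS_lim[OF assms(1)] by (rule Lim_transform_eventually[rotated])
  then show ?thesis
    using GS_pos[OF assms(1)] assms(2,3) by (auto simp: GS_def)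
qed

lemma GS_increment_tendsto_0:
  assumes "v \<in> GS \<beta>"
  shows "(\<lambda>n. 1 - v (n - 1) / v n) \<longlonglongrightarrow> 0"
proof -
  have "(\<lambda>n. inverse (real n) * (real n * (1 - v (n - 1) / v n))) \<longlonglongrightarrow> 0 * \<beta>"
    by (intro tendsto_mult GS_lim[OF assms] lim_inverse_n)
  moreover have "\<forall>\<^sub>F n in sequentially.
      inverse (real n) * (real n * (1 - v (n - 1) / v n)) = 1 - v (n - 1) / v n"
    using eventually_gt_at_top[of 0] by eventually_elim simp
  ultimately show ?thesis
    using Lim_transform_eventually by fastforce
qed

lemma GS_ratio_tendsto_1:
  assumes "v \<in> GS \<beta>"
  shows "(\<lambda>n. v (n - 1) / v n) \<longlonglongrightarrow> 1"
  using tendsto_diff[OF tendsto_const[of 1] GS_increment_tendsto_0[OF assms]] by simp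

lemma GS_mult:
  assumes v: "v \<in> GS \<beta>" and w: "w \<in> GS \<beta>'"
  shows "(\<lambda>n. v n * w n) \<in> GS (\<beta> + \<beta>')"
proof -
  have "(\<lambda>n. real n * (1 - v (n - 1) / v n) + v (n - 1) / v n * (real n * (1 - w (n - 1) / w n)))
      \<longlonglongrightarrow> \<beta> + 1 * \<beta>'"
    by (intro tendsto_intros GS_lim[OF v] GS_lim[OF w] GS_ratio_tendsto_1[OF v])
  moreover have "real n * (1 - v (n - 1) / v n)
        + v (n - 1) / v n * (real n * (1 - w (n - 1) / w n))
      = real n * (1 - v (n - 1) * w (n - 1) / (v n * w n))" for n
    by (simp add: algebra_simps)
  ultimately show ?thesis
    using GS_pos[OF v] GS_pos[OF w] by (simp add: GS_def)
qed

text \<open>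
  Let \<open>\<psi>\<close> be the difference quotient at 0 of \<open>y \<mapsto> 1 - (1 - y)\<^sup>c\<close>, continuous with \<open>\<psi>(0) = c\<close>. With
  \<open>y\<^sub>n = 1 - v\<^sub>n\<^sub>-\<^sub>1 / v\<^sub>n\<close> the quantity in question is \<open>n y\<^sub>n \<psi>(y\<^sub>n)\<close>.
\<close>

lemma GS_powr:
  assumes v: "v \<in> GS \<beta>"
  shows "(\<lambda>n. v n powr c) \<in> GS (c * \<beta>)"
proof -
  have "((\<lambda>y. 1 - (1 - y) powr c) has_field_derivative c) (at (0::real))"
    by (auto intro!: derivative_eq_intros)
  then obtain \<psi> where \<psi>: "\<And>y. (1 - (1 - y) powr c) - (1 - (1 - 0) powr c) = \<psi> y * (y - 0)"
      "isCont \<psi> 0" "\<psi> 0 = c"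
    by (auto simp: CARAT_DERIV)
  define y where "y n = 1 - v (n - 1) / v n" for n
  have "(\<lambda>n. real n * y n * \<psi> (y n)) \<longlonglongrightarrow> \<beta> * c"
    unfolding y_def using \<psi>(3) tendsto_mult[OF GS_lim[OF v] isCont_tendsto_compose[OF \<psi>(2) GS_increment_tendsto_0[OF v]]]
    by simp
  moreover have "\<forall>\<^sub>F n in sequentially.
      real n * y n * \<psi> (y n) = real n * (1 - v (n - 1) powr c / v n powr c)"
    using eventually_ge_at_top[of 2]
  proof eventually_elim
    case (elim n)
    have "(v (n - 1) / v n) powr c = v (n - 1) powr c / v n powr c"
      by (rule powr_divide)
    then have "\<psi> (y n) * y n = 1 - v (n - 1) powr c / v n powr c"
      using \<psi>(1)[of "y n"] by (simp add: y_def)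
    then show ?case
      by (metis mult.assoc mult.commute)
  qed
  ultimately have "(\<lambda>n. real n * (1 - v (n - 1) powr c / v n powr c)) \<longlonglongrightarrow> c * \<beta>"
    by (subst mult.commute[of c]) (rule Lim_transform_eventually)
  moreover have "0 < v n powr c" if "n \<ge> 1" for n
    using GS_pos[OF v that] by simp
  ultimately show ?thesis
    by (simp add: GS_def)
qed

lemma GS_inverse:
  assumes v: "v \<in> GS \<beta>"
  shows "(\<lambda>n. inverse (v n)) \<in> GS (- \<beta>)"
  by (rule GS_cong[OF GS_powr[OF v, of "-1"]])
     (use GS_pos[OF v] in \<open>auto simp: powr_minus less_imp_le\<close>)

lemma GS_divide:
  assumes v: "v \<in> GS \<beta>" and w: "w \<in> GS \<beta>'"
  shows "(\<lambda>n. v n / w n) \<in> GS (\<beta> - \<beta>')"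
  using GS_mult[OF v GS_inverse[OF w]] by (simp add: divide_inverse)

lemma GS_power:
  assumes v: "v \<in> GS \<beta>"
  shows "(\<lambda>n. v n ^ k) \<in> GS (real k * \<beta>)"
  by (rule GS_cong[OF GS_powr[OF v, of "real k"]])
     (use GS_pos[OF v] in \<open>auto simp: powr_realpow\<close>)

lemma GS_sqrt:
  assumes v: "v \<in> GS \<beta>"
  shows "(\<lambda>n. sqrt (v n)) \<in> GS (\<beta> / 2)"
  by (rule GS_cong[OF GS_powr[OF v, of "1/2"]])
     (use GS_pos[OF v] in \<open>auto simp: powr_half_sqrt less_imp_le\<close>)

lemma GS_real: "real \<in> GS 1"
proof -
  have "\<forall>\<^sub>F n in sequentially. real n * (1 - real (n - 1) / real n) = 1"
    using eventually_gt_at_top[of 0] by eventually_elim (auto simp: field_simps of_nat_diff)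
  then show ?thesis
    by (auto simp: GS_def tendsto_eventually)
qed

text \<open>
  The Toeplitz form of the Stolz--Cesaro theorem: the indices at which \<open>u\<close> is far from its limit carry a
  bounded part of a divergent total weight.
\<close>

lemma weighted_cesaro:
  fixes w u :: "nat \<Rightarrow> real"
  assumes pos: "\<And>k. k \<ge> 1 \<Longrightarrow> 0 < w k"
    and div: "filterlim (\<lambda>n. \<Sum>k=1..n. w k) at_top sequentially"
    and u: "u \<longlonglongrightarrow> l"
  shows "(\<lambda>n. (\<Sum>k=1..n. w k * u k) / (\<Sum>k=1..n. w k)) \<longlonglongrightarrow> l"
proof -
  define S where "S n = (\<Sum>k=1..n. w k)" for n
  have S_pos: "0 < S n" if "n \<ge> 1" for n
    unfolding S_def using pos that by (intro sum_pos) auto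
  have "(\<lambda>n. (\<Sum>k=1..n. w k * (u k - l)) / S n) \<longlonglongrightarrow> 0"
  proof (rule LIMSEQ_I)
    fix e :: real assume e: "0 < e"
    obtain N where N: "\<And>k. k \<ge> N \<Longrightarrow> \<bar>u k - l\<bar> < e / 2"
      using LIMSEQ_D[OF u, of "e/2"] e by auto
    define C where "C = (\<Sum>k=1..N. w k * \<bar>u k - l\<bar>)"
    have C: "C \<ge> 0" unfolding C_def by (intro sum_nonneg) (auto simp: pos less_imp_le)
    obtain N' where N': "\<And>n. n \<ge> N' \<Longrightarrow> S n > 2 * C / e"
      using div unfolding S_def[symmetric] filterlim_at_top_dense eventually_sequentially by blast
    show "\<exists>no. \<forall>n\<ge>no. norm ((\<Sum>k=1..n. w k * (u k - l)) / S n - 0) < e"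
    proof (intro exI allI impI)
      fix n assume n: "n \<ge> N + N' + 1"
      have Sn: "S n > 0" using S_pos n by auto
      have "\<bar>\<Sum>k=1..n. w k * (u k - l)\<bar> \<le> (\<Sum>k=1..n. w k * \<bar>u k - l\<bar>)"
        by (rule order_trans[OF sum_abs], rule sum_mono)
           (auto simp: abs_mult pos abs_of_pos)
      also have "\<dots> \<le> C + (\<Sum>k\<in>{N<..n}. w k * \<bar>u k - l\<bar>)"
      proof -
        have "{1..n} = {1..N} \<union> {N<..n}" using n by auto
        moreover have "{1..N} \<inter> {N<..n} = {}" by auto
        ultimately show ?thesis unfolding C_def by (simp add: sum.union_disjoint)
      qed
      also have "(\<Sum>k\<in>{N<..n}. w k * \<bar>u k - l\<bar>) \<le> (\<Sum>k\<in>{N<..n}. w k * (e / 2))"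
        using less_imp_le[OF N] pos by (intro sum_mono mult_left_mono) (auto simp: less_imp_le)
      also have "\<dots> \<le> (\<Sum>k=1..n. w k * (e / 2))"
        using e by (intro sum_mono2) (auto intro!: mult_nonneg_nonneg less_imp_le[OF pos])
      also have "\<dots> = S n * (e / 2)"
        by (simp add: S_def sum_distrib_right sum_divide_distrib)
      finally have 1: "\<bar>\<Sum>k=1..n. w k * (u k - l)\<bar> \<le> C + S n * (e / 2)" by simp
      have "C < S n * (e / 2)" using N'[of n] n e by (simp add: field_simps)
      with 1 have "\<bar>\<Sum>k=1..n. w k * (u k - l)\<bar> < S n * e" by (simp add: field_simps)
      then show "norm ((\<Sum>k=1..n. w k * (u k - l)) / S n - 0) < e"
        using Sn by (simp add: field_simps)
    qed
  qed
  then have "(\<lambda>n. (\<Sum>k=1..n. w k * (u k - l)) / S n + l) \<longlonglongrightarrow> 0 + l"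
    by (intro tendsto_intros)
  moreover have "\<forall>\<^sub>F n in sequentially.
      (\<Sum>k=1..n. w k * (u k - l)) / S n + l = (\<Sum>k=1..n. w k * u k) / S n"
    using eventually_ge_at_top[of 1]
  proof eventually_elim
    case (elim n)
    have "(\<Sum>k=1..n. w k * (u k - l)) = (\<Sum>k=1..n. w k * u k) - S n * l"
      by (simp add: S_def algebra_simps sum_subtractf sum_distrib_right sum_distrib_left)
    then show ?case using S_pos[OF elim] by (simp add: field_simps)
  qed
  ultimately show ?thesis
    by (simp add: tendsto_cong S_def)
qed

text \<open>
  The increment of \<open>n v\<^sub>n\<close>, divided by \<open>v\<^sub>n\<close>, tends to \<open>1 + \<beta> > 0\<close>. So \<open>n v\<^sub>n\<close> is eventually increasing, \<open>v\<^sub>n\<close>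
  is at least a multiple of \<open>1/n\<close>, and the harmonic series diverges.
\<close>

lemma GS_sum_at_top:
  assumes v: "v \<in> GS \<beta>" and \<beta>: "\<beta> > -1"
  shows "filterlim (\<lambda>n. \<Sum>k=1..n. v k) at_top sequentially"
proof -
  have "(\<lambda>n. real n * (1 - v (n - 1) / v n) + v (n - 1) / v n) \<longlonglongrightarrow> \<beta> + 1"
    by (intro tendsto_intros GS_lim[OF v] GS_ratio_tendsto_1[OF v])
  then have "\<forall>\<^sub>F n in sequentially. real n * (1 - v (n - 1) / v n) + v (n - 1) / v n > 0"
    using \<beta> by (intro order_tendstoD) auto
  then obtain N where N: "\<And>n. n \<ge> N \<Longrightarrow> real n * (1 - v (n - 1) / v n) + v (n - 1) / v n > 0"
    by (auto simp: eventually_sequentially)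
  define c where "c = real (N + 1) * v (N + 1)"
  have c: "c > 0" using GS_pos[OF v] by (simp add: c_def)
  have ge: "real n * v n \<ge> c" if "n \<ge> N + 1" for n
    using that
  proof (induction n rule: dec_induct)
    case base
    show ?case by (simp add: c_def)
  next
    case (step n)
    have "0 < real (Suc n) * (1 - v n / v (Suc n)) + v n / v (Suc n)"
      using N[of "Suc n"] step by simp
    moreover have "v (Suc n) > 0" using GS_pos[OF v] by simp
    ultimately have "0 < real (Suc n) * (v (Suc n) - v n) + v n"
      by (simp add: field_simps)
    then show ?case using step by (simp add: algebra_simps)
  qed
  have "\<not> summable v"
  proof
    assume "summable v"
    then have "summable (\<lambda>n. c * inverse (real n))"
    proof (rule summable_comparison_test_ev[rotated])
      show "\<forall>\<^sub>F n in sequentially. norm (c * inverse (real n)) \<le> v n"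
        using eventually_ge_at_top[of "N + 1"]
        by eventually_elim (use ge c in \<open>auto simp: field_simps\<close>)
    qed
    then show False
      using not_summable_harmonic[where 'a = real] c
      by (subst (asm) summable_cmult_iff) (auto simp: divide_inverse)
  qed
  define S where "S n = (\<Sum>k<n. v (Suc k))" for n
  have S_eq: "S n = (\<Sum>k=1..n. v k)" for n
    by (simp add: S_def sum.atLeast1_atMost_eq)
  have inc: "incseq S"
    unfolding S_def using GS_pos[OF v] by (intro incseq_SucI) (auto intro: less_imp_le)
  have "\<not> summable (\<lambda>n. v (Suc n))"
    using \<open>\<not> summable v\<close> by (simp add: summable_Suc_iff)
  then have "\<not> convergent S"
    by (simp add: summable_iff_convergent S_def[abs_def])
  then have unbounded: "\<exists>n. S n > B" for B
    using incseq_convergent[OF inc, of B] by (auto simp: convergent_def not_le[symmetric])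
  have "\<exists>N. \<forall>n\<ge>N. B \<le> S n" for B
    using unbounded[of B] inc by (meson incseqD less_imp_le order_trans)
  then show ?thesis
    by (simp add: filterlim_at_top eventually_sequentially S_eq)
qed

text \<open>
  Karamata's theorem for sums. The same increments telescope: \<open>n v\<^sub>n = \<Sum> v\<^sub>k d\<^sub>k\<close> with \<open>d\<^sub>k \<rightarrow> 1 + \<beta>\<close>, so that
  \<open>n v\<^sub>n / \<Sum> v\<^sub>k\<close> is a weighted average of the \<open>d\<^sub>k\<close>.
\<close>

lemma GS_sum_tendsto:
  assumes v: "v \<in> GS \<beta>" and \<beta>: "\<beta> > -1"
  shows "(\<lambda>n. (\<Sum>k=1..n. v k) / (real n * v n)) \<longlonglongrightarrow> 1 / (1 + \<beta>)"
proof -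
  define d where "d n = real n * (1 - v (n - 1) / v n) + v (n - 1) / v n" for n
  have "d \<longlonglongrightarrow> \<beta> + 1"
    unfolding d_def by (intro tendsto_intros GS_lim[OF v] GS_ratio_tendsto_1[OF v])
  then have "(\<lambda>n. (\<Sum>k=1..n. v k * d k) / (\<Sum>k=1..n. v k)) \<longlonglongrightarrow> \<beta> + 1"
    by (intro weighted_cesaro GS_pos[OF v] GS_sum_at_top[OF v \<beta>])
  moreover have "(\<Sum>k=1..n. v k * d k) = real n * v n" for n
  proof (induction n)
    case (Suc n)
    have "v (Suc n) > 0" using GS_pos[OF v] by simp
    then have "v (Suc n) * d (Suc n) = real (Suc n) * v (Suc n) - real n * v n"
      by (simp add: d_def field_simps)
    with Suc show ?case by simp
  qed simp
  ultimately have "(\<lambda>n. inverse ((real n * v n) / (\<Sum>k=1..n. v k))) \<longlonglongrightarrow> inverse (\<beta> + 1)"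
    using \<beta> by (intro tendsto_inverse) auto
  then show ?thesis by (simp add: field_simps)
qed

lemma GS_weighted_sum_tendsto:
  assumes v: "v \<in> GS \<beta>" and \<beta>: "\<beta> > -1" and u: "u \<longlonglongrightarrow> l"
  shows "(\<lambda>n. (\<Sum>k=1..n. v k * u k) / (real n * v n)) \<longlonglongrightarrow> l / (1 + \<beta>)"
proof -
  have "(\<lambda>n. (\<Sum>k=1..n. v k * u k) / (\<Sum>k=1..n. v k) * ((\<Sum>k=1..n. v k) / (real n * v n)))
      \<longlonglongrightarrow> l * (1 / (1 + \<beta>))"
    by (intro tendsto_mult weighted_cesaro[OF GS_pos[OF v] GS_sum_at_top[OF v \<beta>] u]
        GS_sum_tendsto[OF v \<beta>])
  moreover have "\<forall>\<^sub>F n in sequentially. (\<Sum>k=1..n. v k * u k) / (\<Sum>k=1..n. v k)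
      * ((\<Sum>k=1..n. v k) / (real n * v n)) = (\<Sum>k=1..n. v k * u k) / (real n * v n)"
    using eventually_ge_at_top[of 1]
  proof eventually_elim
    case (elim n)
    then have "(\<Sum>k=1..n. v k) > 0" using GS_pos[OF v] by (intro sum_pos) auto
    then show ?case by simp
  qed
  ultimately show ?thesis
    using Lim_transform_eventually by fastforce
qed

lemma convergent_bound:
  fixes f :: "nat \<Rightarrow> real"
  assumes "f \<longlonglongrightarrow> l"
  obtains C where "C > 0" "\<And>n. \<bar>f n\<bar> \<le> C"
  using convergent_imp_Bseq[OF convergentI[OF assms]] by (auto simp: Bseq_def)

lemma GS_sum_bound:
  assumes v: "v \<in> GS \<beta>" and \<beta>: "\<beta> > -1"
  obtains C where "C > 0" "\<And>n. n \<ge> 1 \<Longrightarrow> (\<Sum>k=1..n. v k) \<le> C * (real n * v n)"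
proof -
  obtain C where C: "C > 0" "\<And>n. \<bar>(\<Sum>k=1..n. v k) / (real n * v n)\<bar> \<le> C"
    using convergent_bound[OF GS_sum_tendsto[OF v \<beta>]] by blast
  have "(\<Sum>k=1..n. v k) \<le> C * (real n * v n)" if "n \<ge> 1" for n
    using C(2)[of n] GS_pos[OF v that] that by (simp add: field_simps abs_le_iff)
  with C(1) that show thesis by blast
qed

text \<open>
  The sequence \<open>v\<^sub>n / n\<close> lies in \<open>GS (\<beta> - 1)\<close> with \<open>\<beta> - 1 > -1\<close>: its partial sums diverge, yet they are at most
  of the order \<open>v\<^sub>n\<close>.
\<close>

lemma GS_at_top:
  assumes v: "v \<in> GS \<beta>" and \<beta>: "\<beta> > 0"
  shows "filterlim v at_top sequentially"
proof -
  have w: "(\<lambda>n. v n / real n) \<in> GS (\<beta> - 1)"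
    by (intro GS_divide v GS_real)
  then obtain C where C: "C > 0"
      "\<And>n. n \<ge> 1 \<Longrightarrow> (\<Sum>k=1..n. v k / real k) \<le> C * (real n * (v n / real n))"
    using GS_sum_bound[OF w] \<beta> by auto
  have "filterlim (\<lambda>n. inverse C * (\<Sum>k=1..n. v k / real k)) at_top sequentially"
    using \<beta> C(1) by (intro filterlim_tendsto_pos_mult_at_top[OF tendsto_const] GS_sum_at_top[OF w]) auto
  then show ?thesis
    by (rule filterlim_at_top_mono)
       (use eventually_ge_at_top[of 1] in eventually_elim, use C in \<open>auto simp: field_simps\<close>)
qed

lemma GS_tendsto_0:
  assumes v: "v \<in> GS \<beta>" and \<beta>: "\<beta> < 0"
  shows "v \<longlonglongrightarrow> 0"
  using tendsto_inverse_0_at_top[OF GS_at_top[OF GS_inverse[OF v]]] \<beta> by simp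

lemma GS_increment_bound:
  assumes v: "v \<in> GS \<beta>"
  obtains C where "C > 0" "\<And>n. n \<ge> 1 \<Longrightarrow> \<bar>v n - v (n - 1)\<bar> \<le> C * (v n / real n)"
proof -
  obtain C where C: "C > 0" "\<And>n. \<bar>real n * (1 - v (n - 1) / v n)\<bar> \<le> C"
    using convergent_bound[OF GS_lim[OF v]] by blast
  have "\<bar>v n - v (n - 1)\<bar> \<le> C * (v n / real n)" if n: "n \<ge> 1" for n
  proof -
    have "\<bar>v n - v (n - 1)\<bar> = \<bar>real n * (1 - v (n - 1) / v n)\<bar> * (v n / real n)"
    proof -
      have "v n - v (n - 1) = real n * (1 - v (n - 1) / v n) * (v n / real n)"
        using GS_pos[OF v n] n by (simp add: field_simps)
      then have "\<bar>v n - v (n - 1)\<bar> = \<bar>real n * (1 - v (n - 1) / v n)\<bar> * \<bar>v n / real n\<bar>"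
        by (simp only: abs_mult)
      then show ?thesis using GS_pos[OF v n] by simp
    qed
    also have "\<dots> \<le> C * (v n / real n)"
      using C(2) GS_pos[OF v n] by (intro mult_right_mono) auto
    finally show ?thesis .
  qed
  with C(1) that show thesis by blast
qed

text \<open>
  Consider \<open>m\<^sub>n / b\<^sub>n\<close>. Replacing \<open>b\<^sub>n\<^sub>-\<^sub>1\<close> by \<open>b\<^sub>n\<close> costs a factor \<open>1 + O(1/n)\<close>, which half of the contraction
  \<open>1 - c \<gamma>\<^sub>n\<close> absorbs because \<open>n \<gamma>\<^sub>n \<rightarrow> \<infinity>\<close>. The remaining half preserves every upper bound that is at
  least \<open>2 D / c\<close>.
\<close>

lemma recursion_bound:
  fixes m b \<gamma> :: "nat \<Rightarrow> real"
  assumes b: "b \<in> GS \<beta>"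
    and \<gamma>_pos: "\<And>n. n \<ge> 1 \<Longrightarrow> 0 < \<gamma> n" and \<gamma>0: "\<gamma> \<longlonglongrightarrow> 0"
    and n\<gamma>: "filterlim (\<lambda>n. real n * \<gamma> n) at_top sequentially"
    and c: "0 < c" and D: "0 \<le> D" and m: "\<And>n. 0 \<le> m n"
    and rec: "\<forall>\<^sub>F n in sequentially. m n \<le> (1 - c * \<gamma> n) * m (n - 1) + D * \<gamma> n * b n"
  obtains C where "C > 0" "\<And>n. n \<ge> 1 \<Longrightarrow> m n \<le> C * b n"
proof -
  obtain E where E: "E > 0" "\<And>n. \<bar>real n * (1 - b (n - 1) / b n)\<bar> \<le> E"
    using convergent_bound[OF GS_lim[OF b]] by blast
  have "\<forall>\<^sub>F n in sequentially. c * \<gamma> n < 1"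
    using tendsto_mult[OF tendsto_const \<gamma>0, of c] by (intro order_tendstoD) auto
  moreover have "\<forall>\<^sub>F n in sequentially. real n * \<gamma> n \<ge> 2 * E / c"
    using n\<gamma> by (simp add: filterlim_at_top)
  ultimately have "\<forall>\<^sub>F n in sequentially. m n / b n \<le>
      (1 - c / 2 * \<gamma> n) * (m (n - 1) / b (n - 1)) + D * \<gamma> n"
    using rec eventually_ge_at_top[of 2]
  proof eventually_elim
    case (elim n)
    have bn: "b n > 0" "b (n - 1) > 0" and gn: "\<gamma> n > 0"
      using GS_pos[OF b, of n] GS_pos[OF b, of "n - 1"] \<gamma>_pos[of n] elim by auto
    have "- E \<le> real n * (1 - b (n - 1) / b n)" using E(2)[of n] by (simp add: abs_le_iff)
    moreover have "E \<le> real n * (c / 2 * \<gamma> n)" using elim c by (simp add: field_simps)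
    ultimately have "real n * (b (n - 1) / b n) \<le> real n * (1 + c / 2 * \<gamma> n)"
      by (simp add: algebra_simps)
    then have ratio: "b (n - 1) / b n \<le> 1 + c / 2 * \<gamma> n"
      using elim by (simp only: mult_le_cancel_left_pos of_nat_0_less_iff)
    have "m n / b n \<le> (1 - c * \<gamma> n) * (m (n - 1) / b (n - 1)) * (b (n - 1) / b n) + D * \<gamma> n"
    proof -
      have "m n / b n \<le> ((1 - c * \<gamma> n) * m (n - 1) + D * \<gamma> n * b n) / b n"
        using elim(3) bn by (intro divide_right_mono) auto
      then show ?thesis using bn by (simp add: add_divide_distrib)
    qed
    also have "\<dots> \<le> (1 - c * \<gamma> n) * (m (n - 1) / b (n - 1)) * (1 + c / 2 * \<gamma> n) + D * \<gamma> n"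
      using ratio elim m[of "n - 1"] bn by (intro add_right_mono mult_left_mono) auto
    also have "\<dots> = ((1 - c * \<gamma> n) * (1 + c / 2 * \<gamma> n)) * (m (n - 1) / b (n - 1)) + D * \<gamma> n"
      by (simp only: ac_simps)
    also have "\<dots> \<le> (1 - c / 2 * \<gamma> n) * (m (n - 1) / b (n - 1)) + D * \<gamma> n"
      using m[of "n - 1"] bn gn c by (intro add_right_mono mult_right_mono) (auto simp: field_simps)
    finally show ?case .
  qed
  moreover have "\<forall>\<^sub>F n in sequentially. c / 2 * \<gamma> n < 1"
    using tendsto_mult[OF tendsto_const \<gamma>0, of "c/2"] by (intro order_tendstoD(2)[where y = 0]) auto
  ultimately have "\<forall>\<^sub>F n in sequentially. c / 2 * \<gamma> n < 1 \<and> m n / b n \<le>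
      (1 - c / 2 * \<gamma> n) * (m (n - 1) / b (n - 1)) + D * \<gamma> n"
    by eventually_elim auto
  then obtain N where N: "\<And>n. n \<ge> N \<Longrightarrow> c / 2 * \<gamma> n < 1 \<and> m n / b n \<le>
      (1 - c / 2 * \<gamma> n) * (m (n - 1) / b (n - 1)) + D * \<gamma> n"
    by (auto simp: eventually_sequentially)
  (* The sum takes care of the initial segment, on which the recursive inequality may fail. *)
  define C where "C = 1 + 2 * D / c + (\<Sum>k=1..Suc N. m k / b k)"
  have nn: "0 \<le> m k / b k" if "k \<ge> 1" for k
    using m[of k] GS_pos[OF b that] by simp
  have C: "C > 0" unfolding C_def
    using c D nn by (intro add_pos_nonneg sum_nonneg) auto
  have C2: "D \<le> c / 2 * C"
  proof -
    have "c / 2 * (2 * D / c) \<le> c / 2 * C"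
      unfolding C_def using c nn by (intro mult_left_mono) (auto intro!: add_nonneg_nonneg sum_nonneg)
    then show ?thesis using c by simp
  qed
  have small: "m k / b k \<le> C" if "k \<ge> 1" "k \<le> Suc N" for k
  proof -
    have "m k / b k \<le> (\<Sum>k=1..Suc N. m k / b k)"
      using that nn by (intro member_le_sum) auto
    also have "\<dots> \<le> C" unfolding C_def using c D by simp
    finally show ?thesis .
  qed
  have large: "m n / b n \<le> C" if "n \<ge> Suc N" for n
    using that
  proof (induction n rule: dec_induct)
    case base
    show ?case by (rule small) auto
  next
    case (step n)
    have g: "\<gamma> (Suc n) > 0" using \<gamma>_pos by simp
    have "m (Suc n) / b (Suc n) \<le> (1 - c / 2 * \<gamma> (Suc n)) * (m n / b n) + D * \<gamma> (Suc n)"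
      using N[of "Suc n"] step by simp
    also have "\<dots> \<le> (1 - c / 2 * \<gamma> (Suc n)) * C + (c / 2 * C) * \<gamma> (Suc n)"
      using N[of "Suc n"] step C2 g by (intro add_mono mult_left_mono mult_right_mono) auto
    also have "\<dots> = C" by (simp add: algebra_simps)
    finally show ?case .
  qed
  have "m n \<le> C * b n" if "n \<ge> 1" for n
    using small[of n] large[of n] GS_pos[OF b that] that by (cases "n \<le> Suc N") (auto simp: field_simps)
  with C that show thesis by blast
qed



section \<open>Characteristic functions and the Lyapunov central limit theorem\<close>

lemma gaussian_eq_distr_std_normal:
  assumes "0 < v"
  shows "gaussian 0 v = distr std_normal_distribution borel (\<lambda>x. sqrt v * x)"
proof -
  interpret prob_space std_normal_distribution
    by (simp add: prob_space_normal_density)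
  have "distributed std_normal_distribution lborel (\<lambda>x. x) std_normal_density"
    by (auto simp: distributed_def distr_id2)
  then have "distributed std_normal_distribution lborel (\<lambda>x. 0 + sqrt v * x)
      (normal_density (0 + sqrt v * 0) (\<bar>sqrt v\<bar> * 1))"
    using assms by (intro normal_density_affine) auto
  then have "distr std_normal_distribution lborel (\<lambda>x. sqrt v * x) = density lborel (normal_density 0 (sqrt v))"
    using assms by (simp add: distributed_def)
  moreover have "distr std_normal_distribution borel (\<lambda>x. sqrt v * x)
      = distr std_normal_distribution lborel (\<lambda>x. sqrt v * x)"
    by (intro distr_cong) auto
  ultimately show ?thesis
    using assms by (simp add: gaussian_def)
qed

lemma real_distribution_gaussian:
  assumes "0 < v"
  shows "real_distribution (gaussian 0 v)"
proof -
  interpret real_distribution std_normal_distribution by (rule real_dist_normal_dist)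
  show ?thesis
    unfolding gaussian_eq_distr_std_normal[OF assms] by (rule real_distribution_distr) simp
qed

lemma char_gaussian:
  assumes "0 < v"
  shows "char (gaussian 0 v) t = complex_of_real (exp (- (t\<^sup>2 * v / 2)))"
proof -
  have "char (gaussian 0 v) t = char std_normal_distribution (t * sqrt v)"
    unfolding gaussian_eq_distr_std_normal[OF assms]
    by (simp add: char_def integral_distr mult.assoc)
  then show ?thesis
    using assms by (simp add: char_std_normal_distribution power_mult_distrib)
qed

text \<open>
  The power \<open>3/2\<close> is chosen so that, for \<open>u\<close> a multiple of a variance, the error is controlled by a third
  absolute moment (\<open>third_moment_ge_cube_of_L2_norm\<close>).
\<close>

lemma second_order_exp_bound:
  fixes u :: real
  assumes "0 \<le> u"
  shows "\<bar>exp (- u) - (1 - u)\<bar> \<le> u powr (3 / 2)"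
proof (cases "u \<le> 1")
  case True
  have "0\<^sup>2 / 2 - 0 + 1 - exp (- 0) \<le> u\<^sup>2 / 2 - u + 1 - exp (- u)"
  proof (rule DERIV_nonneg_imp_nondecreasing[OF assms])
    fix y :: real assume "0 \<le> y" "y \<le> u"
    have "((\<lambda>y. y\<^sup>2 / 2 - y + 1 - exp (- y)) has_real_derivative (y - 1 + exp (- y))) (at y)"
      by (auto intro!: derivative_eq_intros)
    moreover have "0 \<le> y - 1 + exp (- y)"
      using exp_ge_add_one_self[of "- y"] by simp
    ultimately show "\<exists>d. ((\<lambda>y. y\<^sup>2 / 2 - y + 1 - exp (- y)) has_real_derivative d) (at y) \<and> 0 \<le> d"
      by blast
  qed
  then have "\<bar>exp (- u) - (1 - u)\<bar> \<le> u\<^sup>2 / 2"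
    using exp_ge_add_one_self[of "- u"] by (simp add: abs_le_iff)
  also have "\<dots> \<le> u powr (3/2)"
  proof (cases "u = 0")
    case False
    then have "u\<^sup>2 = u powr 2" using assms by (simp add: powr_numeral)
    also have "\<dots> \<le> u powr (3/2)" using True assms False by (intro powr_mono') auto
    finally show ?thesis using zero_le_power2[of u] by linarith
  qed simp
  finally show ?thesis .
next
  case False
  have "\<bar>exp (- u) - (1 - u)\<bar> \<le> u"
    using exp_ge_add_one_self[of "- u"] assms by (auto simp: abs_le_iff)
  also have "\<dots> \<le> u powr (3/2)"
    using powr_mono[of 1 "3/2" u] False by simp
  finally show ?thesis .
qed

context prob_space
begin

text \<open>
  A case of Lyapunov's moment inequality, obtained by integrating \<open>3 s y\<^sup>2 \<le> 2 \<bar>y\<bar>\<^sup>3 + s\<^sup>3\<close> at \<open>s\<close> equal to the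
  \<open>L\<^sup>2\<close> norm.
\<close>

lemma third_moment_ge_cube_of_L2_norm:
  assumes [measurable]: "X \<in> borel_measurable M"
    and int: "integrable M (\<lambda>\<omega>. (X \<omega>)\<^sup>2)" "integrable M (\<lambda>\<omega>. \<bar>X \<omega>\<bar> ^ 3)"
  shows "sqrt (expectation (\<lambda>\<omega>. (X \<omega>)\<^sup>2)) ^ 3 \<le> expectation (\<lambda>\<omega>. \<bar>X \<omega>\<bar> ^ 3)"
proof -
  define s where "s = sqrt (expectation (\<lambda>\<omega>. (X \<omega>)\<^sup>2))"
  have s: "s \<ge> 0" "s\<^sup>2 = expectation (\<lambda>\<omega>. (X \<omega>)\<^sup>2)"
    by (auto simp: s_def)
  have pt: "3 * s * y\<^sup>2 \<le> 2 * \<bar>y\<bar> ^ 3 + s ^ 3" for y :: real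
  proof -
    have "2 * \<bar>y\<bar> ^ 3 + s ^ 3 - 3 * s * \<bar>y\<bar>\<^sup>2 = (\<bar>y\<bar> - s)\<^sup>2 * (2 * \<bar>y\<bar> + s)"
      by (simp add: power2_eq_square power3_eq_cube algebra_simps)
    also have "\<dots> \<ge> 0" using s by (intro mult_nonneg_nonneg) auto
    finally show ?thesis by simp
  qed
  have "expectation (\<lambda>\<omega>. 3 * s * (X \<omega>)\<^sup>2) \<le> expectation (\<lambda>\<omega>. 2 * \<bar>X \<omega>\<bar> ^ 3 + s ^ 3)"
    using int by (intro integral_mono pt) auto
  then have "3 * s * s\<^sup>2 \<le> 2 * expectation (\<lambda>\<omega>. \<bar>X \<omega>\<bar> ^ 3) + s ^ 3"
    using int s(2) by (simp add: prob_space)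
  then show ?thesis
    unfolding s_def[symmetric] by (simp add: power2_eq_square power3_eq_cube)
qed

text \<open>
  Both the characteristic function of \<open>X\<close> and its Gaussian counterpart differ from \<open>1 - t\<^sup>2 \<sigma>\<^sup>2 / 2\<close> by a
  multiple of \<open>\<bar>t\<bar>\<^sup>3 E \<bar>X\<bar>\<^sup>3\<close>.
\<close>

lemma char_centered_bound:
  assumes [measurable]: "X \<in> borel_measurable M"
    and int: "integrable M (\<lambda>\<omega>. (X \<omega>)\<^sup>2)" "integrable M (\<lambda>\<omega>. \<bar>X \<omega>\<bar> ^ 3)"
    and mean: "expectation X = 0"
  shows "cmod (char (distr M borel X) t - complex_of_real (exp (- (t\<^sup>2 * expectation (\<lambda>\<omega>. (X \<omega>)\<^sup>2) / 2))))
    \<le> 2 * \<bar>t\<bar> ^ 3 * expectation (\<lambda>\<omega>. \<bar>X \<omega>\<bar> ^ 3)"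
proof -
  define \<sigma>2 where "\<sigma>2 = expectation (\<lambda>\<omega>. (X \<omega>)\<^sup>2)"
  define \<rho> where "\<rho> = expectation (\<lambda>\<omega>. \<bar>X \<omega>\<bar> ^ 3)"
  define u where "u = t\<^sup>2 * \<sigma>2 / 2"
  have intX: "integrable M X"
    by (rule square_integrable_imp_integrable[OF _ int(1)]) simp
  have \<sigma>2: "\<sigma>2 \<ge> 0" by (simp add: \<sigma>2_def)
  have \<rho>: "\<rho> \<ge> 0" by (simp add: \<rho>_def)
  have "cmod (char (distr M borel X) t - (1 - t^2 * \<sigma>2 / 2)) \<le>
      (t\<^sup>2 / 6) * expectation (\<lambda>x. min (6 * (X x)\<^sup>2) (\<bar>t\<bar> * \<bar>X x\<bar> ^ 3))"
    using mean int intX by (intro char_approx3') (auto simp: \<sigma>2_def)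
  also have "\<dots> \<le> (t\<^sup>2 / 6) * expectation (\<lambda>x. \<bar>t\<bar> * \<bar>X x\<bar> ^ 3)"
    using int by (intro mult_left_mono integral_mono) auto
  also have "\<dots> = \<bar>t\<bar> ^ 3 * \<rho> / 6"
  proof -
    have "t\<^sup>2 * \<bar>t\<bar> = \<bar>t\<bar> ^ 3"
      by (metis mult.commute numeral_3_eq_3 numeral_2_eq_2 power_Suc power2_abs)
    then show ?thesis by (simp add: \<rho>_def)
  qed
  finally have 1: "cmod (char (distr M borel X) t - (1 - u)) \<le> \<bar>t\<bar> ^ 3 * \<rho> / 6"
    by (simp add: u_def)
  have u: "u \<ge> 0" using \<sigma>2 by (simp add: u_def)
  have "\<bar>exp (- u) - (1 - u)\<bar> \<le> u powr (3 / 2)"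
    by (rule second_order_exp_bound[OF u])
  also have "\<dots> = sqrt u ^ 3"
  proof (cases "u = 0")
    case False
    then have "sqrt u ^ 3 = sqrt u powr 3" using u by (simp add: powr_numeral)
    also have "\<dots> = u powr (3 / 2)" using u by (simp add: powr_powr flip: powr_half_sqrt)
    finally show ?thesis by simp
  qed simp
  also have "\<dots> \<le> (\<bar>t\<bar> * sqrt \<sigma>2) ^ 3"
  proof (rule power_mono)
    have "sqrt u \<le> sqrt (t\<^sup>2 * \<sigma>2)" using \<sigma>2 by (simp add: u_def)
    then show "sqrt u \<le> \<bar>t\<bar> * sqrt \<sigma>2" by (simp add: real_sqrt_mult)
  qed (use u in auto)
  also have "\<dots> \<le> \<bar>t\<bar> ^ 3 * \<rho>"
    using third_moment_ge_cube_of_L2_norm[OF assms(1) int]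
    by (auto simp: power_mult_distrib \<sigma>2_def \<rho>_def intro: mult_left_mono)
  finally have "cmod (complex_of_real (exp (- u) - (1 - u))) \<le> \<bar>t\<bar> ^ 3 * \<rho>"
    by (simp only: norm_of_real)
  then have 2: "cmod ((1 - u) - complex_of_real (exp (- u))) \<le> \<bar>t\<bar> ^ 3 * \<rho>"
    by (simp add: norm_minus_commute)
  have "cmod (char (distr M borel X) t - complex_of_real (exp (- u))) \<le> \<bar>t\<bar> ^ 3 * \<rho> / 6 + \<bar>t\<bar> ^ 3 * \<rho>"
    using norm_triangle_le_diff[of _ _] norm_triangle_mono[OF 1 2] by simp
  also have "\<dots> \<le> 2 * \<bar>t\<bar> ^ 3 * \<rho>"
    using \<rho> by simp
  finally show ?thesis by (simp add: u_def \<sigma>2_def \<rho>_def)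
qed

text \<open>
  The function \<open>y \<mapsto> exp (\<i> t y)\<close> is Lipschitz with constant \<open>\<bar>t\<bar>\<close>; a remainder that is small in \<open>L\<^sup>1\<close> can thus be
  dropped from a characteristic function, which takes the place of Slutsky's lemma.
\<close>

lemma char_perturbation_bound:
  assumes [measurable]: "A \<in> borel_measurable M" and R: "integrable M R"
  shows "cmod (char (distr M borel (\<lambda>\<omega>. A \<omega> + R \<omega>)) t - char (distr M borel A) t)
    \<le> \<bar>t\<bar> * expectation (\<lambda>\<omega>. \<bar>R \<omega>\<bar>)"
proof -
  have [measurable]: "R \<in> borel_measurable M" using R by simp
  have int: "integrable M (\<lambda>\<omega>. iexp (t * f \<omega>))" if [measurable]: "f \<in> borel_measurable M" for f
    by (rule integrable_const_bound[of _ 1]) auto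
  have "char (distr M borel (\<lambda>\<omega>. A \<omega> + R \<omega>)) t - char (distr M borel A) t
      = (CLINT \<omega>|M. iexp (t * (A \<omega> + R \<omega>)) - iexp (t * A \<omega>))"
    by (simp add: char_def integral_distr int del: of_real_add of_real_mult)
  also have "cmod \<dots> \<le> expectation (\<lambda>\<omega>. \<bar>t\<bar> * \<bar>R \<omega>\<bar>)"
  proof (rule order_trans[OF integral_norm_bound], rule integral_mono)
    show "integrable M (\<lambda>\<omega>. cmod (iexp (t * (A \<omega> + R \<omega>)) - iexp (t * A \<omega>)))"
      by (intro integrable_norm Bochner_Integration.integrable_diff int) auto
    show "integrable M (\<lambda>\<omega>. \<bar>t\<bar> * \<bar>R \<omega>\<bar>)" using R by simp
    fix \<omega>
    have "iexp (t * (A \<omega> + R \<omega>)) - iexp (t * A \<omega>) = iexp (t * A \<omega>) * (iexp (t * R \<omega>) - 1)"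
      by (simp add: algebra_simps exp_add)
    then show "cmod (iexp (t * (A \<omega> + R \<omega>)) - iexp (t * A \<omega>)) \<le> \<bar>t\<bar> * \<bar>R \<omega>\<bar>"
      using iexp_approx1[of "t * R \<omega>" 0] by (simp add: norm_mult abs_mult)
  qed
  finally show ?thesis using R by simp
qed

text \<open>
  The characteristic function of the weighted sum is a product over \<open>k\<close>, and products of numbers in the
  unit disc differ by at most the sum of the differences of their factors. Each factor is compared with a
  Gaussian one by \<open>char_centered_bound\<close>, and the total error is the Lyapunov sum.
\<close>

theorem lyapunov_with_negligible_remainder:
  fixes \<eta> :: "nat \<Rightarrow> 'a \<Rightarrow> real" and w :: "nat \<Rightarrow> nat \<Rightarrow> real"
  assumes indep: "indep_vars (\<lambda>_. borel) \<eta> {1..}"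
    and sq: "\<And>k. k \<ge> 1 \<Longrightarrow> integrable M (\<lambda>\<omega>. (\<eta> k \<omega>)\<^sup>2)"
    and cube: "\<And>k. k \<ge> 1 \<Longrightarrow> integrable M (\<lambda>\<omega>. \<bar>\<eta> k \<omega>\<bar> ^ 3)"
    and mean: "\<And>k. k \<ge> 1 \<Longrightarrow> expectation (\<eta> k) = 0"
    and v: "0 < v"
    and var: "(\<lambda>n. \<Sum>k=1..n. (w n k)\<^sup>2 * expectation (\<lambda>\<omega>. (\<eta> k \<omega>)\<^sup>2)) \<longlonglongrightarrow> v"
    and lyapunov: "(\<lambda>n. \<Sum>k=1..n. \<bar>w n k\<bar> ^ 3 * expectation (\<lambda>\<omega>. \<bar>\<eta> k \<omega>\<bar> ^ 3)) \<longlonglongrightarrow> 0"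
    and R: "\<And>n. integrable M (R n)" and R0: "(\<lambda>n. expectation (\<lambda>\<omega>. \<bar>R n \<omega>\<bar>)) \<longlonglongrightarrow> 0"
  shows "weak_conv_m (\<lambda>n. distr M borel (\<lambda>\<omega>. (\<Sum>k=1..n. w n k * \<eta> k \<omega>) + R n \<omega>)) (gaussian 0 v)"
proof (rule levy_continuity)
  have \<eta>_meas: "\<eta> k \<in> borel_measurable M" if "k \<ge> 1" for k
    using indep that by (auto simp: indep_vars_def2)
  have A_meas [measurable]: "(\<lambda>\<omega>. \<Sum>k=1..n. w n k * \<eta> k \<omega>) \<in> borel_measurable M" for n
    using \<eta>_meas by auto
  have [measurable]: "R n \<in> borel_measurable M" for n using R by simp
  show "real_distribution (distr M borel (\<lambda>\<omega>. (\<Sum>k=1..n. w n k * \<eta> k \<omega>) + R n \<omega>))" for n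
    by (intro real_distribution_distr borel_measurable_add A_meas) simp
  show "real_distribution (gaussian 0 v)" by (rule real_distribution_gaussian[OF v])
  fix t
  define A where "A n \<omega> = (\<Sum>k=1..n. w n k * \<eta> k \<omega>)" for n \<omega>
  define \<sigma>2 where "\<sigma>2 k = expectation (\<lambda>\<omega>. (\<eta> k \<omega>)\<^sup>2)" for k
  define \<rho> where "\<rho> k = expectation (\<lambda>\<omega>. \<bar>\<eta> k \<omega>\<bar> ^ 3)" for k
  define E where "E n = complex_of_real (exp (- (t\<^sup>2 * (\<Sum>k=1..n. (w n k)\<^sup>2 * \<sigma>2 k) / 2)))" for n
  have char_A: "cmod (char (distr M borel (A n)) t - E n)
      \<le> 2 * \<bar>t\<bar> ^ 3 * (\<Sum>k=1..n. \<bar>w n k\<bar> ^ 3 * \<rho> k)" for n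
  proof -
    have ind: "indep_vars (\<lambda>_. borel) (\<lambda>k \<omega>. w n k * \<eta> k \<omega>) {1..n}"
      by (rule indep_vars_compose2[OF indep_vars_subset[OF indep]]) auto
    have "E n = (\<Prod>k=1..n. complex_of_real (exp (- (t\<^sup>2 * ((w n k)\<^sup>2 * \<sigma>2 k) / 2))))"
      unfolding E_def of_real_prod[symmetric]
      by (subst exp_sum[symmetric]) (simp_all add: sum_distrib_left sum_divide_distrib sum_negf)
    then have "cmod (char (distr M borel (A n)) t - E n)
        = cmod ((\<Prod>k=1..n. char (distr M borel (\<lambda>\<omega>. w n k * \<eta> k \<omega>)) t)
          - (\<Prod>k=1..n. complex_of_real (exp (- (t\<^sup>2 * ((w n k)\<^sup>2 * \<sigma>2 k) / 2)))))"
      unfolding A_def using char_distr_sum[OF ind] by simp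
    also have "\<dots> \<le> (\<Sum>k=1..n. cmod (char (distr M borel (\<lambda>\<omega>. w n k * \<eta> k \<omega>)) t
        - complex_of_real (exp (- (t\<^sup>2 * ((w n k)\<^sup>2 * \<sigma>2 k) / 2)))))"
    proof (rule norm_prod_diff)
      fix k assume "k \<in> {1..n}"
      then interpret D: real_distribution "distr M borel (\<lambda>\<omega>. w n k * \<eta> k \<omega>)"
        using \<eta>_meas by (intro real_distribution_distr) auto
      show "cmod (char (distr M borel (\<lambda>\<omega>. w n k * \<eta> k \<omega>)) t) \<le> 1"
        by (rule D.cmod_char_le_1)
      show "cmod (complex_of_real (exp (- (t\<^sup>2 * ((w n k)\<^sup>2 * \<sigma>2 k) / 2)))) \<le> 1"
        by (simp add: \<sigma>2_def)
    qed
    also have "\<dots> \<le> (\<Sum>k=1..n. 2 * \<bar>t\<bar> ^ 3 * (\<bar>w n k\<bar> ^ 3 * \<rho> k))"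
    proof (rule sum_mono)
      fix k assume k: "k \<in> {1..n}"
      then show "cmod (char (distr M borel (\<lambda>\<omega>. w n k * \<eta> k \<omega>)) t
          - complex_of_real (exp (- (t\<^sup>2 * ((w n k)\<^sup>2 * \<sigma>2 k) / 2)))) \<le> 2 * \<bar>t\<bar> ^ 3 * (\<bar>w n k\<bar> ^ 3 * \<rho> k)"
        using char_centered_bound[of "\<lambda>\<omega>. w n k * \<eta> k \<omega>" t] sq[of k] cube[of k] mean[of k] \<eta>_meas[of k]
        by (simp add: power_mult_distrib abs_mult \<sigma>2_def \<rho>_def)
    qed
    finally show ?thesis by (simp add: sum_distrib_left)
  qed
  have "(\<lambda>n. char (distr M borel (A n)) t - E n) \<longlonglongrightarrow> 0"
    by (rule Lim_null_comparison[OF always_eventually[OF allI[OF char_A]]])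
       (use tendsto_mult[OF tendsto_const lyapunov, of "2 * \<bar>t\<bar> ^ 3"] in \<open>simp add: \<rho>_def\<close>)
  moreover have "(\<lambda>n. char (distr M borel (\<lambda>\<omega>. A n \<omega> + R n \<omega>)) t - char (distr M borel (A n)) t) \<longlonglongrightarrow> 0"
    by (rule Lim_null_comparison[OF always_eventually[OF allI[OF char_perturbation_bound]]])
       (use tendsto_mult[OF tendsto_const R0, of "\<bar>t\<bar>"] R A_meas in \<open>simp_all add: A_def\<close>)
  moreover have "E \<longlonglongrightarrow> complex_of_real (exp (- (t\<^sup>2 * v / 2)))"
    unfolding E_def \<sigma>2_def by (intro tendsto_intros var) simp
  ultimately have "(\<lambda>n. (char (distr M borel (\<lambda>\<omega>. A n \<omega> + R n \<omega>)) t - char (distr M borel (A n)) t)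
      + ((char (distr M borel (A n)) t - E n) + E n)) \<longlonglongrightarrow> 0 + (0 + complex_of_real (exp (- (t\<^sup>2 * v / 2))))"
    by (intro tendsto_add)
  then show "(\<lambda>n. char (distr M borel (\<lambda>\<omega>. (\<Sum>k=1..n. w n k * \<eta> k \<omega>) + R n \<omega>)) t)
      \<longlonglongrightarrow> char (gaussian 0 v) t"
    by (simp add: A_def char_gaussian[OF v])
qed

end



section \<open>A linear recursion driven by independent pairs\<close>

lemma abs_diff_cubed_le: "\<bar>x - y\<bar> ^ 3 \<le> 4 * \<bar>x\<bar> ^ 3 + 4 * \<bar>y\<bar> ^ 3" for x y :: real
proof -
  have "4 * \<bar>x\<bar> ^ 3 + 4 * \<bar>y\<bar> ^ 3 - (\<bar>x\<bar> + \<bar>y\<bar>) ^ 3 = 3 * (\<bar>x\<bar> + \<bar>y\<bar>) * (\<bar>x\<bar> - \<bar>y\<bar>)\<^sup>2"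
    by (simp add: power2_eq_square power3_eq_cube algebra_simps)
  moreover have "\<dots> \<ge> 0" by (intro mult_nonneg_nonneg) auto
  moreover have "\<bar>x - y\<bar> ^ 3 \<le> (\<bar>x\<bar> + \<bar>y\<bar>) ^ 3" by (intro power_mono) auto
  ultimately show ?thesis by linarith
qed

lemma (in prob_space) integrable_power_le:
  fixes X :: "'a \<Rightarrow> real"
  assumes [measurable]: "X \<in> borel_measurable M" and int: "integrable M (\<lambda>\<omega>. \<bar>X \<omega>\<bar> ^ m)" and "k \<le> m"
  shows "integrable M (\<lambda>\<omega>. X \<omega> ^ k)"
proof (rule Bochner_Integration.integrable_bound)
  show "integrable M (\<lambda>\<omega>. 1 + \<bar>X \<omega>\<bar> ^ m)" using int by simp
  have "\<bar>y\<bar> ^ k \<le> 1 + \<bar>y\<bar> ^ m" for y :: real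
  proof (cases "\<bar>y\<bar> \<le> 1")
    case True
    then have "\<bar>y\<bar> ^ k \<le> 1" by (simp add: power_le_one)
    then show ?thesis by (simp add: add_increasing2)
  next
    case False
    then have "\<bar>y\<bar> ^ k \<le> \<bar>y\<bar> ^ m" using \<open>k \<le> m\<close> by (intro power_increasing) auto
    then show ?thesis by simp
  qed
  then show "AE \<omega> in M. norm (X \<omega> ^ k) \<le> norm (1 + \<bar>X \<omega>\<bar> ^ m)"
    by (auto simp: power_abs intro!: AE_I2 order_trans[OF _ abs_ge_self])
qed simp

lemma (in prob_space) expectation_abs_le_sqrt:
  fixes X :: "'a \<Rightarrow> real"
  assumes [measurable]: "X \<in> borel_measurable M" and int: "integrable M (\<lambda>\<omega>. (X \<omega>)\<^sup>2)"
  shows "expectation (\<lambda>\<omega>. \<bar>X \<omega>\<bar>) \<le> sqrt (expectation (\<lambda>\<omega>. (X \<omega>)\<^sup>2))"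
proof (rule real_le_rsqrt)
  have "integrable M X"
    by (rule square_integrable_imp_integrable[OF _ int]) simp
  then have "variance (\<lambda>\<omega>. \<bar>X \<omega>\<bar>) = expectation (\<lambda>\<omega>. \<bar>X \<omega>\<bar>\<^sup>2) - (expectation (\<lambda>\<omega>. \<bar>X \<omega>\<bar>))\<^sup>2"
    using int by (intro variance_eq) auto
  moreover have "0 \<le> variance (\<lambda>\<omega>. \<bar>X \<omega>\<bar>)"
    by simp
  ultimately show "(expectation (\<lambda>\<omega>. \<bar>X \<omega>\<bar>))\<^sup>2 \<le> expectation (\<lambda>\<omega>. (X \<omega>)\<^sup>2)"
    unfolding power2_abs by linarith
qed

lemma (in prob_space) integrable_mult_square_integrable:
  fixes X Y :: "'a \<Rightarrow> real"
  assumes [measurable]: "X \<in> borel_measurable M" "Y \<in> borel_measurable M"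
    and "integrable M (\<lambda>\<omega>. (X \<omega>)\<^sup>2)" "integrable M (\<lambda>\<omega>. (Y \<omega>)\<^sup>2)"
  shows "integrable M (\<lambda>\<omega>. X \<omega> * Y \<omega>)"
    and "\<bar>expectation (\<lambda>\<omega>. X \<omega> * Y \<omega>)\<bar>
      \<le> (expectation (\<lambda>\<omega>. (X \<omega>)\<^sup>2) + expectation (\<lambda>\<omega>. (Y \<omega>)\<^sup>2)) / 2"
proof -
  have pt: "\<bar>x * y\<bar> \<le> (x\<^sup>2 + y\<^sup>2) / 2" for x y :: real
    using sum_squares_bound[of "\<bar>x\<bar>" "\<bar>y\<bar>"] by (simp add: abs_mult)
  show int: "integrable M (\<lambda>\<omega>. X \<omega> * Y \<omega>)"
    by (rule Bochner_Integration.integrable_bound[of _ "\<lambda>\<omega>. ((X \<omega>)\<^sup>2 + (Y \<omega>)\<^sup>2) / 2"])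
       (use assms pt in auto)
  have "\<bar>expectation (\<lambda>\<omega>. X \<omega> * Y \<omega>)\<bar> \<le> expectation (\<lambda>\<omega>. \<bar>X \<omega> * Y \<omega>\<bar>)"
    by (rule integral_abs_bound)
  also have "\<dots> \<le> expectation (\<lambda>\<omega>. ((X \<omega>)\<^sup>2 + (Y \<omega>)\<^sup>2) / 2)"
    using assms int by (intro integral_mono pt) auto
  finally show "\<bar>expectation (\<lambda>\<omega>. X \<omega> * Y \<omega>)\<bar>
      \<le> (expectation (\<lambda>\<omega>. (X \<omega>)\<^sup>2) + expectation (\<lambda>\<omega>. (Y \<omega>)\<^sup>2)) / 2"
    using assms by simp
qed

text \<open>
  The pair \<open>(\<zeta>\<^sub>n, \<xi>\<^sub>n)\<close> may be internally dependent, as it is for kernel estimators; independence is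
  required across \<open>n\<close> only.
\<close>

locale linear_stochastic_recursion = prob_space M for M :: "'w measure" +
  fixes \<zeta> \<xi> e :: "nat \<Rightarrow> 'w \<Rightarrow> real" and \<gamma> :: "nat \<Rightarrow> real" and e0 :: real
  assumes indep: "indep_vars (\<lambda>_. borel) (\<lambda>n \<omega>. (\<zeta> n \<omega>, \<xi> n \<omega>)) {1..}"
    and e_0: "\<And>\<omega>. e 0 \<omega> = e0"
    and e_Suc: "\<And>n \<omega>. e (Suc n) \<omega> = (1 - \<gamma> (Suc n) * \<zeta> (Suc n) \<omega>) * e n \<omega> + \<gamma> (Suc n) * \<xi> (Suc n) \<omega>"
    and \<zeta>_sq: "\<And>n. n \<ge> 1 \<Longrightarrow> integrable M (\<lambda>\<omega>. (\<zeta> n \<omega>)\<^sup>2)"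
    and \<xi>_cube: "\<And>n. n \<ge> 1 \<Longrightarrow> integrable M (\<lambda>\<omega>. \<bar>\<xi> n \<omega>\<bar> ^ 3)"
begin

lemma borel_measurable_fst_snd [measurable]:
  "fst \<in> borel_measurable (borel :: (real \<times> real) measure)"
  "snd \<in> borel_measurable (borel :: (real \<times> real) measure)"
  by (simp_all flip: borel_prod)

lemma pair_measurable: "n \<ge> 1 \<Longrightarrow> (\<lambda>\<omega>. (\<zeta> n \<omega>, \<xi> n \<omega>)) \<in> borel_measurable M"
  using indep by (auto simp: indep_vars_def2)

lemma \<zeta>_measurable: "n \<ge> 1 \<Longrightarrow> \<zeta> n \<in> borel_measurable M"
  using measurable_compose[OF pair_measurable borel_measurable_fst_snd(1)] by (simp add: comp_def)

lemma \<xi>_measurable: "n \<ge> 1 \<Longrightarrow> \<xi> n \<in> borel_measurable M"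
  using measurable_compose[OF pair_measurable borel_measurable_fst_snd(2)] by (simp add: comp_def)

lemma \<xi>_sq: "n \<ge> 1 \<Longrightarrow> integrable M (\<lambda>\<omega>. (\<xi> n \<omega>)\<^sup>2)"
  by (rule integrable_power_le[OF \<xi>_measurable \<xi>_cube]) auto

lemma \<xi>_integrable: "n \<ge> 1 \<Longrightarrow> integrable M (\<xi> n)"
  using integrable_power_le[OF \<xi>_measurable \<xi>_cube, of n 1] by simp

lemma \<zeta>_integrable: "n \<ge> 1 \<Longrightarrow> integrable M (\<zeta> n)"
  by (rule square_integrable_imp_integrable[OF \<zeta>_measurable \<zeta>_sq])

abbreviation path_space :: "nat \<Rightarrow> (nat \<Rightarrow> real \<times> real) measure" where
  "path_space n \<equiv> \<Pi>\<^sub>M k\<in>{1..n}. borel"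

abbreviation path :: "nat \<Rightarrow> 'w \<Rightarrow> nat \<Rightarrow> real \<times> real" where
  "path n \<omega> \<equiv> \<lambda>k\<in>{1..n}. (\<zeta> k \<omega>, \<xi> k \<omega>)"

text \<open>
  Dependence on the first \<open>n\<close> pairs, expressed as factorization through the product space rather than
  through a generated \<open>\<sigma>\<close>-algebra: independence of the next pair is then a matter of composition.
\<close>

definition adapted :: "nat \<Rightarrow> ('w \<Rightarrow> real) \<Rightarrow> bool" where
  "adapted n V \<longleftrightarrow> (\<exists>F\<in>borel_measurable (path_space n).
     \<forall>\<omega>. V \<omega> = F (path n \<omega>))"

lemma adaptedI:
  assumes "F \<in> borel_measurable (path_space n)"
    and "\<And>\<omega>. V \<omega> = F (path n \<omega>)"
  shows "adapted n V"
  using assms by (auto simp: adapted_def)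

lemma adapted_const: "adapted n (\<lambda>_. c)"
  by (rule adaptedI[of "\<lambda>_. c"]) auto

lemma adapted_combine:
  fixes G :: "real \<Rightarrow> real \<Rightarrow> real"
  assumes V: "adapted n V" and V': "adapted n V'" and G: "case_prod G \<in> borel_measurable (borel \<Otimes>\<^sub>M borel)"
  shows "adapted n (\<lambda>\<omega>. G (V \<omega>) (V' \<omega>))"
proof -
  obtain F F' where F [measurable]: "F \<in> borel_measurable (path_space n)"
      "F' \<in> borel_measurable (path_space n)"
    and eq: "\<And>\<omega>. V \<omega> = F (path n \<omega>)" "\<And>\<omega>. V' \<omega> = F' (path n \<omega>)"
    using V V' by (auto simp: adapted_def)
  have "(\<lambda>p. G (F p) (F' p)) \<in> borel_measurable (path_space n)"
    using measurable_compose[OF measurable_Pair[OF F] G] by simp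
  then show ?thesis
    by (rule adaptedI) (simp add: eq)
qed

lemma adapted_add: "adapted n V \<Longrightarrow> adapted n V' \<Longrightarrow> adapted n (\<lambda>\<omega>. V \<omega> + V' \<omega>)"
  by (rule adapted_combine) simp_all

lemma adapted_mult: "adapted n V \<Longrightarrow> adapted n V' \<Longrightarrow> adapted n (\<lambda>\<omega>. V \<omega> * V' \<omega>)"
  by (rule adapted_combine) simp_all

lemma adapted_Suc:
  assumes "adapted n V"
  shows "adapted (Suc n) V"
proof -
  obtain F where F: "F \<in> borel_measurable (path_space n)"
    and eq: "\<And>\<omega>. V \<omega> = F (path n \<omega>)"
    using assms by (auto simp: adapted_def)
  have "(\<lambda>p. F (restrict p {1..n})) \<in> borel_measurable (path_space (Suc n))"
    by (rule measurable_compose[OF measurable_restrict_subset F]) auto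
  then show ?thesis
    by (rule adaptedI) (auto simp: eq intro!: arg_cong[where f = F])
qed

lemma adapted_current:
  assumes "\<phi> \<in> borel_measurable (borel :: (real \<times> real) measure)"
  shows "adapted (Suc n) (\<lambda>\<omega>. \<phi> (\<zeta> (Suc n) \<omega>, \<xi> (Suc n) \<omega>))"
proof (rule adaptedI)
  show "(\<lambda>p. \<phi> (p (Suc n))) \<in> borel_measurable (path_space (Suc n))"
    by (rule measurable_compose[OF _ assms], rule measurable_component_singleton) simp
qed simp

lemma adapted_measurable:
  assumes "adapted n V"
  shows "V \<in> borel_measurable M"
proof -
  obtain F where F: "F \<in> borel_measurable (path_space n)"
    and eq: "\<And>\<omega>. V \<omega> = F (path n \<omega>)"
    using assms by (auto simp: adapted_def)
  have "(\<lambda>\<omega>. F (path n \<omega>)) \<in> borel_measurable M"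
    by (intro measurable_compose[OF measurable_restrict F] pair_measurable) auto
  then show ?thesis by (simp add: eq[abs_def])
qed

lemma adapted_indep_next:
  assumes V: "adapted n V" and \<phi>: "\<phi> \<in> borel_measurable (borel :: (real \<times> real) measure)"
  shows "indep_var borel V borel (\<lambda>\<omega>. \<phi> (\<zeta> (Suc n) \<omega>, \<xi> (Suc n) \<omega>))"
proof -
  obtain F where F: "F \<in> borel_measurable (path_space n)"
    and eq: "\<And>\<omega>. V \<omega> = F (path n \<omega>)"
    using V by (auto simp: adapted_def)
  have "(\<lambda>p. \<phi> (p (Suc n))) \<in> borel_measurable (\<Pi>\<^sub>M k\<in>{Suc n}. (borel :: (real \<times> real) measure))"
    by (rule measurable_compose[OF _ \<phi>], rule measurable_component_singleton) simp
  then have "indep_var borel (F \<circ> path n)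
      borel ((\<lambda>p. \<phi> (p (Suc n))) \<circ> (\<lambda>\<omega>. \<lambda>k\<in>{Suc n}. (\<zeta> k \<omega>, \<xi> k \<omega>)))"
    by (intro indep_var_compose[OF indep_var_restrict[OF indep]] F) auto
  then show ?thesis by (simp add: comp_def eq[abs_def])
qed

lemma adapted_times_next:
  assumes V: "adapted n V" "integrable M V"
    and \<phi>: "\<phi> \<in> borel_measurable (borel :: (real \<times> real) measure)"
      "integrable M (\<lambda>\<omega>. \<phi> (\<zeta> (Suc n) \<omega>, \<xi> (Suc n) \<omega>))"
  shows "integrable M (\<lambda>\<omega>. V \<omega> * \<phi> (\<zeta> (Suc n) \<omega>, \<xi> (Suc n) \<omega>))"
    and "expectation (\<lambda>\<omega>. V \<omega> * \<phi> (\<zeta> (Suc n) \<omega>, \<xi> (Suc n) \<omega>))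
      = expectation V * expectation (\<lambda>\<omega>. \<phi> (\<zeta> (Suc n) \<omega>, \<xi> (Suc n) \<omega>))"
  using indep_var_integrable[OF adapted_indep_next[OF V(1) \<phi>(1)] V(2) \<phi>(2)]
    indep_var_lebesgue_integral[OF adapted_indep_next[OF V(1) \<phi>(1)] V(2) \<phi>(2)] by auto

lemma adapted_e: "adapted n (e n)"
proof (induction n)
  case 0
  show ?case using adapted_const[of 0 e0] by (simp add: e_0[abs_def])
next
  case (Suc n)
  have "adapted (Suc n) (\<lambda>\<omega>. (\<lambda>p. 1 - \<gamma> (Suc n) * fst p) (\<zeta> (Suc n) \<omega>, \<xi> (Suc n) \<omega>))"
    by (rule adapted_current) measurable
  moreover have "adapted (Suc n) (\<lambda>\<omega>. (\<lambda>p. \<gamma> (Suc n) * snd p) (\<zeta> (Suc n) \<omega>, \<xi> (Suc n) \<omega>))"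
    by (rule adapted_current) measurable
  ultimately show ?case
    using adapted_add[OF adapted_mult[OF _ adapted_Suc[OF Suc]]] by (simp add: e_Suc[abs_def])
qed

lemma e_measurable: "e n \<in> borel_measurable M"
  by (rule adapted_measurable[OF adapted_e])

lemma factor_sq_integrable: "integrable M (\<lambda>\<omega>. (1 - \<gamma> (Suc n) * \<zeta> (Suc n) \<omega>)\<^sup>2)"
  using \<zeta>_sq[of "Suc n"] \<zeta>_integrable[of "Suc n"] by (simp add: power2_diff power_mult_distrib)

lemma e_sq_integrable: "integrable M (\<lambda>\<omega>. (e n \<omega>)\<^sup>2)"
proof (induction n)
  case (Suc n)
  have "adapted n (\<lambda>\<omega>. (e n \<omega>)\<^sup>2)"
    using adapted_mult[OF adapted_e adapted_e] by (simp add: power2_eq_square)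
  from adapted_times_next(1)[OF this Suc, of "\<lambda>p. (1 - \<gamma> (Suc n) * fst p)\<^sup>2"]
  have 1: "integrable M (\<lambda>\<omega>. (e n \<omega>)\<^sup>2 * (1 - \<gamma> (Suc n) * \<zeta> (Suc n) \<omega>)\<^sup>2)"
    using factor_sq_integrable by simp
  note [measurable] = e_measurable \<xi>_measurable[of "Suc n", simplified] \<zeta>_measurable[of "Suc n", simplified]
  show ?case
  proof (rule Bochner_Integration.integrable_bound)
    show "integrable M (\<lambda>\<omega>. 2 * ((e n \<omega>)\<^sup>2 * (1 - \<gamma> (Suc n) * \<zeta> (Suc n) \<omega>)\<^sup>2)
        + 2 * (\<gamma> (Suc n))\<^sup>2 * (\<xi> (Suc n) \<omega>)\<^sup>2)"
      using 1 \<xi>_sq[of "Suc n"] by auto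
    have "(x + y)\<^sup>2 \<le> 2 * x\<^sup>2 + 2 * y\<^sup>2" for x y :: real
      using sum_squares_bound[of x y] by (simp add: power2_sum)
    from this[of "(1 - \<gamma> (Suc n) * \<zeta> (Suc n) _) * e n _" "\<gamma> (Suc n) * \<xi> (Suc n) _"]
    show "AE \<omega> in M. norm ((e (Suc n) \<omega>)\<^sup>2) \<le> norm (2 * ((e n \<omega>)\<^sup>2 * (1 - \<gamma> (Suc n) * \<zeta> (Suc n) \<omega>)\<^sup>2)
        + 2 * (\<gamma> (Suc n))\<^sup>2 * (\<xi> (Suc n) \<omega>)\<^sup>2)"
      by (auto intro!: AE_I2 simp: e_Suc power_mult_distrib mult_ac)
  qed measurable
qed (simp add: e_0)

lemma e_integrable: "integrable M (e n)"
  by (rule square_integrable_imp_integrable[OF e_measurable e_sq_integrable])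

text \<open>
  The square of \<open>(1 - \<gamma> \<zeta>) e\<^sub>n + \<gamma> \<xi>\<close> is expanded, and \<open>e\<^sub>n\<close> is independent of the pair \<open>(\<zeta>, \<xi>)\<close> of index \<open>n + 1\<close>.
  The cross term retains \<open>E \<xi>\<close> and \<open>E (\<zeta> \<xi>)\<close>, neither of which vanishes.
\<close>

lemma second_moment_recursion:
  "expectation (\<lambda>\<omega>. (e (Suc n) \<omega>)\<^sup>2) =
     expectation (\<lambda>\<omega>. (1 - \<gamma> (Suc n) * \<zeta> (Suc n) \<omega>)\<^sup>2) * expectation (\<lambda>\<omega>. (e n \<omega>)\<^sup>2)
   + 2 * \<gamma> (Suc n) * (expectation (\<xi> (Suc n)) - \<gamma> (Suc n) * expectation (\<lambda>\<omega>. \<zeta> (Suc n) \<omega> * \<xi> (Suc n) \<omega>))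
       * expectation (e n)
   + (\<gamma> (Suc n))\<^sup>2 * expectation (\<lambda>\<omega>. (\<xi> (Suc n) \<omega>)\<^sup>2)"
proof -
  let ?\<gamma> = "\<gamma> (Suc n)" and ?\<zeta> = "\<zeta> (Suc n)" and ?\<xi> = "\<xi> (Suc n)"
  have "adapted n (\<lambda>\<omega>. (e n \<omega>)\<^sup>2)"
    using adapted_mult[OF adapted_e adapted_e] by (simp add: power2_eq_square)
  from adapted_times_next[OF this e_sq_integrable, of "\<lambda>p. (1 - ?\<gamma> * fst p)\<^sup>2"]
  have 1: "integrable M (\<lambda>\<omega>. (e n \<omega>)\<^sup>2 * (1 - ?\<gamma> * ?\<zeta> \<omega>)\<^sup>2)"
    "expectation (\<lambda>\<omega>. (e n \<omega>)\<^sup>2 * (1 - ?\<gamma> * ?\<zeta> \<omega>)\<^sup>2)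
      = expectation (\<lambda>\<omega>. (e n \<omega>)\<^sup>2) * expectation (\<lambda>\<omega>. (1 - ?\<gamma> * ?\<zeta> \<omega>)\<^sup>2)"
    using factor_sq_integrable by simp_all
  have \<zeta>\<xi>: "integrable M (\<lambda>\<omega>. ?\<zeta> \<omega> * ?\<xi> \<omega>)"
    by (intro integrable_mult_square_integrable \<zeta>_measurable \<xi>_measurable \<zeta>_sq \<xi>_sq) simp_all
  have eq: "(1 - ?\<gamma> * ?\<zeta> \<omega>) * ?\<xi> \<omega> = ?\<xi> \<omega> - ?\<gamma> * (?\<zeta> \<omega> * ?\<xi> \<omega>)" for \<omega>
    by (simp add: algebra_simps)
  have cross: "integrable M (\<lambda>\<omega>. (1 - ?\<gamma> * ?\<zeta> \<omega>) * ?\<xi> \<omega>)"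
    "expectation (\<lambda>\<omega>. (1 - ?\<gamma> * ?\<zeta> \<omega>) * ?\<xi> \<omega>) = expectation ?\<xi> - ?\<gamma> * expectation (\<lambda>\<omega>. ?\<zeta> \<omega> * ?\<xi> \<omega>)"
    using \<zeta>\<xi> \<xi>_integrable[of "Suc n"] unfolding eq by simp_all
  from adapted_times_next[OF adapted_e e_integrable, of "\<lambda>p. (1 - ?\<gamma> * fst p) * snd p"]
  have 2: "integrable M (\<lambda>\<omega>. e n \<omega> * ((1 - ?\<gamma> * ?\<zeta> \<omega>) * ?\<xi> \<omega>))"
    "expectation (\<lambda>\<omega>. e n \<omega> * ((1 - ?\<gamma> * ?\<zeta> \<omega>) * ?\<xi> \<omega>))
      = expectation (e n) * (expectation ?\<xi> - ?\<gamma> * expectation (\<lambda>\<omega>. ?\<zeta> \<omega> * ?\<xi> \<omega>))"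
    using cross by simp_all
  have "expectation (\<lambda>\<omega>. (e (Suc n) \<omega>)\<^sup>2) = expectation (\<lambda>\<omega>. (e n \<omega>)\<^sup>2 * (1 - ?\<gamma> * ?\<zeta> \<omega>)\<^sup>2
      + 2 * ?\<gamma> * (e n \<omega> * ((1 - ?\<gamma> * ?\<zeta> \<omega>) * ?\<xi> \<omega>)) + ?\<gamma>\<^sup>2 * (?\<xi> \<omega>)\<^sup>2)"
    by (intro Bochner_Integration.integral_cong) (auto simp: e_Suc power2_eq_square algebra_simps)
  also have "\<dots> = expectation (\<lambda>\<omega>. (e n \<omega>)\<^sup>2 * (1 - ?\<gamma> * ?\<zeta> \<omega>)\<^sup>2)
      + 2 * ?\<gamma> * expectation (\<lambda>\<omega>. e n \<omega> * ((1 - ?\<gamma> * ?\<zeta> \<omega>) * ?\<xi> \<omega>))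
      + ?\<gamma>\<^sup>2 * expectation (\<lambda>\<omega>. (?\<xi> \<omega>)\<^sup>2)"
    using 1(1) 2(1) \<xi>_sq[of "Suc n"] by simp
  finally show ?thesis
    unfolding 1(2) 2(2) by (simp add: mult_ac)
qed

text \<open>
  The partial sums form a martingale: the increment of index \<open>n + 1\<close> is \<open>e\<^sub>n\<close> times a centred variable that
  is independent of the past, so its product with the previous partial sum has mean zero.
\<close>

lemma weighted_noise_second_moment:
  fixes c :: "nat \<Rightarrow> real"
  defines "S \<equiv> \<lambda>n \<omega>. \<Sum>k=1..n. c k * ((expectation (\<zeta> k) - \<zeta> k \<omega>) * e (k - 1) \<omega>)"
  shows "integrable M (\<lambda>\<omega>. (S n \<omega>)\<^sup>2)"
    and "expectation (\<lambda>\<omega>. (S n \<omega>)\<^sup>2) =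
      (\<Sum>k=1..n. (c k)\<^sup>2 * (variance (\<zeta> k) * expectation (\<lambda>\<omega>. (e (k - 1) \<omega>)\<^sup>2)))"
proof -
  have adapted_S: "adapted n (S n)" for n
  proof (induction n)
    case 0
    show ?case using adapted_const[of 0 0] by (simp add: S_def)
  next
    case (Suc n)
    have "adapted (Suc n) (\<lambda>\<omega>. (\<lambda>p. c (Suc n) * (expectation (\<zeta> (Suc n)) - fst p)) (\<zeta> (Suc n) \<omega>, \<xi> (Suc n) \<omega>))"
      by (rule adapted_current) measurable
    from adapted_add[OF adapted_Suc[OF Suc] adapted_mult[OF this adapted_Suc[OF adapted_e[of n]]]]
    show ?case by (simp add: S_def mult_ac)
  qed
  have "integrable M (\<lambda>\<omega>. (S n \<omega>)\<^sup>2) \<and> expectation (\<lambda>\<omega>. (S n \<omega>)\<^sup>2) =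
      (\<Sum>k=1..n. (c k)\<^sup>2 * (variance (\<zeta> k) * expectation (\<lambda>\<omega>. (e (k - 1) \<omega>)\<^sup>2)))"
  proof (induction n)
    case 0
    show ?case by (simp add: S_def)
  next
    case (Suc n)
    define D where "D \<omega> = expectation (\<zeta> (Suc n)) - \<zeta> (Suc n) \<omega>" for \<omega>
    have D: "integrable M D" "expectation D = 0"
      using \<zeta>_integrable[of "Suc n"] by (auto simp: D_def[abs_def] prob_space)
    have D2_eq: "(D \<omega>)\<^sup>2 = (\<zeta> (Suc n) \<omega> - expectation (\<zeta> (Suc n)))\<^sup>2" for \<omega>
      by (simp add: D_def power2_commute)
    have D2: "integrable M (\<lambda>\<omega>. (D \<omega>)\<^sup>2)"
      using \<zeta>_integrable[of "Suc n"] \<zeta>_sq[of "Suc n"] by (simp add: D_def power2_diff)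
    have "adapted n (\<lambda>\<omega>. (e n \<omega>)\<^sup>2)"
      using adapted_mult[OF adapted_e adapted_e] by (simp add: power2_eq_square)
    from adapted_times_next[OF this e_sq_integrable, of "\<lambda>p. (expectation (\<zeta> (Suc n)) - fst p)\<^sup>2"]
    have 1: "integrable M (\<lambda>\<omega>. (e n \<omega>)\<^sup>2 * (D \<omega>)\<^sup>2)"
      "expectation (\<lambda>\<omega>. (e n \<omega>)\<^sup>2 * (D \<omega>)\<^sup>2) = expectation (\<lambda>\<omega>. (e n \<omega>)\<^sup>2) * expectation (\<lambda>\<omega>. (D \<omega>)\<^sup>2)"
      using D2 by (simp_all add: D_def)
    have Se: "integrable M (\<lambda>\<omega>. S n \<omega> * e n \<omega>)"
      using Suc by (intro integrable_mult_square_integrable adapted_measurable[OF adapted_S] e_measurable e_sq_integrable) auto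
    from adapted_times_next[OF adapted_mult[OF adapted_S adapted_e] this, of "\<lambda>p. expectation (\<zeta> (Suc n)) - fst p"]
    have 2: "integrable M (\<lambda>\<omega>. S n \<omega> * e n \<omega> * D \<omega>)" "expectation (\<lambda>\<omega>. S n \<omega> * e n \<omega> * D \<omega>) = 0"
      using D by (simp_all add: D_def[abs_def])
    have eq: "(S (Suc n) \<omega>)\<^sup>2 = (S n \<omega>)\<^sup>2 + 2 * c (Suc n) * (S n \<omega> * e n \<omega> * D \<omega>)
        + (c (Suc n))\<^sup>2 * ((e n \<omega>)\<^sup>2 * (D \<omega>)\<^sup>2)" for \<omega>
      by (simp add: S_def D_def power2_eq_square algebra_simps)
    show ?case
      using Suc 1 2 unfolding eq D2_eq by simp
  qed
  then show "integrable M (\<lambda>\<omega>. (S n \<omega>)\<^sup>2)" "expectation (\<lambda>\<omega>. (S n \<omega>)\<^sup>2) =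
      (\<Sum>k=1..n. (c k)\<^sup>2 * (variance (\<zeta> k) * expectation (\<lambda>\<omega>. (e (k - 1) \<omega>)\<^sup>2)))" by auto
qed

end



section \<open>Averaging the recursion\<close>

text \<open>
  The setting of the optimal weights: \<open>q\<close> varies with the same exponent as the bandwidth \<open>h\<close>. The moment
  assumptions are those of a kernel estimator, with a bias of order \<open>h\<^sup>2\<close> and a \<open>p\<close>-th moment of order
  \<open>h\<^sup>1\<^sup>-\<^sup>p\<close>; one constant \<open>B\<close> serves for all of them.
\<close>

locale averaged_linear_recursion = linear_stochastic_recursion M \<zeta> \<xi> e \<gamma> e0
  for M :: "'w measure" and \<zeta> \<xi> e :: "nat \<Rightarrow> 'w \<Rightarrow> real" and \<gamma> :: "nat \<Rightarrow> real" and e0 :: real +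
  fixes h q :: "nat \<Rightarrow> real" and \<alpha> a f \<tau> B :: real
  assumes \<gamma>_GS: "\<gamma> \<in> GS (- \<alpha>)" and h_GS: "h \<in> GS (- a)" and q_GS: "q \<in> GS (- a)"
    and a_pos: "0 < a" and a_less_\<alpha>: "a < \<alpha>" and a_less_third: "a < 1 / 3"
    and n\<gamma>: "filterlim (\<lambda>n. real n * \<gamma> n) at_top sequentially"
    and nh5: "(\<lambda>n. real n * h n ^ 5) \<longlonglongrightarrow> 0"
    and f_pos: "0 < f" and \<tau>_pos: "0 < \<tau>" and B_pos: "0 < B"
    and \<zeta>_mean: "\<And>n. n \<ge> 1 \<Longrightarrow> \<bar>expectation (\<zeta> n) - f\<bar> \<le> B * (h n)\<^sup>2"
    and \<zeta>_second: "\<And>n. n \<ge> 1 \<Longrightarrow> expectation (\<lambda>\<omega>. (\<zeta> n \<omega>)\<^sup>2) \<le> B / h n"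
    and \<xi>_mean: "\<And>n. n \<ge> 1 \<Longrightarrow> \<bar>expectation (\<xi> n)\<bar> \<le> B * (h n)\<^sup>2"
    and \<xi>_second: "(\<lambda>n. h n * expectation (\<lambda>\<omega>. (\<xi> n \<omega>)\<^sup>2)) \<longlonglongrightarrow> \<tau>"
    and \<xi>_third: "\<And>n. n \<ge> 1 \<Longrightarrow> expectation (\<lambda>\<omega>. \<bar>\<xi> n \<omega>\<bar> ^ 3) \<le> B / (h n)\<^sup>2"
begin

lemmas \<gamma>_pos = GS_pos[OF \<gamma>_GS] and h_pos = GS_pos[OF h_GS] and q_pos = GS_pos[OF q_GS]

lemma \<gamma>_tendsto_0: "\<gamma> \<longlonglongrightarrow> 0"
  using a_pos a_less_\<alpha> by (intro GS_tendsto_0[OF \<gamma>_GS]) auto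

lemma h_tendsto_0: "h \<longlonglongrightarrow> 0"
  using a_pos by (intro GS_tendsto_0[OF h_GS]) auto

text \<open>
  The order of magnitude of the second moment of \<open>e\<close>.
\<close>

definition b :: "nat \<Rightarrow> real" where "b n = \<gamma> n / h n"

lemma b_GS: "b \<in> GS (a - \<alpha>)"
  using GS_divide[OF \<gamma>_GS h_GS] by (simp add: b_def[abs_def])

lemmas b_pos = GS_pos[OF b_GS]

lemma b_tendsto_0: "b \<longlonglongrightarrow> 0"
  using a_less_\<alpha> by (intro GS_tendsto_0[OF b_GS]) auto

text \<open>
  Comparison of the squared bias with the variance: \<open>h\<^sub>n\<^sup>4 / b\<^sub>n = n h\<^sub>n\<^sup>5 / (n \<gamma>\<^sub>n) \<rightarrow> 0\<close>.
\<close>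

lemma h4_le_b: "\<forall>\<^sub>F n in sequentially. h n ^ 4 \<le> b n"
proof -
  have "\<forall>\<^sub>F n in sequentially. real n * h n ^ 5 < 1"
    using nh5 by (intro order_tendstoD) auto
  moreover have "\<forall>\<^sub>F n in sequentially. 1 \<le> real n * \<gamma> n"
    using n\<gamma> by (simp add: filterlim_at_top)
  ultimately show ?thesis
    using eventually_ge_at_top[of 1]
  proof eventually_elim
    case (elim n)
    have "real n * h n ^ 5 \<le> real n * \<gamma> n" using elim by linarith
    then have "h n ^ 5 \<le> \<gamma> n" using elim by simp
    then show ?case using h_pos[OF elim(3)] by (simp add: b_def field_simps power_numeral_reduce)
  qed
qed

text \<open>
  In the exact recursion for \<open>E e\<^sub>n\<^sup>2\<close> the first coefficient is \<open>1 - 2 f \<gamma>\<^sub>n\<close> up to \<open>o(\<gamma>\<^sub>n)\<close>. The cross term is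
  bounded by Young's inequality, at the price of part of this contraction, and leaves \<open>\<gamma>\<^sub>n O(b\<^sub>n)\<close> by
  \<open>h4_le_b\<close>; the noise is of the order \<open>\<gamma>\<^sub>n b\<^sub>n\<close> as well. Hence \<open>recursion_bound\<close> applies. The second bound
  serves sums in which the error lags one step behind the weight.
\<close>

lemma e_second_moment_bound:
  obtains C where "C > 0"
    and "\<And>n. n \<ge> 1 \<Longrightarrow> expectation (\<lambda>\<omega>. (e n \<omega>)\<^sup>2) \<le> C * b n"
    and "\<And>n. n \<ge> 1 \<Longrightarrow> expectation (\<lambda>\<omega>. (e (n - 1) \<omega>)\<^sup>2) \<le> C * b n"
proof -
  define m where "m n = expectation (\<lambda>\<omega>. (e n \<omega>)\<^sup>2)" for n
  have m_nonneg: "0 \<le> m n" for n by (simp add: m_def)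
  obtain T where T: "T > 0" "\<And>n. \<bar>h n * expectation (\<lambda>\<omega>. (\<xi> n \<omega>)\<^sup>2)\<bar> \<le> T"
    using convergent_bound[OF \<xi>_second] by blast
  define D where "D = 2 / f * (2 * B\<^sup>2 + 2 * (B + T)\<^sup>2) + T"
  have D: "D \<ge> 0" using f_pos T by (simp add: D_def)
  have "(\<lambda>n. 2 * B * (h n)\<^sup>2 + B * b n) \<longlonglongrightarrow> 2 * B * 0\<^sup>2 + B * 0"
    by (intro tendsto_intros h_tendsto_0 b_tendsto_0)
  then have "\<forall>\<^sub>F n in sequentially. 2 * B * (h n)\<^sup>2 + B * b n < f / 2"
    using f_pos by (intro order_tendstoD) auto
  moreover have "\<forall>\<^sub>F n in sequentially. b n < 1"
    using b_tendsto_0 by (intro order_tendstoD) auto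
  ultimately have "\<forall>\<^sub>F n in sequentially. m n \<le> (1 - f * \<gamma> n) * m (n - 1) + D * \<gamma> n * b n"
    using h4_le_b eventually_ge_at_top[of 1]
  proof eventually_elim
    case (elim n)
    then obtain k where k: "n = Suc k" by (cases n) auto
    define g where "g = \<gamma> n"
    have g: "g > 0" and hn: "h n > 0" and bn: "b n > 0" "g / h n = b n"
      using \<gamma>_pos[of n] h_pos[of n] b_pos[of n] elim by (auto simp: g_def b_def)
    define \<beta> where "\<beta> = expectation (\<xi> n) - g * expectation (\<lambda>\<omega>. \<zeta> n \<omega> * \<xi> n \<omega>)"
    have rec: "m n = expectation (\<lambda>\<omega>. (1 - g * \<zeta> n \<omega>)\<^sup>2) * m k + 2 * g * \<beta> * expectation (e k)
        + g\<^sup>2 * expectation (\<lambda>\<omega>. (\<xi> n \<omega>)\<^sup>2)"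
      using second_moment_recursion[of k] by (simp add: m_def g_def \<beta>_def k)
    have \<xi>2: "expectation (\<lambda>\<omega>. (\<xi> n \<omega>)\<^sup>2) \<le> T / h n"
      using T(2)[of n] hn by (simp add: field_simps abs_le_iff)
    have "expectation (\<lambda>\<omega>. (1 - g * \<zeta> n \<omega>)\<^sup>2) = 1 - 2 * g * expectation (\<zeta> n) + g\<^sup>2 * expectation (\<lambda>\<omega>. (\<zeta> n \<omega>)\<^sup>2)"
      using \<zeta>_sq[OF elim(4)] \<zeta>_integrable[OF elim(4)]
      by (simp add: power2_diff power_mult_distrib prob_space)
    also have "\<dots> \<le> 1 - 2 * g * (f - B * (h n)\<^sup>2) + g\<^sup>2 * (B / h n)"
      using \<zeta>_mean[OF elim(4)] \<zeta>_second[OF elim(4)] g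
      by (intro add_mono diff_mono mult_left_mono) (auto simp: abs_le_iff)
    also have "\<dots> = 1 - g * (2 * f - (2 * B * (h n)\<^sup>2 + B * b n))"
      using bn(2) by (simp add: power2_eq_square algebra_simps flip: bn(2))
    also have "\<dots> \<le> 1 - g * (2 * f - f / 2)"
      using elim(1) g by simp
    finally have t1: "expectation (\<lambda>\<omega>. (1 - g * \<zeta> n \<omega>)\<^sup>2) \<le> 1 - g * (3 / 2 * f)"
      by simp
    have "\<bar>expectation (\<lambda>\<omega>. \<zeta> n \<omega> * \<xi> n \<omega>)\<bar> \<le> (B / h n + T / h n) / 2"
      using integrable_mult_square_integrable(2)[OF \<zeta>_measurable \<xi>_measurable \<zeta>_sq \<xi>_sq, of n n]
        \<zeta>_second[OF elim(4)] \<xi>2 elim(4) by simp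
    also have "\<dots> \<le> (B + T) / h n"
      using B_pos T(1) hn by (simp add: field_simps)
    finally have "g * \<bar>expectation (\<lambda>\<omega>. \<zeta> n \<omega> * \<xi> n \<omega>)\<bar> \<le> g * ((B + T) / h n)"
      using g by (intro mult_left_mono) auto
    also have "\<dots> = (B + T) * b n" by (simp flip: bn(2))
    finally have "\<bar>\<beta>\<bar> \<le> B * (h n)\<^sup>2 + (B + T) * b n"
      using \<xi>_mean[OF elim(4)] g abs_triangle_ineq4[of "expectation (\<xi> n)" "g * expectation (\<lambda>\<omega>. \<zeta> n \<omega> * \<xi> n \<omega>)"]
      by (simp add: \<beta>_def abs_mult)
    then have "\<beta>\<^sup>2 \<le> (B * (h n)\<^sup>2 + (B + T) * b n)\<^sup>2"
      by (metis abs_ge_zero power2_abs power_mono)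
    also have "\<dots> \<le> 2 * (B * (h n)\<^sup>2)\<^sup>2 + 2 * ((B + T) * b n)\<^sup>2"
      using sum_squares_bound[of "B * (h n)\<^sup>2" "(B + T) * b n"] by (simp add: power2_sum)
    also have "\<dots> = 2 * B\<^sup>2 * h n ^ 4 + 2 * (B + T)\<^sup>2 * (b n * b n)"
      by (simp add: power_mult_distrib power2_eq_square power4_eq_xxxx)
    also have "\<dots> \<le> 2 * B\<^sup>2 * b n + 2 * (B + T)\<^sup>2 * b n"
      using elim(2,3) bn(1) by (intro add_mono mult_left_mono) auto
    finally have \<beta>2: "\<beta>\<^sup>2 \<le> (2 * B\<^sup>2 + 2 * (B + T)\<^sup>2) * b n"
      by (simp add: algebra_simps)
    have Ee: "(expectation (e k))\<^sup>2 \<le> m k"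
    proof -
      have "\<bar>expectation (e k)\<bar> \<le> expectation (\<lambda>\<omega>. \<bar>e k \<omega>\<bar>)"
        by (rule integral_abs_bound)
      also have "\<dots> \<le> sqrt (m k)"
        unfolding m_def by (rule expectation_abs_le_sqrt[OF e_measurable e_sq_integrable])
      finally show ?thesis
        using m_nonneg[of k] by (metis abs_ge_zero power2_abs power_mono real_sqrt_pow2)
    qed
    (* Young's inequality; f / 2 is what the contraction 3 f / 2 can spare to remain at least f. *)
    have "2 * \<beta> * expectation (e k) \<le> 2 / f * \<beta>\<^sup>2 + f / 2 * (expectation (e k))\<^sup>2"
    proof -
      have "0 \<le> (2 * \<beta> - f * expectation (e k))\<^sup>2 / (2 * f)" using f_pos by simp
      then show ?thesis using f_pos by (simp add: power2_eq_square field_simps)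
    qed
    also have "\<dots> \<le> 2 / f * ((2 * B\<^sup>2 + 2 * (B + T)\<^sup>2) * b n) + f / 2 * m k"
      using \<beta>2 Ee f_pos by (intro add_mono mult_left_mono) auto
    finally have t2: "g * (2 * \<beta> * expectation (e k)) \<le> g * (2 / f * ((2 * B\<^sup>2 + 2 * (B + T)\<^sup>2) * b n) + f / 2 * m k)"
      using g by (intro mult_left_mono) auto
    have "g\<^sup>2 * expectation (\<lambda>\<omega>. (\<xi> n \<omega>)\<^sup>2) \<le> g\<^sup>2 * (T / h n)"
      using \<xi>2 by (intro mult_left_mono) auto
    also have "\<dots> = g * (T * b n)" by (simp add: power2_eq_square flip: bn(2))
    finally have t3: "g\<^sup>2 * expectation (\<lambda>\<omega>. (\<xi> n \<omega>)\<^sup>2) \<le> g * (T * b n)" .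
    have "m n \<le> (1 - g * (3 / 2 * f)) * m k
        + g * (2 / f * ((2 * B\<^sup>2 + 2 * (B + T)\<^sup>2) * b n) + f / 2 * m k) + g * (T * b n)"
      unfolding rec using t2 t3 mult_right_mono[OF t1 m_nonneg[of k]] by (simp add: mult_ac)
    also have "\<dots> = (1 - f * g) * m k + D * g * b n"
      by (simp add: D_def algebra_simps)
    finally show ?case by (simp add: g_def k)
  qed
  then obtain C1 where C1: "C1 > 0" "\<And>n. n \<ge> 1 \<Longrightarrow> m n \<le> C1 * b n"
    using recursion_bound[where m = m, OF b_GS \<gamma>_pos \<gamma>_tendsto_0 n\<gamma> f_pos D m_nonneg] by blast
  obtain R where R: "R > 0" "\<And>n. \<bar>b (n - 1) / b n\<bar> \<le> R"
    using convergent_bound[OF GS_ratio_tendsto_1[OF b_GS]] by blast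
  define C where "C = C1 + C1 * R + m 0 / b 1"
  have "C > 0" unfolding C_def using C1(1) R(1) m_nonneg[of 0] b_pos[of 1] by (intro add_pos_nonneg) auto
  moreover have "m n \<le> C * b n" if "n \<ge> 1" for n
  proof -
    have "C1 * b n \<le> C * b n"
      using R C1 m_nonneg[of 0] b_pos[of 1] b_pos[OF that] by (intro mult_right_mono) (auto simp: C_def)
    with C1(2)[OF that] show ?thesis by simp
  qed
  moreover have "m (n - 1) \<le> C * b n" if n: "n \<ge> 1" for n
  proof (cases "n = 1")
    case True
    have "m 0 = m 0 / b 1 * b 1" using b_pos[of 1] by simp
    also have "\<dots> \<le> C * b 1"
      using R C1 m_nonneg[of 0] b_pos[of 1] by (intro mult_right_mono) (auto simp: C_def)
    finally show ?thesis by (simp add: True)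
  next
    case False
    have "m (n - 1) \<le> C1 * b (n - 1)" using False n by (intro C1(2)) auto
    also have "\<dots> \<le> C1 * (R * b n)"
      using R(2)[of n] b_pos[OF n] C1(1) by (intro mult_left_mono) (auto simp: abs_le_iff field_simps)
    also have "\<dots> \<le> C * b n"
    proof -
      have "C1 * R * b n \<le> C * b n"
        using R C1 m_nonneg[of 0] b_pos[of 1] b_pos[OF n] by (intro mult_right_mono) (auto simp: C_def)
      then show ?thesis by (simp add: mult_ac)
    qed
    finally show ?thesis .
  qed
  ultimately show thesis
    using that by (simp add: m_def)
qed

text \<open>
  By Karamata's theorem \<open>\<Sum> q\<^sub>k\<close> is equivalent to \<open>n q\<^sub>n / (1 - a)\<close>; up to this constant, \<open>norming\<close> is the factor
  applied to \<open>\<Sum> q\<^sub>k e\<^sub>k\<close>.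
\<close>

definition norming :: "nat \<Rightarrow> real" where
  "norming n = sqrt (real n * h n) / (real n * q n)"

lemma norming_nonneg: "0 \<le> norming n"
proof (cases "n = 0")
  case False
  then show ?thesis using h_pos[of n] q_pos[of n] by (auto simp: norming_def)
qed (simp add: norming_def)

lemma norming_tendsto_0: "norming \<longlonglongrightarrow> 0"
proof -
  have "norming \<in> GS ((1 + - a) / 2 - (1 + - a))"
    unfolding norming_def[abs_def] by (intro GS_divide GS_sqrt GS_mult GS_real h_GS q_GS)
  then show ?thesis by (rule GS_tendsto_0) (use a_less_third in auto)
qed

text \<open>
  The expression equals \<open>sqrt (n h\<^sub>n\<^sup>5)\<close>: sums weighted by the bias \<open>h\<^sub>k\<^sup>2\<close> are negligible.
\<close>

lemma norming_bias_tendsto_0: "(\<lambda>n. norming n * (real n * (q n * (h n)\<^sup>2))) \<longlonglongrightarrow> 0"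
proof -
  have "(\<lambda>n. sqrt (real n * h n ^ 5)) \<longlonglongrightarrow> sqrt 0"
    by (intro tendsto_real_sqrt nh5)
  moreover have "\<forall>\<^sub>F n in sequentially. sqrt (real n * h n ^ 5) = norming n * (real n * (q n * (h n)\<^sup>2))"
    using eventually_ge_at_top[of 1]
  proof eventually_elim
    case (elim n)
    have "sqrt (real n * h n ^ 5) = sqrt (real n * h n * ((h n)\<^sup>2)\<^sup>2)"
      by (simp add: power_numeral_reduce mult_ac)
    also have "\<dots> = sqrt (real n * h n) * (h n)\<^sup>2"
      by (simp only: real_sqrt_mult real_sqrt_abs abs_power2)
    finally show ?case using q_pos[OF elim] elim by (simp add: norming_def)
  qed
  ultimately show ?thesis
    using Lim_transform_eventually by fastforce
qed

text \<open>
  The expression equals \<open>1 / sqrt (n \<gamma>\<^sub>n)\<close>; it governs what summation by parts leaves behind.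
\<close>

lemma norming_boundary_tendsto_0: "(\<lambda>n. norming n * (q n / \<gamma> n * sqrt (b n))) \<longlonglongrightarrow> 0"
proof -
  have "(\<lambda>n. inverse (sqrt (real n * \<gamma> n))) \<longlonglongrightarrow> 0"
    by (intro tendsto_inverse_0_at_top filterlim_compose[OF sqrt_at_top n\<gamma>])
  moreover have "\<forall>\<^sub>F n in sequentially. inverse (sqrt (real n * \<gamma> n)) = norming n * (q n / \<gamma> n * sqrt (b n))"
    using eventually_ge_at_top[of 1]
  proof eventually_elim
    case (elim n)
    note p = q_pos[OF elim] h_pos[OF elim] \<gamma>_pos[OF elim]
    have "sqrt (real n * h n) * sqrt (b n) = sqrt (real n * \<gamma> n)"
      using p by (simp add: b_def flip: real_sqrt_mult)
    then have "norming n * (q n / \<gamma> n * sqrt (b n)) = sqrt (real n * \<gamma> n) / (real n * \<gamma> n)"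
      using p elim by (simp add: norming_def field_simps)
    also have "\<dots> = inverse (sqrt (real n * \<gamma> n))"
      using p elim real_sqrt_mult_self[of "real n * \<gamma> n"] by (simp add: divide_simps del: real_sqrt_mult_self)
    finally show ?case by simp
  qed
  ultimately show ?thesis
    using Lim_transform_eventually by fastforce
qed

lemma norming_sq: "n \<ge> 1 \<Longrightarrow> (norming n)\<^sup>2 * y = y / (real n * ((q n)\<^sup>2 / h n))"
  using h_pos[of n] q_pos[of n]
  by (simp add: norming_def power_divide power_mult_distrib power2_eq_square field_simps)

text \<open>
  The Lyapunov ratio: the expression equals \<open>1 / sqrt (n h\<^sub>n)\<close>.
\<close>

lemma norming_cube_tendsto_0: "(\<lambda>n. norming n ^ 3 * (real n * (q n ^ 3 / (h n)\<^sup>2))) \<longlonglongrightarrow> 0"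
proof -
  have "(\<lambda>n. real n * h n) \<in> GS (1 + - a)"
    by (intro GS_mult GS_real h_GS)
  then have "filterlim (\<lambda>n. real n * h n) at_top sequentially"
    using a_less_third by (intro GS_at_top) auto
  then have "(\<lambda>n. inverse (sqrt (real n * h n))) \<longlonglongrightarrow> 0"
    by (intro tendsto_inverse_0_at_top filterlim_compose[OF sqrt_at_top])
  moreover have "\<forall>\<^sub>F n in sequentially. inverse (sqrt (real n * h n)) = norming n ^ 3 * (real n * (q n ^ 3 / (h n)\<^sup>2))"
    using eventually_ge_at_top[of 1]
  proof eventually_elim
    case (elim n)
    note p = q_pos[OF elim] h_pos[OF elim]
    define y where "y = sqrt (real n * h n)"
    have y: "y > 0" "real n * h n = y\<^sup>2" using p elim by (auto simp: y_def)
    have "norming n ^ 3 * (real n * (q n ^ 3 / (h n)\<^sup>2)) = y ^ 3 / (real n * h n)\<^sup>2"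
      unfolding norming_def y_def[symmetric] using p elim
      by (simp add: power_divide power_mult_distrib power2_eq_square power3_eq_cube field_simps)
    also have "\<dots> = inverse y"
      unfolding y(2) using y(1) by (simp add: power2_eq_square power3_eq_cube field_simps)
    finally show ?case by (simp add: y_def)
  qed
  ultimately show ?thesis
    using Lim_transform_eventually by fastforce
qed

definition negligible :: "(nat \<Rightarrow> 'w \<Rightarrow> real) \<Rightarrow> bool" where
  "negligible T \<longleftrightarrow> (\<forall>n. integrable M (T n)) \<and> (\<lambda>n. norming n * expectation (\<lambda>\<omega>. \<bar>T n \<omega>\<bar>)) \<longlonglongrightarrow> 0"

lemma negligibleI:
  assumes "\<And>n. integrable M (T n)" and "\<And>n. n \<ge> 1 \<Longrightarrow> expectation (\<lambda>\<omega>. \<bar>T n \<omega>\<bar>) \<le> t n"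
    and "(\<lambda>n. norming n * t n) \<longlonglongrightarrow> 0"
  shows "negligible T"
proof -
  have "(\<lambda>n. norming n * expectation (\<lambda>\<omega>. \<bar>T n \<omega>\<bar>)) \<longlonglongrightarrow> 0"
  proof (rule tendsto_sandwich[OF _ _ tendsto_const assms(3)])
    show "\<forall>\<^sub>F n in sequentially. norming n * expectation (\<lambda>\<omega>. \<bar>T n \<omega>\<bar>) \<le> norming n * t n"
      using eventually_ge_at_top[of 1]
      by eventually_elim (intro mult_left_mono assms(2) norming_nonneg)
  qed (auto intro!: always_eventually mult_nonneg_nonneg norming_nonneg)
  with assms(1) show ?thesis by (simp add: negligible_def)
qed

lemma negligible_add:
  assumes "negligible S" "negligible T"
  shows "negligible (\<lambda>n \<omega>. S n \<omega> + T n \<omega>)"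
proof (rule negligibleI)
  have int: "integrable M (S n)" "integrable M (T n)" for n
    using assms by (auto simp: negligible_def)
  then show "integrable M (\<lambda>\<omega>. S n \<omega> + T n \<omega>)" for n by simp
  have "expectation (\<lambda>\<omega>. \<bar>S n \<omega> + T n \<omega>\<bar>) \<le> expectation (\<lambda>\<omega>. \<bar>S n \<omega>\<bar> + \<bar>T n \<omega>\<bar>)" for n
    using int by (intro integral_mono) auto
  then show "expectation (\<lambda>\<omega>. \<bar>S n \<omega> + T n \<omega>\<bar>) \<le> expectation (\<lambda>\<omega>. \<bar>S n \<omega>\<bar>) + expectation (\<lambda>\<omega>. \<bar>T n \<omega>\<bar>)" for n
    using int by simp
  show "(\<lambda>n. norming n * (expectation (\<lambda>\<omega>. \<bar>S n \<omega>\<bar>) + expectation (\<lambda>\<omega>. \<bar>T n \<omega>\<bar>))) \<longlonglongrightarrow> 0"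
    using assms by (auto simp: negligible_def distrib_left intro: tendsto_add_zero)
qed

lemma expectation_weighted_sum_le:
  fixes V :: "nat \<Rightarrow> 'w \<Rightarrow> real"
  assumes "\<And>k. k \<in> A \<Longrightarrow> integrable M (V k)" and "\<And>k. k \<in> A \<Longrightarrow> expectation (\<lambda>\<omega>. \<bar>V k \<omega>\<bar>) \<le> t k"
  shows "expectation (\<lambda>\<omega>. \<bar>\<Sum>k\<in>A. c k * V k \<omega>\<bar>) \<le> (\<Sum>k\<in>A. \<bar>c k\<bar> * t k)"
proof -
  have "expectation (\<lambda>\<omega>. \<bar>\<Sum>k\<in>A. c k * V k \<omega>\<bar>) \<le> expectation (\<lambda>\<omega>. \<Sum>k\<in>A. \<bar>c k\<bar> * \<bar>V k \<omega>\<bar>)"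
    using assms(1) by (intro integral_mono) (auto intro!: order_trans[OF sum_abs] simp: abs_mult)
  also have "\<dots> = (\<Sum>k\<in>A. \<bar>c k\<bar> * expectation (\<lambda>\<omega>. \<bar>V k \<omega>\<bar>))"
    using assms(1) by simp
  also have "\<dots> \<le> (\<Sum>k\<in>A. \<bar>c k\<bar> * t k)"
    using assms(2) by (intro sum_mono mult_left_mono) auto
  finally show ?thesis .
qed

lemma e_abs_bound:
  obtains C where "C > 0"
    and "\<And>n. n \<ge> 1 \<Longrightarrow> expectation (\<lambda>\<omega>. \<bar>e n \<omega>\<bar>) \<le> C * sqrt (b n)"
    and "\<And>n. n \<ge> 1 \<Longrightarrow> expectation (\<lambda>\<omega>. \<bar>e (n - 1) \<omega>\<bar>) \<le> C * sqrt (b n)"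
proof -
  obtain C where C: "C > 0"
    "\<And>n. n \<ge> 1 \<Longrightarrow> expectation (\<lambda>\<omega>. (e n \<omega>)\<^sup>2) \<le> C * b n"
    "\<And>n. n \<ge> 1 \<Longrightarrow> expectation (\<lambda>\<omega>. (e (n - 1) \<omega>)\<^sup>2) \<le> C * b n"
    using e_second_moment_bound by blast
  have "expectation (\<lambda>\<omega>. \<bar>e k \<omega>\<bar>) \<le> sqrt C * sqrt (b n)"
    if "expectation (\<lambda>\<omega>. (e k \<omega>)\<^sup>2) \<le> C * b n" for k n
    using expectation_abs_le_sqrt[OF e_measurable e_sq_integrable, of k] real_sqrt_le_mono[OF that]
    by (simp add: real_sqrt_mult)
  with C show thesis by (intro that[of "sqrt C"]) auto
qed

text \<open>
  Summation by parts replaces the increments of \<open>e\<close> by those of \<open>c\<close>, which are smaller than \<open>c\<^sub>k\<close>, of order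
  \<open>q\<^sub>k / \<gamma>\<^sub>k\<close>, by a factor \<open>1/k\<close>. As \<open>E \<bar>e\<^sub>k\<bar> = O(sqrt b\<^sub>k)\<close>, both the resulting sum and the boundary term at \<open>n\<close>
  are of the order \<open>q\<^sub>n / \<gamma>\<^sub>n sqrt b\<^sub>n\<close>.
\<close>

lemma negligible_abel_sum:
  fixes c :: "nat \<Rightarrow> real"
  defines "c \<equiv> \<lambda>k. q k / \<gamma> k - f * q k"
  shows "negligible (\<lambda>n \<omega>. \<Sum>k=1..n. c k * (e (k - 1) \<omega> - e k \<omega>))"
proof -
  have abel: "(\<Sum>k=1..n. c k * (e (k - 1) \<omega> - e k \<omega>))
      = (\<Sum>k=1..n. (c k - c (k - 1)) * e (k - 1) \<omega>) + (c 0 * e0 + - c n * e n \<omega>)" for n \<omega>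
    by (induction n) (auto simp: algebra_simps e_0)
  obtain C where C: "C > 0"
    "\<And>n. n \<ge> 1 \<Longrightarrow> expectation (\<lambda>\<omega>. \<bar>e n \<omega>\<bar>) \<le> C * sqrt (b n)"
    "\<And>n. n \<ge> 1 \<Longrightarrow> expectation (\<lambda>\<omega>. \<bar>e (n - 1) \<omega>\<bar>) \<le> C * sqrt (b n)"
    using e_abs_bound by blast
  obtain G where G: "G > 0" "\<And>n. \<bar>\<gamma> n\<bar> \<le> G"
    using convergent_bound[OF \<gamma>_tendsto_0] by blast
  have q_le: "q k \<le> G * (q k / \<gamma> k)" if "k \<ge> 1" for k
    using G(2)[of k] \<gamma>_pos[OF that] q_pos[OF that] by (simp add: field_simps)
  have d_GS: "(\<lambda>k. q k / \<gamma> k) \<in> GS (- a - - \<alpha>)"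
    by (intro GS_divide q_GS \<gamma>_GS)
  obtain C1 where C1: "C1 > 0" "\<And>k. k \<ge> 1 \<Longrightarrow> \<bar>q k / \<gamma> k - q (k - 1) / \<gamma> (k - 1)\<bar> \<le> C1 * (q k / \<gamma> k / real k)"
    using GS_increment_bound[OF d_GS] by blast
  obtain C2 where C2: "C2 > 0" "\<And>k. k \<ge> 1 \<Longrightarrow> \<bar>q k - q (k - 1)\<bar> \<le> C2 * (q k / real k)"
    using GS_increment_bound[OF q_GS] by blast
  define D where "D = C1 + f * C2 * G"
  have D: "D > 0" using C1 C2 G f_pos by (simp add: D_def add_pos_pos)
  have c_diff: "\<bar>c k - c (k - 1)\<bar> \<le> D * (q k / \<gamma> k / real k)" if k: "k \<ge> 1" for k
  proof -
    have "\<bar>c k - c (k - 1)\<bar> \<le> \<bar>q k / \<gamma> k - q (k - 1) / \<gamma> (k - 1)\<bar> + f * \<bar>q k - q (k - 1)\<bar>"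
    proof -
      have "c k - c (k - 1) = (q k / \<gamma> k - q (k - 1) / \<gamma> (k - 1)) - f * (q k - q (k - 1))"
        by (simp add: c_def algebra_simps)
      then show ?thesis using abs_triangle_ineq4[of "q k / \<gamma> k - q (k - 1) / \<gamma> (k - 1)" "f * (q k - q (k - 1))"] f_pos
        by (simp add: abs_mult)
    qed
    also have "\<dots> \<le> C1 * (q k / \<gamma> k / real k) + f * (C2 * (G * (q k / \<gamma> k) / real k))"
    proof (intro add_mono C1(2) k mult_left_mono)
      have "C2 * (q k / real k) \<le> C2 * (G * (q k / \<gamma> k) / real k)"
        using C2(1) q_le[OF k] by (intro mult_left_mono divide_right_mono) auto
      with C2(2)[OF k] show "\<bar>q k - q (k - 1)\<bar> \<le> C2 * (G * (q k / \<gamma> k) / real k)" by linarith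
    qed (use f_pos in auto)
    also have "\<dots> = D * (q k / \<gamma> k / real k)"
      by (simp add: D_def algebra_simps add_divide_distrib)
    finally show ?thesis .
  qed
  define v where "v k = q k / \<gamma> k / real k * sqrt (b k)" for k
  (* The exponent of v is (\<alpha> - a) / 2 - 1, and a < \<alpha>. *)
  have "- 1 < (- a - - \<alpha> - 1) + (a - \<alpha>) / 2"
    using a_less_\<alpha> by (simp add: field_simps)
  moreover have "v \<in> GS ((- a - - \<alpha> - 1) + (a - \<alpha>) / 2)"
    unfolding v_def[abs_def] by (intro GS_mult GS_divide[OF d_GS GS_real] GS_sqrt b_GS)
  ultimately obtain C3 where C3: "C3 > 0" "\<And>n. n \<ge> 1 \<Longrightarrow> (\<Sum>k=1..n. v k) \<le> C3 * (real n * v n)"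
    using GS_sum_bound[of v] by blast
  have "negligible (\<lambda>n \<omega>. \<Sum>k=1..n. (c k - c (k - 1)) * e (k - 1) \<omega>)"
  proof (rule negligibleI)
    show "integrable M (\<lambda>\<omega>. \<Sum>k=1..n. (c k - c (k - 1)) * e (k - 1) \<omega>)" for n
      using e_integrable by auto
    fix n :: nat assume n: "n \<ge> 1"
    have "expectation (\<lambda>\<omega>. \<bar>\<Sum>k=1..n. (c k - c (k - 1)) * e (k - 1) \<omega>\<bar>)
        \<le> (\<Sum>k=1..n. \<bar>c k - c (k - 1)\<bar> * (C * sqrt (b k)))"
      using C(3) e_integrable by (intro expectation_weighted_sum_le) auto
    also have "\<dots> \<le> (\<Sum>k=1..n. D * (q k / \<gamma> k / real k) * (C * sqrt (b k)))"
      using c_diff C(1) b_pos by (intro sum_mono mult_right_mono) (auto intro!: mult_nonneg_nonneg less_imp_le)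
    also have "\<dots> = D * C * (\<Sum>k=1..n. v k)"
      by (simp add: v_def sum_distrib_left mult_ac)
    also have "\<dots> \<le> D * C * (C3 * (real n * v n))"
      using D C(1) C3(2)[OF n] by (intro mult_left_mono) auto
    also have "real n * v n = q n / \<gamma> n * sqrt (b n)"
      using n by (simp add: v_def)
    finally show "expectation (\<lambda>\<omega>. \<bar>\<Sum>k=1..n. (c k - c (k - 1)) * e (k - 1) \<omega>\<bar>)
        \<le> D * C * (C3 * (q n / \<gamma> n * sqrt (b n)))" .
  next
    show "(\<lambda>n. norming n * (D * C * (C3 * (q n / \<gamma> n * sqrt (b n))))) \<longlonglongrightarrow> 0"
      using tendsto_mult[OF tendsto_const norming_boundary_tendsto_0, of "D * C * C3"] by (simp add: mult_ac)
  qed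
  moreover have "negligible (\<lambda>n \<omega>. c 0 * e0)"
    using tendsto_mult[OF norming_tendsto_0 tendsto_const, of "\<bar>c 0 * e0\<bar>"]
    by (intro negligibleI[of _ "\<lambda>_. \<bar>c 0 * e0\<bar>"]) (auto simp: prob_space)
  moreover have "negligible (\<lambda>n \<omega>. - c n * e n \<omega>)"
  proof (rule negligibleI)
    show "integrable M (\<lambda>\<omega>. - c n * e n \<omega>)" for n using e_integrable by simp
    fix n :: nat assume n: "n \<ge> 1"
    have "\<bar>c n\<bar> \<le> q n / \<gamma> n + f * q n"
      unfolding c_def using q_pos[OF n] \<gamma>_pos[OF n] f_pos by (simp add: abs_le_iff add_nonneg_nonneg)
    also have "\<dots> \<le> (1 + f * G) * (q n / \<gamma> n)"
      using mult_left_mono[OF q_le[OF n], of f] f_pos by (simp add: algebra_simps add_divide_distrib)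
    finally have "\<bar>c n\<bar> * expectation (\<lambda>\<omega>. \<bar>e n \<omega>\<bar>) \<le> (1 + f * G) * (q n / \<gamma> n) * (C * sqrt (b n))"
      using C(2)[OF n] by (intro mult_mono) auto
    then show "expectation (\<lambda>\<omega>. \<bar>- c n * e n \<omega>\<bar>) \<le> (1 + f * G) * (q n / \<gamma> n) * (C * sqrt (b n))"
      by (simp add: abs_mult)
  next
    show "(\<lambda>n. norming n * ((1 + f * G) * (q n / \<gamma> n) * (C * sqrt (b n)))) \<longlonglongrightarrow> 0"
      using tendsto_mult[OF tendsto_const norming_boundary_tendsto_0, of "(1 + f * G) * C"] by (simp add: mult_ac)
  qed
  ultimately show ?thesis
    unfolding abel by (intro negligible_add)
qed

lemma sum_q_h2_bound:
  obtains C where "C > 0" "\<And>n. n \<ge> 1 \<Longrightarrow> (\<Sum>k=1..n. q k * (h k)\<^sup>2) \<le> C * (real n * (q n * (h n)\<^sup>2))"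
proof -
  have "(\<lambda>k. q k * (h k)\<^sup>2) \<in> GS (- a + real 2 * - a)"
    by (intro GS_mult GS_power q_GS h_GS)
  then show thesis
    using GS_sum_bound[of "\<lambda>k. q k * (h k)\<^sup>2" "- a + real 2 * - a"] a_less_third that by auto
qed

lemma negligible_drift:
  "negligible (\<lambda>n \<omega>. \<Sum>k=1..n. (q k * (f - expectation (\<zeta> k))) * e (k - 1) \<omega>)"
proof -
  obtain C where C: "C > 0"
    "\<And>n. n \<ge> 1 \<Longrightarrow> expectation (\<lambda>\<omega>. \<bar>e n \<omega>\<bar>) \<le> C * sqrt (b n)"
    "\<And>n. n \<ge> 1 \<Longrightarrow> expectation (\<lambda>\<omega>. \<bar>e (n - 1) \<omega>\<bar>) \<le> C * sqrt (b n)"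
    using e_abs_bound by blast
  obtain G where G: "G > 0" "\<And>n. \<bar>sqrt (b n)\<bar> \<le> G"
    using convergent_bound[OF tendsto_real_sqrt[OF b_tendsto_0]] by blast
  obtain D where D: "D > 0" "\<And>n. n \<ge> 1 \<Longrightarrow> (\<Sum>k=1..n. q k * (h k)\<^sup>2) \<le> D * (real n * (q n * (h n)\<^sup>2))"
    using sum_q_h2_bound by blast
  show ?thesis
  proof (rule negligibleI)
    show "integrable M (\<lambda>\<omega>. \<Sum>k=1..n. (q k * (f - expectation (\<zeta> k))) * e (k - 1) \<omega>)" for n
      using e_integrable by auto
    fix n :: nat assume n: "n \<ge> 1"
    have "expectation (\<lambda>\<omega>. \<bar>e (k - 1) \<omega>\<bar>) \<le> C * G" if "k \<ge> 1" for k
    proof -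
      have "C * sqrt (b k) \<le> C * G" using C(1) G(2)[of k] by (intro mult_left_mono) auto
      with C(3)[OF that] show ?thesis by linarith
    qed
    then have "expectation (\<lambda>\<omega>. \<bar>\<Sum>k=1..n. (q k * (f - expectation (\<zeta> k))) * e (k - 1) \<omega>\<bar>)
        \<le> (\<Sum>k=1..n. \<bar>q k * (f - expectation (\<zeta> k))\<bar> * (C * G))"
      using e_integrable by (intro expectation_weighted_sum_le) auto
    also have "\<dots> \<le> (\<Sum>k=1..n. q k * (B * (h k)\<^sup>2) * (C * G))"
    proof (intro sum_mono mult_right_mono)
      fix k assume k: "k \<in> {1..n}"
      then show "\<bar>q k * (f - expectation (\<zeta> k))\<bar> \<le> q k * (B * (h k)\<^sup>2)"
        using \<zeta>_mean[of k] q_pos[of k] by (simp add: abs_mult abs_minus_commute)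
    qed (use C(1) G(1) in auto)
    also have "\<dots> = B * C * G * (\<Sum>k=1..n. q k * (h k)\<^sup>2)"
      by (simp add: sum_distrib_left mult_ac)
    also have "\<dots> \<le> B * C * G * (D * (real n * (q n * (h n)\<^sup>2)))"
      using B_pos C(1) G(1) D(2)[OF n] by (intro mult_left_mono) auto
    finally show "expectation (\<lambda>\<omega>. \<bar>\<Sum>k=1..n. (q k * (f - expectation (\<zeta> k))) * e (k - 1) \<omega>\<bar>)
      \<le> B * C * G * (D * (real n * (q n * (h n)\<^sup>2)))" .
  next
    show "(\<lambda>n. norming n * (B * C * G * (D * (real n * (q n * (h n)\<^sup>2))))) \<longlonglongrightarrow> 0"
      using tendsto_mult[OF tendsto_const norming_bias_tendsto_0, of "B * C * G * D"] by (simp add: mult_ac)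
  qed
qed

lemma negligible_bias: "negligible (\<lambda>n \<omega>. \<Sum>k=1..n. q k * expectation (\<xi> k))"
proof -
  obtain D where D: "D > 0" "\<And>n. n \<ge> 1 \<Longrightarrow> (\<Sum>k=1..n. q k * (h k)\<^sup>2) \<le> D * (real n * (q n * (h n)\<^sup>2))"
    using sum_q_h2_bound by blast
  show ?thesis
  proof (rule negligibleI)
    fix n :: nat assume n: "n \<ge> 1"
    have "\<bar>\<Sum>k=1..n. q k * expectation (\<xi> k)\<bar> \<le> (\<Sum>k=1..n. q k * (B * (h k)\<^sup>2))"
    proof (rule order_trans[OF sum_abs], rule sum_mono)
      fix k assume k: "k \<in> {1..n}"
      then show "\<bar>q k * expectation (\<xi> k)\<bar> \<le> q k * (B * (h k)\<^sup>2)"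
        using \<xi>_mean[of k] q_pos[of k] by (simp add: abs_mult)
    qed
    also have "\<dots> = B * (\<Sum>k=1..n. q k * (h k)\<^sup>2)"
      by (simp add: sum_distrib_left mult_ac)
    also have "\<dots> \<le> B * (D * (real n * (q n * (h n)\<^sup>2)))"
      using B_pos D(2)[OF n] by (intro mult_left_mono) auto
    finally show "expectation (\<lambda>\<omega>. \<bar>\<Sum>k=1..n. q k * expectation (\<xi> k)\<bar>) \<le> B * (D * (real n * (q n * (h n)\<^sup>2)))"
      by (simp add: prob_space)
  next
    show "(\<lambda>n. norming n * (B * (D * (real n * (q n * (h n)\<^sup>2))))) \<longlonglongrightarrow> 0"
      using tendsto_mult[OF tendsto_const norming_bias_tendsto_0, of "B * D"] by (simp add: mult_ac)
  qed simp
qed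

lemma q2_h_GS: "(\<lambda>k. (q k)\<^sup>2 / h k) \<in> GS (- a)"
  by (rule GS_cong[OF GS_divide[OF GS_power[OF q_GS, of 2] h_GS]]) auto

text \<open>
  By orthogonality the second moment is at most \<open>\<Sum> q\<^sub>k\<^sup>2 / h\<^sub>k O(b\<^sub>k)\<close>. Since \<open>b\<^sub>k \<rightarrow> 0\<close>, this is of smaller order
  than \<open>\<Sum> q\<^sub>k\<^sup>2 / h\<^sub>k\<close>, the order of the variance of the leading term.
\<close>

lemma negligible_noise:
  "negligible (\<lambda>n \<omega>. \<Sum>k=1..n. q k * ((expectation (\<zeta> k) - \<zeta> k \<omega>) * e (k - 1) \<omega>))" (is "negligible ?S")
proof -
  obtain C where C: "C > 0"
    "\<And>n. n \<ge> 1 \<Longrightarrow> expectation (\<lambda>\<omega>. (e n \<omega>)\<^sup>2) \<le> C * b n"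
    "\<And>n. n \<ge> 1 \<Longrightarrow> expectation (\<lambda>\<omega>. (e (n - 1) \<omega>)\<^sup>2) \<le> C * b n"
    using e_second_moment_bound by blast
  define U where "U n = (\<Sum>k=1..n. (q k)\<^sup>2 / h k * (B * C * b k))" for n
  have [measurable]: "?S n \<in> borel_measurable M" for n
    using \<zeta>_measurable e_measurable by auto
  show ?thesis
  proof (rule negligibleI)
    show "integrable M (?S n)" for n
      by (rule square_integrable_imp_integrable[OF _ weighted_noise_second_moment(1)]) measurable
    fix n :: nat assume n: "n \<ge> 1"
    have "expectation (\<lambda>\<omega>. \<bar>?S n \<omega>\<bar>) \<le> sqrt (expectation (\<lambda>\<omega>. (?S n \<omega>)\<^sup>2))"
      by (rule expectation_abs_le_sqrt[OF _ weighted_noise_second_moment(1)]) measurable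
    also have "expectation (\<lambda>\<omega>. (?S n \<omega>)\<^sup>2) \<le> U n"
      unfolding weighted_noise_second_moment(2) U_def
    proof (rule sum_mono)
      fix k assume "k \<in> {1..n}"
      then have k: "k \<ge> 1" by simp
      have "variance (\<zeta> k) \<le> B / h k"
        using variance_eq[OF \<zeta>_integrable[OF k] \<zeta>_sq[OF k]] \<zeta>_second[OF k]
          zero_le_power2[of "expectation (\<zeta> k)"] by linarith
      then have "variance (\<zeta> k) * expectation (\<lambda>\<omega>. (e (k - 1) \<omega>)\<^sup>2) \<le> B / h k * (C * b k)"
        using C(3)[OF k] B_pos h_pos[OF k] by (intro mult_mono) auto
      then have "(q k)\<^sup>2 * (variance (\<zeta> k) * expectation (\<lambda>\<omega>. (e (k - 1) \<omega>)\<^sup>2)) \<le> (q k)\<^sup>2 * (B / h k * (C * b k))"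
        by (intro mult_left_mono) auto
      then show "(q k)\<^sup>2 * (variance (\<zeta> k) * expectation (\<lambda>\<omega>. (e (k - 1) \<omega>)\<^sup>2)) \<le> (q k)\<^sup>2 / h k * (B * C * b k)"
        by (simp add: mult_ac)
    qed
    finally show "expectation (\<lambda>\<omega>. \<bar>?S n \<omega>\<bar>) \<le> sqrt (U n)" by simp
  next
    have "(\<lambda>k. B * C * b k) \<longlonglongrightarrow> B * C * 0"
      by (intro tendsto_intros b_tendsto_0)
    from GS_weighted_sum_tendsto[OF q2_h_GS _ this]
    have "(\<lambda>n. sqrt (U n / (real n * ((q n)\<^sup>2 / h n)))) \<longlonglongrightarrow> sqrt 0"
      using a_less_third by (intro tendsto_real_sqrt) (auto simp: U_def)
    moreover have "\<forall>\<^sub>F n in sequentially. sqrt (U n / (real n * ((q n)\<^sup>2 / h n))) = norming n * sqrt (U n)"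
      using eventually_ge_at_top[of 1]
    proof eventually_elim
      case (elim n)
      have "sqrt (U n / (real n * ((q n)\<^sup>2 / h n))) = sqrt ((norming n)\<^sup>2 * U n)"
        by (simp only: norming_sq[OF elim])
      then show ?case using norming_nonneg[of n] by (simp add: real_sqrt_mult)
    qed
    ultimately show "(\<lambda>n. norming n * sqrt (U n)) \<longlonglongrightarrow> 0"
      using Lim_transform_eventually by fastforce
  qed
qed

text \<open>
  Summing the recursion, solved for \<open>f e\<^sub>k\<close>, leaves the centred sum \<open>\<Sum> q\<^sub>k \<eta>\<^sub>k\<close> and four negligible sums, collected
  in \<open>T\<close> below. Since \<open>E \<eta>\<^sub>k\<^sup>2\<close> is equivalent to \<open>\<tau> / h\<^sub>k\<close>, the variance of the centred sum is
  \<open>\<tau> n q\<^sub>n\<^sup>2 / ((1 - a) h\<^sub>n)\<close> asymptotically.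
\<close>

theorem averaged_recursion_clt:
  "weak_conv_m (\<lambda>n. distr M borel (\<lambda>\<omega>. sqrt (real n * h n) * ((\<Sum>k=1..n. q k * e k \<omega>) / (\<Sum>k=1..n. q k))))
     (gaussian 0 ((1 - a) * \<tau> / f\<^sup>2))"
proof -
  define \<eta> where "\<eta> k \<omega> = \<xi> k \<omega> - expectation (\<xi> k)" for k \<omega>
  define \<rho> where "\<rho> n = real n * q n / (\<Sum>k=1..n. q k)" for n
  define w where "w n k = \<rho> n * norming n / f * q k" for n k
  define T where "T n \<omega> = (\<Sum>k=1..n. (q k / \<gamma> k - f * q k) * (e (k - 1) \<omega> - e k \<omega>))
    + ((\<Sum>k=1..n. (q k * (f - expectation (\<zeta> k))) * e (k - 1) \<omega>)
    + ((\<Sum>k=1..n. q k * ((expectation (\<zeta> k) - \<zeta> k \<omega>) * e (k - 1) \<omega>))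
    + (\<Sum>k=1..n. q k * expectation (\<xi> k))))" for n \<omega>
  have T: "negligible T"
    unfolding T_def by (intro negligible_add negligible_abel_sum negligible_drift negligible_noise negligible_bias)
  have \<rho>: "\<rho> \<longlonglongrightarrow> 1 - a"
  proof -
    have "(\<lambda>n. inverse ((\<Sum>k=1..n. q k) / (real n * q n))) \<longlonglongrightarrow> inverse (1 / (1 + - a))"
      using a_less_third by (intro tendsto_inverse GS_sum_tendsto[OF q_GS]) auto
    then show ?thesis by (simp add: \<rho>_def[abs_def])
  qed
  have \<rho>_nonneg: "\<rho> n \<ge> 0" for n
  proof (cases "n = 0")
    case False
    then have "q n > 0" by (intro q_pos) auto
    moreover have "(\<Sum>k=1..n. q k) \<ge> 0" by (intro sum_nonneg) (auto intro: less_imp_le[OF q_pos])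
    ultimately show ?thesis by (simp add: \<rho>_def)
  qed (simp add: \<rho>_def)
  have telescoped: "f * (\<Sum>k=1..n. q k * e k \<omega>) = (\<Sum>k=1..n. q k * \<eta> k \<omega>) + T n \<omega>" for n \<omega>
  proof (induction n)
    case (Suc n)
    have "\<gamma> (Suc n) > 0" by (rule \<gamma>_pos) simp
    then have "q (Suc n) / \<gamma> (Suc n) * (e n \<omega> - e (Suc n) \<omega>) = q (Suc n) * (\<zeta> (Suc n) \<omega> * e n \<omega> - \<xi> (Suc n) \<omega>)"
      by (simp add: e_Suc field_simps)
    then have "f * (q (Suc n) * e (Suc n) \<omega>) = q (Suc n) * \<eta> (Suc n) \<omega>
      + ((q (Suc n) / \<gamma> (Suc n) - f * q (Suc n)) * (e n \<omega> - e (Suc n) \<omega>)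
      + ((q (Suc n) * (f - expectation (\<zeta> (Suc n)))) * e n \<omega>
      + (q (Suc n) * ((expectation (\<zeta> (Suc n)) - \<zeta> (Suc n) \<omega>) * e n \<omega>)
      + q (Suc n) * expectation (\<xi> (Suc n)))))"
      by (simp add: \<eta>_def algebra_simps)
    with Suc show ?case by (simp add: T_def distrib_left)
  qed (simp add: T_def)
  have decomposition: "sqrt (real n * h n) * ((\<Sum>k=1..n. q k * e k \<omega>) / (\<Sum>k=1..n. q k))
      = (\<Sum>k=1..n. w n k * \<eta> k \<omega>) + \<rho> n * norming n / f * T n \<omega>" for n \<omega>
  proof (cases "n = 0")
    case False
    then have "q n > 0" "real n > 0" by (auto intro: q_pos)
    then have "\<rho> n * norming n = sqrt (real n * h n) / (\<Sum>k=1..n. q k)"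
      by (simp add: \<rho>_def norming_def)
    moreover have "(\<Sum>k=1..n. w n k * \<eta> k \<omega>) = \<rho> n * norming n / f * (\<Sum>k=1..n. q k * \<eta> k \<omega>)"
      by (simp add: w_def sum_distrib_left mult_ac)
    ultimately have "(\<Sum>k=1..n. w n k * \<eta> k \<omega>) + \<rho> n * norming n / f * T n \<omega>
        = sqrt (real n * h n) / (\<Sum>k=1..n. q k) / f * (f * (\<Sum>k=1..n. q k * e k \<omega>))"
      by (simp only: telescoped distrib_left)
    then show ?thesis using f_pos by simp
  qed (simp add: \<rho>_def)
  have \<eta>_moments: "integrable M (\<lambda>\<omega>. (\<eta> k \<omega>)\<^sup>2)" "integrable M (\<lambda>\<omega>. \<bar>\<eta> k \<omega>\<bar> ^ 3)" "expectation (\<eta> k) = 0"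
    "expectation (\<lambda>\<omega>. (\<eta> k \<omega>)\<^sup>2) = expectation (\<lambda>\<omega>. (\<xi> k \<omega>)\<^sup>2) - (expectation (\<xi> k))\<^sup>2"
    "expectation (\<lambda>\<omega>. \<bar>\<eta> k \<omega>\<bar> ^ 3) \<le> 8 * B / (h k)\<^sup>2" if k: "k \<ge> 1" for k
  proof -
    note [measurable] = \<xi>_measurable[OF k]
    show "integrable M (\<lambda>\<omega>. (\<eta> k \<omega>)\<^sup>2)"
      using \<xi>_sq[OF k] \<xi>_integrable[OF k] by (simp add: \<eta>_def power2_diff)
    show "expectation (\<eta> k) = 0"
      using \<xi>_integrable[OF k] by (simp add: \<eta>_def[abs_def] prob_space)
    show "expectation (\<lambda>\<omega>. (\<eta> k \<omega>)\<^sup>2) = expectation (\<lambda>\<omega>. (\<xi> k \<omega>)\<^sup>2) - (expectation (\<xi> k))\<^sup>2"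
      unfolding \<eta>_def by (rule variance_eq[OF \<xi>_integrable[OF k] \<xi>_sq[OF k]])
    show int3: "integrable M (\<lambda>\<omega>. \<bar>\<eta> k \<omega>\<bar> ^ 3)"
    proof (rule Bochner_Integration.integrable_bound)
      show "integrable M (\<lambda>\<omega>. 4 * \<bar>\<xi> k \<omega>\<bar> ^ 3 + 4 * \<bar>expectation (\<xi> k)\<bar> ^ 3)"
        using \<xi>_cube[OF k] by simp
    qed (auto simp: \<eta>_def abs_diff_cubed_le)
    have "\<bar>expectation (\<xi> k)\<bar> \<le> sqrt (expectation (\<lambda>\<omega>. (\<xi> k \<omega>)\<^sup>2))"
      using expectation_abs_le_sqrt[OF \<xi>_measurable[OF k] \<xi>_sq[OF k]] integral_abs_bound[of M "\<xi> k"] by linarith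
    then have "\<bar>expectation (\<xi> k)\<bar> ^ 3 \<le> sqrt (expectation (\<lambda>\<omega>. (\<xi> k \<omega>)\<^sup>2)) ^ 3"
      by (intro power_mono) auto
    also have "\<dots> \<le> expectation (\<lambda>\<omega>. \<bar>\<xi> k \<omega>\<bar> ^ 3)"
      by (intro third_moment_ge_cube_of_L2_norm \<xi>_sq \<xi>_cube k \<xi>_measurable)
    finally have mean3: "\<bar>expectation (\<xi> k)\<bar> ^ 3 \<le> expectation (\<lambda>\<omega>. \<bar>\<xi> k \<omega>\<bar> ^ 3)" .
    have "expectation (\<lambda>\<omega>. \<bar>\<eta> k \<omega>\<bar> ^ 3) \<le> expectation (\<lambda>\<omega>. 4 * \<bar>\<xi> k \<omega>\<bar> ^ 3 + 4 * \<bar>expectation (\<xi> k)\<bar> ^ 3)"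
      using int3 \<xi>_cube[OF k] by (intro integral_mono) (auto simp: \<eta>_def abs_diff_cubed_le)
    also have "\<dots> = 4 * expectation (\<lambda>\<omega>. \<bar>\<xi> k \<omega>\<bar> ^ 3) + 4 * \<bar>expectation (\<xi> k)\<bar> ^ 3"
      using \<xi>_cube[OF k] by (simp add: prob_space)
    also have "\<dots> \<le> 8 * (B / (h k)\<^sup>2)"
      using mean3 \<xi>_third[OF k] by linarith
    finally show "expectation (\<lambda>\<omega>. \<bar>\<eta> k \<omega>\<bar> ^ 3) \<le> 8 * B / (h k)\<^sup>2" by simp
  qed
  have h_var: "(\<lambda>k. h k * expectation (\<lambda>\<omega>. (\<eta> k \<omega>)\<^sup>2)) \<longlonglongrightarrow> \<tau>"
  proof -
    have mean0: "(\<lambda>k. expectation (\<xi> k)) \<longlonglongrightarrow> 0"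
    proof (rule Lim_null_comparison)
      show "\<forall>\<^sub>F k in sequentially. norm (expectation (\<xi> k)) \<le> B * (h k)\<^sup>2"
        using eventually_ge_at_top[of 1] by eventually_elim (simp add: \<xi>_mean)
      show "(\<lambda>k. B * (h k)\<^sup>2) \<longlonglongrightarrow> 0"
        using tendsto_mult[OF tendsto_const tendsto_power[OF h_tendsto_0], of B 2] by simp
    qed
    have "(\<lambda>k. h k * expectation (\<lambda>\<omega>. (\<xi> k \<omega>)\<^sup>2) - h k * (expectation (\<xi> k))\<^sup>2) \<longlonglongrightarrow> \<tau> - 0 * 0\<^sup>2"
      by (intro tendsto_intros \<xi>_second h_tendsto_0 mean0)
    moreover have "\<forall>\<^sub>F k in sequentially. h k * expectation (\<lambda>\<omega>. (\<xi> k \<omega>)\<^sup>2) - h k * (expectation (\<xi> k))\<^sup>2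
        = h k * expectation (\<lambda>\<omega>. (\<eta> k \<omega>)\<^sup>2)"
      using eventually_ge_at_top[of 1] by eventually_elim (simp add: \<eta>_moments(4) right_diff_distrib)
    ultimately show ?thesis
      using Lim_transform_eventually by fastforce
  qed
  show ?thesis
    unfolding decomposition
  proof (rule lyapunov_with_negligible_remainder)
    have "indep_vars (\<lambda>_. borel) (\<lambda>k \<omega>. (\<lambda>p. snd p - expectation (\<xi> k)) (\<zeta> k \<omega>, \<xi> k \<omega>)) {1..}"
      by (rule indep_vars_compose2[OF indep]) auto
    then show "indep_vars (\<lambda>_. borel) \<eta> {1..}" by (simp add: \<eta>_def[abs_def])
    show "0 < (1 - a) * \<tau> / f\<^sup>2" using a_less_third \<tau>_pos f_pos by simp
    have "(\<lambda>n. (\<rho> n)\<^sup>2 / f\<^sup>2 * ((\<Sum>k=1..n. (q k)\<^sup>2 / h k * (h k * expectation (\<lambda>\<omega>. (\<eta> k \<omega>)\<^sup>2))) / (real n * ((q n)\<^sup>2 / h n))))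
        \<longlonglongrightarrow> (1 - a)\<^sup>2 / f\<^sup>2 * (\<tau> / (1 + - a))"
      using a_less_third f_pos by (intro tendsto_intros \<rho> GS_weighted_sum_tendsto[OF q2_h_GS _ h_var]) auto
    also have "(1 - a)\<^sup>2 / f\<^sup>2 * (\<tau> / (1 + - a)) = (1 - a) * \<tau> / f\<^sup>2"
      using a_less_third by (simp add: power2_eq_square)
    finally have lim: "(\<lambda>n. (\<rho> n)\<^sup>2 / f\<^sup>2 * ((\<Sum>k=1..n. (q k)\<^sup>2 / h k * (h k * expectation (\<lambda>\<omega>. (\<eta> k \<omega>)\<^sup>2))) / (real n * ((q n)\<^sup>2 / h n))))
        \<longlonglongrightarrow> (1 - a) * \<tau> / f\<^sup>2" .
    have ev: "\<forall>\<^sub>F n in sequentially.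
        (\<rho> n)\<^sup>2 / f\<^sup>2 * ((\<Sum>k=1..n. (q k)\<^sup>2 / h k * (h k * expectation (\<lambda>\<omega>. (\<eta> k \<omega>)\<^sup>2))) / (real n * ((q n)\<^sup>2 / h n)))
        = (\<Sum>k=1..n. (w n k)\<^sup>2 * expectation (\<lambda>\<omega>. (\<eta> k \<omega>)\<^sup>2))"
      using eventually_ge_at_top[of 1]
    proof eventually_elim
      case (elim n)
      have "(\<Sum>k=1..n. (q k)\<^sup>2 / h k * (h k * expectation (\<lambda>\<omega>. (\<eta> k \<omega>)\<^sup>2)))
          = (\<Sum>k=1..n. (q k)\<^sup>2 * expectation (\<lambda>\<omega>. (\<eta> k \<omega>)\<^sup>2))"
        by (intro sum.cong refl) (use h_pos in force)
      then show ?case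
        unfolding norming_sq[OF elim, symmetric] by (simp add: w_def sum_distrib_left power_mult_distrib power_divide mult_ac)
    qed
    show "(\<lambda>n. \<Sum>k=1..n. (w n k)\<^sup>2 * expectation (\<lambda>\<omega>. (\<eta> k \<omega>)\<^sup>2)) \<longlonglongrightarrow> (1 - a) * \<tau> / f\<^sup>2"
      by (rule Lim_transform_eventually[OF lim ev])
    have "(\<lambda>k. q k ^ 3 / (h k)\<^sup>2) \<in> GS (real 3 * - a - real 2 * - a)"
      by (intro GS_divide GS_power q_GS h_GS)
    then obtain C where C: "C > 0"
        "\<And>n. n \<ge> 1 \<Longrightarrow> (\<Sum>k=1..n. q k ^ 3 / (h k)\<^sup>2) \<le> C * (real n * (q n ^ 3 / (h n)\<^sup>2))"
      using GS_sum_bound[of "\<lambda>k. q k ^ 3 / (h k)\<^sup>2" "real 3 * - a - real 2 * - a"] a_less_third by auto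
    show "(\<lambda>n. \<Sum>k=1..n. \<bar>w n k\<bar> ^ 3 * expectation (\<lambda>\<omega>. \<bar>\<eta> k \<omega>\<bar> ^ 3)) \<longlonglongrightarrow> 0"
    proof (rule tendsto_sandwich[OF _ _ tendsto_const])
      have "(\<lambda>n. (\<rho> n / f) ^ 3 * (8 * B) * C * (norming n ^ 3 * (real n * (q n ^ 3 / (h n)\<^sup>2))))
          \<longlonglongrightarrow> ((1 - a) / f) ^ 3 * (8 * B) * C * 0"
        using f_pos by (intro tendsto_intros \<rho> norming_cube_tendsto_0) auto
      then show "(\<lambda>n. (\<rho> n / f) ^ 3 * (8 * B) * C * (norming n ^ 3 * (real n * (q n ^ 3 / (h n)\<^sup>2)))) \<longlonglongrightarrow> 0"
        by simp
      show "\<forall>\<^sub>F n in sequentially. (\<Sum>k=1..n. \<bar>w n k\<bar> ^ 3 * expectation (\<lambda>\<omega>. \<bar>\<eta> k \<omega>\<bar> ^ 3))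
          \<le> (\<rho> n / f) ^ 3 * (8 * B) * C * (norming n ^ 3 * (real n * (q n ^ 3 / (h n)\<^sup>2)))"
        using eventually_ge_at_top[of 1]
      proof eventually_elim
        case (elim n)
        have pre: "0 \<le> (\<rho> n * norming n / f) ^ 3 * (8 * B)"
          using \<rho>_nonneg[of n] norming_nonneg[of n] f_pos B_pos by simp
        have "(\<Sum>k=1..n. \<bar>w n k\<bar> ^ 3 * expectation (\<lambda>\<omega>. \<bar>\<eta> k \<omega>\<bar> ^ 3))
            \<le> (\<Sum>k=1..n. (\<rho> n * norming n / f * q k) ^ 3 * (8 * B / (h k)\<^sup>2))"
        proof (rule sum_mono)
          fix k assume "k \<in> {1..n}"
          then have k: "k \<ge> 1" by simp
          have "\<bar>w n k\<bar> = \<rho> n * norming n / f * q k"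
            unfolding w_def using \<rho>_nonneg[of n] norming_nonneg[of n] f_pos q_pos[OF k] by (intro abs_of_nonneg) auto
          then have "\<bar>w n k\<bar> ^ 3 * expectation (\<lambda>\<omega>. \<bar>\<eta> k \<omega>\<bar> ^ 3) = (\<rho> n * norming n / f * q k) ^ 3 * expectation (\<lambda>\<omega>. \<bar>\<eta> k \<omega>\<bar> ^ 3)"
            by (simp only:)
          also have "\<dots> \<le> (\<rho> n * norming n / f * q k) ^ 3 * (8 * B / (h k)\<^sup>2)"
            using \<rho>_nonneg[of n] norming_nonneg[of n] f_pos q_pos[OF k]
            by (intro mult_left_mono \<eta>_moments(5) k zero_le_power mult_nonneg_nonneg divide_nonneg_nonneg) auto
          finally show "\<bar>w n k\<bar> ^ 3 * expectation (\<lambda>\<omega>. \<bar>\<eta> k \<omega>\<bar> ^ 3) \<le> (\<rho> n * norming n / f * q k) ^ 3 * (8 * B / (h k)\<^sup>2)" .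
        qed
        also have "\<dots> = (\<rho> n * norming n / f) ^ 3 * (8 * B) * (\<Sum>k=1..n. q k ^ 3 / (h k)\<^sup>2)"
          unfolding sum_distrib_left by (intro sum.cong refl) (simp add: power_mult_distrib power_divide)
        also have "\<dots> \<le> (\<rho> n * norming n / f) ^ 3 * (8 * B) * (C * (real n * (q n ^ 3 / (h n)\<^sup>2)))"
          by (intro mult_left_mono C(2) elim pre)
        also have "\<dots> = (\<rho> n / f) ^ 3 * (8 * B) * C * (norming n ^ 3 * (real n * (q n ^ 3 / (h n)\<^sup>2)))"
          by (simp add: power_mult_distrib power_divide)
        finally show ?case .
      qed
    qed (auto intro!: always_eventually sum_nonneg mult_nonneg_nonneg)
    show "integrable M (\<lambda>\<omega>. \<rho> n * norming n / f * T n \<omega>)" for n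
      using T by (simp add: negligible_def)
    have "(\<lambda>n. \<rho> n / f * (norming n * expectation (\<lambda>\<omega>. \<bar>T n \<omega>\<bar>))) \<longlonglongrightarrow> (1 - a) / f * 0"
      using T f_pos by (intro tendsto_intros \<rho>) (auto simp: negligible_def)
    then show "(\<lambda>n. expectation (\<lambda>\<omega>. \<bar>\<rho> n * norming n / f * T n \<omega>\<bar>)) \<longlonglongrightarrow> 0"
      using f_pos norming_nonneg \<rho>_nonneg by (simp add: abs_mult abs_of_nonneg mult.assoc)
  qed (use \<eta>_moments in auto)
qed

end



section \<open>Kernel smoothing of conditional moments\<close>

text \<open>
  Fubini's theorem and the substitution \<open>s = x - h z\<close>. The moment of \<open>Y\<close> is bounded in \<open>s\<close>, so
  integrability needs no more than that of \<open>k\<close>, even where \<open>\<psi>\<close> grows.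
\<close>

lemma kernel_expectation:
  fixes M :: "'w measure" and X Y :: "'w \<Rightarrow> real" and g :: "real \<Rightarrow> real \<Rightarrow> real"
  assumes M: "prob_space M"
    and g_nonneg: "\<And>s t. 0 \<le> g s t"
    and D: "distributed M (lborel \<Otimes>\<^sub>M lborel) (\<lambda>\<omega>. (X \<omega>, Y \<omega>)) (\<lambda>(s, t). ennreal (g s t))"
    and k: "integrable lborel k" and \<psi>: "\<psi> \<in> borel_measurable borel"
    and bdd: "bdd_integral (\<lambda>s t. \<bar>\<psi> t\<bar> * g s t)" and h: "0 < h"
  shows "integrable M (\<lambda>\<omega>. k ((x - X \<omega>) / h) * \<psi> (Y \<omega>))" (is ?int)
    and "(LINT \<omega>|M. k ((x - X \<omega>) / h) * \<psi> (Y \<omega>))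
      = h * (LINT z|lborel. k z * (LINT t|lborel. \<psi> t * g (x - h * z) t))" (is ?eq)
proof -
  interpret prob_space M by fact
  have [measurable]: "k \<in> borel_measurable borel" using k by auto
  note [measurable] = \<psi>
  have D': "distributed M (lborel \<Otimes>\<^sub>M lborel) (\<lambda>\<omega>. (X \<omega>, Y \<omega>)) (\<lambda>p. ennreal (case_prod g p))"
    using D by (simp add: case_prod_beta')
  have g_meas: "case_prod g \<in> borel_measurable (lborel \<Otimes>\<^sub>M lborel)"
    by (rule distributed_real_measurable[OF _ D']) (auto simp: g_nonneg)
  then have [measurable]: "case_prod g \<in> borel_measurable (borel \<Otimes>\<^sub>M borel)"
    by (simp cong: measurable_cong_sets)
  obtain C where C: "\<And>s. \<bar>LINT t|lborel. \<bar>\<psi> t\<bar> * g s t\<bar> \<le> C"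
    using bdd by (auto simp: bdd_integral_def bounded_iff)
  have int_abs: "integrable lborel (\<lambda>t. \<bar>\<psi> t\<bar> * g s t)" for s
    using bdd by (auto simp: bdd_integral_def)
  have [measurable]: "g s \<in> borel_measurable borel" for s
  proof -
    have "(\<lambda>t. case_prod g (s, t)) \<in> borel_measurable borel" by measurable
    then show ?thesis by simp
  qed
  have int_\<psi>: "integrable lborel (\<lambda>t. \<psi> t * g s t)" for s
    by (rule Bochner_Integration.integrable_bound[OF int_abs[of s]]) (auto simp: abs_mult g_nonneg)
  define F where "F = (\<lambda>p. case_prod g p * (k ((x - fst p) / h) * \<psi> (snd p)))"
  have k': "integrable lborel (\<lambda>s. k ((x - s) / h))"
  proof -
    have "integrable lborel (\<lambda>s. k (x / h + (- 1 / h) * s))"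
      using h by (intro lborel_integrable_real_affine k) auto
    then show ?thesis by (simp add: diff_divide_distrib)
  qed
  have F_meas: "F \<in> borel_measurable (lborel \<Otimes>\<^sub>M lborel)"
    unfolding F_def by measurable
  have F_int: "integrable (lborel \<Otimes>\<^sub>M lborel) F"
  proof (rule lborel_pair.Fubini_integrable[OF F_meas])
    have eq: "(LINT t|lborel. norm (F (s, t))) = \<bar>k ((x - s) / h)\<bar> * (LINT t|lborel. \<bar>\<psi> t\<bar> * g s t)" for s
      by (simp add: F_def abs_mult g_nonneg mult_ac flip: integral_mult_right_zero)
    have A: "(\<lambda>s. LINT t|lborel. \<bar>\<psi> t\<bar> * g s t) \<in> borel_measurable borel" by measurable
    show "integrable lborel (\<lambda>s. LINT t|lborel. norm (F (s, t)))"
      unfolding eq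
    proof (rule Bochner_Integration.integrable_bound[of _ "\<lambda>s. C * \<bar>k ((x - s) / h)\<bar>"])
      show "integrable lborel (\<lambda>s. C * \<bar>k ((x - s) / h)\<bar>)" using k' by auto
      show "(\<lambda>s. \<bar>k ((x - s) / h)\<bar> * (LINT t|lborel. \<bar>\<psi> t\<bar> * g s t)) \<in> borel_measurable lborel"
        using A by measurable
      have C0: "C \<ge> 0" using C[of 0] by linarith
      show "AE s in lborel. norm (\<bar>k ((x - s) / h)\<bar> * (LINT t|lborel. \<bar>\<psi> t\<bar> * g s t)) \<le> norm (C * \<bar>k ((x - s) / h)\<bar>)"
        using C C0 by (auto simp: abs_mult mult.commute[of C] intro!: mult_left_mono)
    qed
    show "AE s in lborel. integrable lborel (\<lambda>t. F (s, t))"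
    proof (rule AE_I2)
      fix s
      have "F (s, t) = k ((x - s) / h) * (\<psi> t * g s t)" for t
        by (simp add: F_def)
      then show "integrable lborel (\<lambda>t. F (s, t))" using int_\<psi>[of s] by simp
    qed
  qed
  have meas: "(\<lambda>p. k ((x - fst p) / h) * \<psi> (snd p)) \<in> borel_measurable (lborel \<Otimes>\<^sub>M lborel)"
    by measurable
  show ?int
    using distributed_integrable[OF D' meas] F_int by (simp add: F_def g_nonneg case_prod_beta')
  have "(LINT \<omega>|M. k ((x - X \<omega>) / h) * \<psi> (Y \<omega>)) = integral\<^sup>L (lborel \<Otimes>\<^sub>M lborel) F"
    using distributed_integral[OF D' meas] by (simp add: F_def g_nonneg case_prod_beta')
  also have "\<dots> = (LINT s|lborel. LINT t|lborel. F (s, t))"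
    by (rule lborel_pair.integral_fst'[OF F_int, symmetric])
  also have "\<dots> = (LINT s|lborel. k ((x - s) / h) * (LINT t|lborel. \<psi> t * g s t))"
    by (simp add: F_def mult_ac flip: integral_mult_right_zero)
  also have "\<dots> = h * (LINT z|lborel. k z * (LINT t|lborel. \<psi> t * g (x - h * z) t))"
    by (subst lborel_integral_real_affine[of "- h" _ x]) (use h in auto)
  finally show ?eq .
qed

lemma kernel_smoothing_integrable:
  fixes k G :: "real \<Rightarrow> real"
  assumes k: "integrable lborel k" and [measurable]: "G \<in> borel_measurable borel" and G: "\<And>s. \<bar>G s\<bar> \<le> C"
  shows "integrable lborel (\<lambda>z. k z * G (x - h * z))"
proof (rule Bochner_Integration.integrable_bound[of _ "\<lambda>z. C * \<bar>k z\<bar>"])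
  have [measurable]: "k \<in> borel_measurable borel" using k by auto
  show "integrable lborel (\<lambda>z. C * \<bar>k z\<bar>)" using k by auto
  show "(\<lambda>z. k z * G (x - h * z)) \<in> borel_measurable lborel" by measurable
  have "C \<ge> 0" using G[of 0] by linarith
  then show "AE z in lborel. norm (k z * G (x - h * z)) \<le> norm (C * \<bar>k z\<bar>)"
    using G by (auto simp: abs_mult mult.commute[of C] intro!: mult_left_mono)
qed

lemma kernel_smoothing_bound:
  fixes k G :: "real \<Rightarrow> real"
  assumes k: "integrable lborel k" "\<And>z. 0 \<le> k z"
    and G_meas: "G \<in> borel_measurable borel" and G: "\<And>s. \<bar>G s\<bar> \<le> C"
  shows "(LINT z|lborel. k z * G (x - h * z)) \<le> C * (LINT z|lborel. k z)"
proof -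
  have "(LINT z|lborel. k z * G (x - h * z)) \<le> (LINT z|lborel. k z * C)"
    using k G kernel_smoothing_integrable[OF k(1) G_meas G]
    by (intro integral_mono) (auto simp: abs_le_iff intro!: mult_left_mono)
  then show ?thesis by (simp add: mult.commute)
qed

text \<open>
  A second-order Taylor estimate at \<open>x\<close> that holds for all displacements \<open>u\<close>, not only for small ones:
  it can be integrated against a kernel of unbounded support.
\<close>

definition second_order_at :: "(real \<Rightarrow> real) \<Rightarrow> real \<Rightarrow> bool" where
  "second_order_at G x \<longleftrightarrow> (\<exists>D C. \<forall>u. \<bar>G (x + u) - G x - D * u\<bar> \<le> C * u\<^sup>2)"

lemma second_order_at_diff:
  assumes "second_order_at G x" "second_order_at H x"
  shows "second_order_at (\<lambda>s. G s - c * H s) x"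
proof -
  obtain D C where G: "\<And>u. \<bar>G (x + u) - G x - D * u\<bar> \<le> C * u\<^sup>2"
    using assms(1) by (auto simp: second_order_at_def)
  obtain D' C' where H: "\<And>u. \<bar>H (x + u) - H x - D' * u\<bar> \<le> C' * u\<^sup>2"
    using assms(2) by (auto simp: second_order_at_def)
  have "\<bar>(G (x + u) - c * H (x + u)) - (G x - c * H x) - (D - c * D') * u\<bar> \<le> (C + \<bar>c\<bar> * C') * u\<^sup>2" for u
  proof -
    have "(G (x + u) - c * H (x + u)) - (G x - c * H x) - (D - c * D') * u
        = (G (x + u) - G x - D * u) - c * (H (x + u) - H x - D' * u)"
      by (simp add: algebra_simps)
    also have "\<bar>\<dots>\<bar> \<le> \<bar>G (x + u) - G x - D * u\<bar> + \<bar>c\<bar> * \<bar>H (x + u) - H x - D' * u\<bar>"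
      unfolding abs_mult[symmetric] by (rule abs_triangle_ineq4)
    also have "\<dots> \<le> C * u\<^sup>2 + \<bar>c\<bar> * (C' * u\<^sup>2)"
      by (intro add_mono mult_left_mono G H) simp
    finally show ?thesis by (simp add: algebra_simps)
  qed
  then show ?thesis by (auto simp: second_order_at_def)
qed

text \<open>
  The linear term of the expansion is annihilated by \<open>\<integral> z K(z) dz = 0\<close>; the quadratic error is integrated
  against \<open>K\<close>.
\<close>

lemma kernel_smoothing_bias:
  fixes K G :: "real \<Rightarrow> real"
  assumes K_nonneg: "\<And>z. 0 \<le> K z" and K1: "has_bochner_integral lborel K 1"
    and Kz: "has_bochner_integral lborel (\<lambda>z. z * K z) 0"
    and Kz2: "integrable lborel (\<lambda>z. z\<^sup>2 * K z)"
    and G_meas: "G \<in> borel_measurable borel" and G: "\<And>s. \<bar>G s\<bar> \<le> C0"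
    and G2: "second_order_at G x"
  obtains B where "0 < B" "\<And>h. \<bar>(LINT z|lborel. K z * G (x - h * z)) - G x\<bar> \<le> B * h\<^sup>2"
proof -
  obtain D C where taylor: "\<And>u. \<bar>G (x + u) - G x - D * u\<bar> \<le> C * u\<^sup>2"
    using G2 by (auto simp: second_order_at_def)
  define S where "S = C * (LINT z|lborel. z\<^sup>2 * K z)"
  have int: "integrable lborel K" "integrable lborel (\<lambda>z. z * K z)"
    "(LINT z|lborel. K z) = 1" "(LINT z|lborel. z * K z) = 0"
    using K1 Kz by (auto simp: has_bochner_integral_iff)
  have "\<bar>(LINT z|lborel. K z * G (x - h * z)) - G x\<bar> \<le> S * h\<^sup>2" for h
  proof -
    note intG = kernel_smoothing_integrable[OF int(1) G_meas G, of x h]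
    have "(LINT z|lborel. K z * (G (x - h * z) - G x - D * (- h * z)))
        = (LINT z|lborel. K z * G (x - h * z) - G x * K z + D * h * (z * K z))"
      by (intro Bochner_Integration.integral_cong) (auto simp: algebra_simps)
    also have "\<dots> = (LINT z|lborel. K z * G (x - h * z)) - G x"
      using intG int by simp
    finally have eq: "(LINT z|lborel. K z * G (x - h * z)) - G x
        = (LINT z|lborel. K z * (G (x - h * z) - G x - D * (- h * z)))" ..
    have int': "integrable lborel (\<lambda>z. K z * (G (x - h * z) - G x - D * (- h * z)))"
    proof -
      have "integrable lborel (\<lambda>z. K z * G (x - h * z) - G x * K z + D * h * (z * K z))"
        using intG int by simp
      then show ?thesis by (simp add: algebra_simps)
    qed
    have "\<bar>LINT z|lborel. K z * (G (x - h * z) - G x - D * (- h * z))\<bar>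
        \<le> (LINT z|lborel. \<bar>K z * (G (x - h * z) - G x - D * (- h * z))\<bar>)"
      by (rule integral_abs_bound)
    also have "\<dots> \<le> (LINT z|lborel. C * h\<^sup>2 * (z\<^sup>2 * K z))"
    proof (rule integral_mono)
      show "integrable lborel (\<lambda>z. \<bar>K z * (G (x - h * z) - G x - D * (- h * z))\<bar>)"
        using int' by auto
      show "integrable lborel (\<lambda>z. C * h\<^sup>2 * (z\<^sup>2 * K z))" using Kz2 by simp
      fix z
      have "\<bar>K z * (G (x - h * z) - G x - D * (- h * z))\<bar> \<le> K z * (C * (- h * z)\<^sup>2)"
        using taylor[of "- h * z"] K_nonneg[of z] by (simp add: abs_mult mult_left_mono)
      then show "\<bar>K z * (G (x - h * z) - G x - D * (- h * z))\<bar> \<le> C * h\<^sup>2 * (z\<^sup>2 * K z)"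
        by (simp add: power_mult_distrib mult_ac)
    qed
    also have "\<dots> = C * h\<^sup>2 * (LINT z|lborel. z\<^sup>2 * K z)"
      by (rule integral_mult_right_zero)
    finally show ?thesis
      unfolding eq S_def by (simp only: mult_ac)
  qed
  moreover have "S * h\<^sup>2 \<le> (\<bar>S\<bar> + 1) * h\<^sup>2" for h :: real
    by (intro mult_right_mono) auto
  ultimately show thesis
    by (intro that[of "\<bar>S\<bar> + 1"]) (auto intro: order_trans)
qed

lemma kernel_smoothing_limit:
  fixes k G :: "real \<Rightarrow> real"
  assumes k: "integrable lborel k" and G_meas: "G \<in> borel_measurable borel" and G: "\<And>s. \<bar>G s\<bar> \<le> C"
    and cont: "isCont G x" and h: "h \<longlonglongrightarrow> 0"
  shows "(\<lambda>n. LINT z|lborel. k z * G (x - h n * z)) \<longlonglongrightarrow> G x * (LINT z|lborel. k z)"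
proof -
  note [measurable] = G_meas
  have [measurable]: "k \<in> borel_measurable borel" using k by auto
  have "(\<lambda>n. LINT z|lborel. k z * G (x - h n * z)) \<longlonglongrightarrow> (LINT z|lborel. k z * G x)"
  proof (rule integral_dominated_convergence[where w = "\<lambda>z. C * \<bar>k z\<bar>"])
    show "integrable lborel (\<lambda>z. C * \<bar>k z\<bar>)" using k by auto
    have "(\<lambda>n. k z * G (x - h n * z)) \<longlonglongrightarrow> k z * G x" for z
    proof (intro tendsto_intros isCont_tendsto_compose[OF cont])
      show "(\<lambda>n. x - h n * z) \<longlonglongrightarrow> x"
        using tendsto_diff[OF tendsto_const[of x] tendsto_mult[OF h tendsto_const[of z]]] by simp
    qed
    then show "AE z in lborel. (\<lambda>n. k z * G (x - h n * z)) \<longlonglongrightarrow> k z * G x" by simp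
    have "C \<ge> 0" using G[of 0] by linarith
    then show "AE z in lborel. norm (k z * G (x - h n * z)) \<le> C * \<bar>k z\<bar>" for n
      using G by (auto simp: abs_mult mult.commute[of C] intro!: mult_left_mono)
  qed measurable
  then show ?thesis by (simp add: mult.commute)
qed

text \<open>
  With the absolute value and the unordered segment, one formula covers both signs of \<open>u\<close>: reversing
  the orientation of the segment also changes the sign of \<open>x + u - s\<close>.
\<close>

lemma taylor_integral_remainder:
  fixes \<phi> \<phi>' \<phi>'' :: "real \<Rightarrow> real"
  assumes d1: "\<And>s. (\<phi> has_real_derivative \<phi>' s) (at s)"
    and d2: "\<And>s. (\<phi>' has_real_derivative \<phi>'' s) (at s)"
    and cont: "continuous_on UNIV \<phi>''"
  shows "(LINT s|lborel. indicator {min x (x + u)..max x (x + u)} s * (\<bar>x + u - s\<bar> * \<phi>'' s))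
    = \<phi> (x + u) - \<phi> x - u * \<phi>' x"
proof -
  have deriv: "((\<lambda>s. \<phi> s + (x + u - s) * \<phi>' s) has_real_derivative (x + u - s) * \<phi>'' s) (at s)" for s
    by (auto intro!: derivative_eq_intros d1 d2)
  have cont': "isCont (\<lambda>s. (x + u - s) * \<phi>'' s) s" for s
    using cont by (intro continuous_intros) (auto simp: continuous_on_eq_continuous_at)
  have ftc: "(LINT s|lborel. ((x + u - s) * \<phi>'' s) * indicator {a..b} s)
      = (\<phi> b + (x + u - b) * \<phi>' b) - (\<phi> a + (x + u - a) * \<phi>' a)" if "a \<le> b" for a b
    using has_bochner_integral_FTC_Icc_real[OF that deriv cont'] by (simp add: has_bochner_integral_iff)
  show ?thesis
  proof (cases "u \<ge> 0")
    case True
    have "(LINT s|lborel. indicator {min x (x + u)..max x (x + u)} s * (\<bar>x + u - s\<bar> * \<phi>'' s))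
        = (LINT s|lborel. ((x + u - s) * \<phi>'' s) * indicator {x..x + u} s)"
      using True by (intro Bochner_Integration.integral_cong) (auto simp: indicator_def)
    then show ?thesis using ftc[of x "x + u"] True by simp
  next
    case False
    have "(LINT s|lborel. indicator {min x (x + u)..max x (x + u)} s * (\<bar>x + u - s\<bar> * \<phi>'' s))
        = (LINT s|lborel. - (((x + u - s) * \<phi>'' s) * indicator {x + u..x} s))"
      using False by (intro Bochner_Integration.integral_cong) (auto simp: indicator_def algebra_simps)
    also have "\<dots> = - (LINT s|lborel. ((x + u - s) * \<phi>'' s) * indicator {x + u..x} s)"
      by simp
    finally show ?thesis using ftc[of "x + u" x] False by simp
  qed
qed

text \<open>
  For \<open>\<bar>u\<bar> \<le> \<delta>\<close>, Taylor's formula with integral remainder is integrated against \<open>\<psi>\<close>; joint integrability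
  near \<open>x\<close> allows the order of integration to be exchanged, and the remainder is an average of the
  bounded function \<open>s \<mapsto> \<integral> \<psi>(t) \<partial>\<^sup>2g/\<partial>s\<^sup>2(s,t) dt\<close>. For larger \<open>u\<close>, boundedness of the moment suffices.
\<close>

lemma second_order_at_moment:
  fixes g :: "real \<Rightarrow> real \<Rightarrow> real" and \<psi> :: "real \<Rightarrow> real"
  assumes C2: "C2_in_first g"
    and G: "bdd_integral (\<lambda>s t. \<psi> t * g s t)"
    and G2: "bdd_integral (\<lambda>s t. \<psi> t * diff2 g s t)"
    and \<delta>: "0 < \<delta>" and joint: "set_integrable (lborel \<Otimes>\<^sub>M lborel) ({x - \<delta>..x + \<delta>} \<times> UNIV)
      (\<lambda>(s, t). \<psi> t * diff2 g s t)"
  shows "second_order_at (\<lambda>s. LINT t|lborel. \<psi> t * g s t) x"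
proof -
  define m where "m s = (LINT t|lborel. \<psi> t * g s t)" for s
  define m2 where "m2 s = (LINT t|lborel. \<psi> t * diff2 g s t)" for s
  obtain Cm where Cm: "\<And>s. \<bar>m s\<bar> \<le> Cm"
    using G by (auto simp: bdd_integral_def bounded_iff m_def)
  obtain C2 where C2': "\<And>s. \<bar>m2 s\<bar> \<le> C2"
    using G2 by (auto simp: bdd_integral_def bounded_iff m2_def)
  have pos: "Cm \<ge> 0" "C2 \<ge> 0" using Cm[of 0] C2'[of 0] by linarith+
  have int_g: "integrable lborel (\<lambda>t. \<psi> t * g s t)" for s
    using G by (auto simp: bdd_integral_def)
  define D where "D = (LINT t|lborel. \<psi> t * diff1 g x t)"
  define w where "w u s = indicator {min x (x + u)..max x (x + u)} s * \<bar>x + u - s\<bar>" for u s :: real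
  have w_bound: "\<bar>w u s\<bar> \<le> \<bar>u\<bar> * indicator {min x (x + u)..max x (x + u)} s" for u s
    by (auto simp: w_def indicator_def)
  have rem: "(LINT s|lborel. w u s * (\<psi> t * diff2 g s t)) = \<psi> t * (g (x + u) t - g x t - u * diff1 g x t)" for u t
  proof -
    have "((\<lambda>s. g s t) has_real_derivative diff1 g s t) (at s)"
      "((\<lambda>s. diff1 g s t) has_real_derivative diff2 g s t) (at s)"
      "continuous_on UNIV (\<lambda>s. diff2 g s t)" for s
      using C2 by (auto simp: C2_in_first_def diff1_def diff2_def DERIV_deriv_iff_field_differentiable)
    note remainder = taylor_integral_remainder[OF this, of x u]
    have "(LINT s|lborel. w u s * (\<psi> t * diff2 g s t)) = (LINT s|lborel. \<psi> t *
        (indicator {min x (x + u)..max x (x + u)} s * (\<bar>x + u - s\<bar> * diff2 g s t)))"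
      by (intro Bochner_Integration.integral_cong) (auto simp: w_def)
    then show ?thesis using remainder by simp
  qed
  have P_int: "integrable (lborel \<Otimes>\<^sub>M lborel) (\<lambda>(s, t). w u s * (\<psi> t * diff2 g s t))" if u: "\<bar>u\<bar> \<le> \<delta>" for u
  proof -
    have j: "integrable (lborel \<Otimes>\<^sub>M lborel) (\<lambda>p. indicator ({x - \<delta>..x + \<delta>} \<times> UNIV) p * (\<psi> (snd p) * diff2 g (fst p) (snd p)))"
      using joint by (simp add: set_integrable_def case_prod_beta')
    have "integrable (lborel \<Otimes>\<^sub>M lborel) (\<lambda>p. w u (fst p) *
        (indicator ({x - \<delta>..x + \<delta>} \<times> UNIV) p * (\<psi> (snd p) * diff2 g (fst p) (snd p))))"
    proof (rule Bochner_Integration.integrable_bound[OF integrable_mult_right[OF j, of "\<bar>u\<bar>"]])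
      have [measurable]: "w u \<in> borel_measurable borel" unfolding w_def by measurable
      show "(\<lambda>p. w u (fst p) * (indicator ({x - \<delta>..x + \<delta>} \<times> UNIV) p * (\<psi> (snd p) * diff2 g (fst p) (snd p))))
          \<in> borel_measurable (lborel \<Otimes>\<^sub>M lborel)"
        by (rule borel_measurable_times[OF _ borel_measurable_integrable[OF j]]) measurable
      have "\<bar>w u s\<bar> \<le> \<bar>u\<bar>" for s
        using w_bound[of u s] by (cases "s \<in> {min x (x + u)..max x (x + u)}") (simp_all only: indicator_simps, auto)
      then show "AE p in lborel \<Otimes>\<^sub>M lborel. norm (w u (fst p) *
          (indicator ({x - \<delta>..x + \<delta>} \<times> UNIV) p * (\<psi> (snd p) * diff2 g (fst p) (snd p))))
        \<le> norm (\<bar>u\<bar> * (indicator ({x - \<delta>..x + \<delta>} \<times> UNIV) p * (\<psi> (snd p) * diff2 g (fst p) (snd p))))"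
        by (auto simp: abs_mult intro!: mult_right_mono)
    qed
    moreover have "w u (fst p) * (indicator ({x - \<delta>..x + \<delta>} \<times> UNIV) p * y) = w u (fst p) * y" for p :: "real \<times> real" and y :: real
      using u by (cases p) (auto simp: w_def indicator_def)
    ultimately show ?thesis by (simp add: case_prod_beta')
  qed
  have int_rem: "integrable lborel (\<lambda>t. \<psi> t * (g (x + u) t - g x t - u * diff1 g x t))" if "\<bar>u\<bar> \<le> \<delta>" for u
    using lborel_pair.integrable_snd[OF P_int[OF that]] by (simp add: rem)
  (* Taylor's formula at u = \<delta> expresses the derivative through integrable terms. *)
  have int_diff1: "integrable lborel (\<lambda>t. \<psi> t * diff1 g x t)"
  proof -
    have "integrable lborel (\<lambda>t. (\<psi> t * g (x + \<delta>) t - \<psi> t * g x t - \<psi> t * (g (x + \<delta>) t - g x t - \<delta> * diff1 g x t)) / \<delta>)"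
      using int_g int_rem[of \<delta>] \<delta> by auto
    also have "(\<lambda>t. (\<psi> t * g (x + \<delta>) t - \<psi> t * g x t - \<psi> t * (g (x + \<delta>) t - g x t - \<delta> * diff1 g x t)) / \<delta>)
        = (\<lambda>t. \<psi> t * diff1 g x t)"
      using \<delta> by (auto simp: field_simps)
    finally show ?thesis .
  qed
  have near: "\<bar>m (x + u) - m x - D * u\<bar> \<le> C2 * u\<^sup>2" if u: "\<bar>u\<bar> \<le> \<delta>" for u
  proof -
    have "m (x + u) - m x - D * u = (LINT t|lborel. \<psi> t * g (x + u) t - \<psi> t * g x t - u * (\<psi> t * diff1 g x t))"
      using int_g int_diff1 by (simp add: m_def D_def mult.commute)
    also have "\<dots> = (LINT t|lborel. LINT s|lborel. w u s * (\<psi> t * diff2 g s t))"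
      unfolding rem by (simp add: algebra_simps)
    also have "\<dots> = (LINT s|lborel. LINT t|lborel. w u s * (\<psi> t * diff2 g s t))"
      by (rule lborel_pair.Fubini_integral[OF P_int[OF u]])
    also have "\<dots> = (LINT s|lborel. w u s * m2 s)"
      by (simp add: m2_def)
    finally have eq: "m (x + u) - m x - D * u = (LINT s|lborel. w u s * m2 s)" .
    have int_wm: "integrable lborel (\<lambda>s. w u s * m2 s)"
      using lborel_pair.integrable_fst'[OF P_int[OF u]] by (simp add: m2_def)
    have "\<bar>LINT s|lborel. w u s * m2 s\<bar> \<le> (LINT s|lborel. \<bar>w u s * m2 s\<bar>)"
      by (rule integral_abs_bound)
    also have "\<dots> \<le> (LINT s|lborel. \<bar>u\<bar> * C2 * indicator {min x (x + u)..max x (x + u)} s)"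
    proof (rule integral_mono)
      show "integrable lborel (\<lambda>s. \<bar>w u s * m2 s\<bar>)" using int_wm by auto
      show "integrable lborel (\<lambda>s. \<bar>u\<bar> * C2 * indicator {min x (x + u)..max x (x + u)} s)" by simp
      fix s
      have "\<bar>w u s * m2 s\<bar> \<le> (\<bar>u\<bar> * indicator {min x (x + u)..max x (x + u)} s) * C2"
        unfolding abs_mult by (intro mult_mono w_bound C2') auto
      then show "\<bar>w u s * m2 s\<bar> \<le> \<bar>u\<bar> * C2 * indicator {min x (x + u)..max x (x + u)} s"
        by (simp add: mult_ac)
    qed
    also have "\<dots> = \<bar>u\<bar> * C2 * \<bar>u\<bar>"
      by (auto simp: min_def max_def)
    also have "\<dots> = C2 * u\<^sup>2" by (simp add: power2_eq_square mult_ac flip: abs_mult)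
    finally show ?thesis by (simp add: eq)
  qed
  define C where "C = C2 + 2 * Cm / \<delta>\<^sup>2 + \<bar>D\<bar> / \<delta>"
  have "\<bar>m (x + u) - m x - D * u\<bar> \<le> C * u\<^sup>2" for u
  proof (cases "\<bar>u\<bar> \<le> \<delta>")
    case True
    have "C2 * u\<^sup>2 \<le> C * u\<^sup>2"
      using pos \<delta> by (intro mult_right_mono) (auto simp: C_def)
    with near[OF True] show ?thesis by linarith
  next
    case False
    have "\<bar>u\<bar> * \<delta> \<le> \<bar>u\<bar> * \<bar>u\<bar>" "\<delta> * \<delta> \<le> \<bar>u\<bar> * \<bar>u\<bar>"
      using False \<delta> by (auto intro!: mult_mono simp del: abs_mult_self_eq)
    then have u: "\<bar>u\<bar> * \<delta> \<le> u\<^sup>2" "\<delta>\<^sup>2 \<le> u\<^sup>2"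
      by (simp_all add: power2_eq_square)
    have "\<bar>m (x + u) - m x - D * u\<bar> \<le> \<bar>m (x + u)\<bar> + \<bar>m x\<bar> + \<bar>D\<bar> * \<bar>u\<bar>"
      by (simp add: abs_mult[symmetric])
    also have "\<dots> \<le> 2 * Cm * 1 + \<bar>D\<bar> * \<bar>u\<bar>"
      using Cm[of "x + u"] Cm[of x] by simp
    also have "\<dots> \<le> 2 * Cm * (u\<^sup>2 / \<delta>\<^sup>2) + \<bar>D\<bar> * (u\<^sup>2 / \<delta>)"
      using u \<delta> pos by (intro add_mono mult_left_mono) (auto simp: field_simps)
    also have "\<dots> \<le> C * u\<^sup>2"
      using pos by (simp add: C_def algebra_simps)
    finally show ?thesis .
  qed
  then show ?thesis
    by (auto simp: second_order_at_def m_def)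
qed



section \<open>The averaged estimator\<close>

text \<open>
  This is the identity \<open>(1 - p)\<^sup>2 = (1 - a)(1 + a - 2p) + (p - a)\<^sup>2\<close>, divided by \<open>1 + a - 2p\<close>.
\<close>

lemma variance_factor_minus_min:
  assumes "p < (1 + a) / 2"
  shows "variance_factor a p = (1 - a) + (p - a)\<^sup>2 / (1 + a - 2 * p)"
proof -
  have "(1 - p)\<^sup>2 = (1 - a) * (1 + a - 2 * p) + (p - a)\<^sup>2"
    by (simp add: power2_eq_square algebra_simps)
  then show ?thesis
    using assms by (simp add: variance_factor_def add_divide_distrib)
qed

lemma variance_factor_at_min: "a < 1 \<Longrightarrow> variance_factor a a = 1 - a"
  using variance_factor_minus_min[of a a] by simp

lemma variance_factor_greater:
  assumes "p < (1 + a) / 2" "p \<noteq> a"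
  shows "1 - a < variance_factor a p"
proof -
  have "0 < (p - a)\<^sup>2 / (1 + a - 2 * p)" using assms by (intro divide_pos_pos) auto
  then show ?thesis using variance_factor_minus_min[OF assms(1)] by simp
qed

lemma is_arg_min_variance_factor:
  assumes a: "a < 1 / 3" and c: "0 < c"
  shows "is_arg_min (\<lambda>p. variance_factor a p * c) (\<lambda>p. p < min (1 - 2 * a) ((1 + a) / 2)) p \<longleftrightarrow> p = a"
proof
  assume "is_arg_min (\<lambda>p. variance_factor a p * c) (\<lambda>p. p < min (1 - 2 * a) ((1 + a) / 2)) p"
  then have p: "p < (1 + a) / 2" and "\<not> variance_factor a a * c < variance_factor a p * c"
    using a by (auto simp: is_arg_min_def)
  then have "\<not> variance_factor a a < variance_factor a p"
    using c by simp
  then show "p = a"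
    using variance_factor_greater[OF p] variance_factor_at_min[of a] a by force
next
  assume "p = a"
  moreover have "\<not> variance_factor a p' * c < variance_factor a a * c" if "p' < (1 + a) / 2" for p'
    using variance_factor_greater[OF that] variance_factor_at_min[of a] a c by (cases "p' = a") auto
  ultimately show "is_arg_min (\<lambda>p. variance_factor a p * c) (\<lambda>p. p < min (1 - 2 * a) ((1 + a) / 2)) p"
    using a by (auto simp: is_arg_min_def)
qed

text \<open>
  The quotient being eventually positive, so is \<open>ln (\<Sum> \<gamma>\<^sub>k)\<close>; as it also increases, it is bounded away
  from 0.
\<close>

lemma step_size_at_top:
  fixes \<gamma> :: "nat \<Rightarrow> real"
  assumes pos: "\<And>n. n \<ge> 1 \<Longrightarrow> 0 < \<gamma> n"
    and lim: "filterlim (\<lambda>n. real n * \<gamma> n * inverse (ln (\<Sum>k=1..n. \<gamma> k))) at_top sequentially"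
  shows "filterlim (\<lambda>n. real n * \<gamma> n) at_top sequentially"
proof -
  define s where "s n = (\<Sum>k=1..n. \<gamma> k)" for n
  have mono: "incseq s"
    unfolding s_def using pos by (intro incseq_SucI) (auto intro: less_imp_le)
  have ev: "\<forall>\<^sub>F n in sequentially. real n * \<gamma> n * inverse (ln (s n)) \<ge> c" for c
    using lim by (simp add: filterlim_at_top s_def)
  have "\<forall>\<^sub>F n in sequentially. 0 < ln (s n)"
    using ev[of 1] eventually_ge_at_top[of 1]
  proof eventually_elim
    case (elim n)
    then have "0 < real n * \<gamma> n" using pos[of n] by simp
    moreover have "0 < (real n * \<gamma> n) * inverse (ln (s n))" using elim by linarith
    ultimately have "0 < inverse (ln (s n))" by (simp only: zero_less_mult_pos)
    then show ?case by simp
  qed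
  then obtain N0 where "\<And>n. n \<ge> N0 \<Longrightarrow> 0 < ln (s n)"
    by (auto simp: eventually_sequentially)
  then obtain N where N: "N \<ge> 1" "\<And>n. n \<ge> N \<Longrightarrow> 0 < ln (s n)"
    by (rule that[of "Suc N0", rotated]) auto
  have s_pos: "0 < s n" if "n \<ge> 1" for n
    unfolding s_def using pos that by (intro sum_pos) auto
  have sN: "ln (s N) \<le> ln (s n)" if "n \<ge> N" for n
    using s_pos[of N] s_pos[of n] incseqD[OF mono that] N(1) that by simp
  show ?thesis
    unfolding filterlim_at_top
  proof
    fix c :: real
    show "\<forall>\<^sub>F n in sequentially. c \<le> real n * \<gamma> n"
      using ev[of "\<bar>c\<bar> / ln (s N)"] eventually_ge_at_top[of N]
    proof eventually_elim
      case (elim n)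
      have l: "0 < ln (s N)" "ln (s N) \<le> ln (s n)" using N sN[OF elim(2)] by auto
      have "\<bar>c\<bar> = \<bar>c\<bar> / ln (s N) * ln (s N)" using l by simp
      also have "\<dots> \<le> \<bar>c\<bar> / ln (s N) * ln (s n)"
        using l by (intro mult_left_mono) auto
      also have "\<dots> \<le> real n * \<gamma> n * inverse (ln (s n)) * ln (s n)"
        using elim(1) l by (intro mult_right_mono) auto
      also have "\<dots> = real n * \<gamma> n" using l by simp
      finally show ?case by linarith
    qed
  qed
qed

lemma bdd_integralD:
  assumes "bdd_integral \<phi>"
  shows bdd_integral_integrable: "integrable lborel (\<phi> s)"
    and bdd_integral_bound: "(\<And>C. 0 < C \<Longrightarrow> (\<And>s. \<bar>LINT t|lborel. \<phi> s t\<bar> \<le> C) \<Longrightarrow> thesis) \<Longrightarrow> thesis"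
proof -
  show "integrable lborel (\<phi> s)" using assms by (auto simp: bdd_integral_def)
  obtain C where "\<And>s. \<bar>LINT t|lborel. \<phi> s t\<bar> \<le> C"
    using assms by (auto simp: bdd_integral_def bounded_iff)
  then have "\<bar>LINT t|lborel. \<phi> s t\<bar> \<le> \<bar>C\<bar> + 1" for s
    by (rule order_trans) simp
  then show thesis if "\<And>C. 0 < C \<Longrightarrow> (\<And>s. \<bar>LINT t|lborel. \<phi> s t\<bar> \<le> C) \<Longrightarrow> thesis"
    using that[of "\<bar>C\<bar> + 1"] by auto
qed

lemma bdd_integral_dominated:
  assumes dom: "bdd_integral \<phi>" and meas: "\<And>s. \<theta> s \<in> borel_measurable borel"
    and le: "\<And>s t. \<bar>\<theta> s t\<bar> \<le> \<phi> s t"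
  shows "bdd_integral \<theta>"
proof -
  have int: "integrable lborel (\<theta> s)" for s
    using meas[of s] le order_trans[OF le abs_ge_self]
    by (intro Bochner_Integration.integrable_bound[OF bdd_integral_integrable[OF dom, of s]]) auto
  obtain C where C: "C > 0" "\<And>s. \<bar>LINT t|lborel. \<phi> s t\<bar> \<le> C"
    using bdd_integral_bound[OF dom] by blast
  have "\<bar>LINT t|lborel. \<theta> s t\<bar> \<le> C" for s
  proof -
    have "\<bar>LINT t|lborel. \<theta> s t\<bar> \<le> (LINT t|lborel. \<bar>\<theta> s t\<bar>)"
      by (rule integral_abs_bound)
    also have "\<dots> \<le> (LINT t|lborel. \<phi> s t)"
      using int by (intro integral_mono bdd_integral_integrable[OF dom] le) auto
    also have "\<dots> \<le> C" using C(2)[of s] by linarith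
    finally show ?thesis .
  qed
  with int show ?thesis by (auto simp: bdd_integral_def bounded_iff)
qed

lemma bdd_integral_add:
  assumes "bdd_integral \<phi>" "bdd_integral \<theta>"
  shows "bdd_integral (\<lambda>s t. \<phi> s t + \<theta> s t)"
proof -
  obtain C where C: "0 < C" "\<And>s. \<bar>LINT t|lborel. \<phi> s t\<bar> \<le> C"
    using bdd_integral_bound[OF assms(1)] by blast
  obtain C' where C': "0 < C'" "\<And>s. \<bar>LINT t|lborel. \<theta> s t\<bar> \<le> C'"
    using bdd_integral_bound[OF assms(2)] by blast
  have "\<bar>LINT t|lborel. \<phi> s t + \<theta> s t\<bar> \<le> C + C'" for s
    using C(2)[of s] C'(2)[of s] bdd_integral_integrable[OF assms(1), of s] bdd_integral_integrable[OF assms(2), of s] by simp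
  then show ?thesis
    using bdd_integral_integrable[OF assms(1)] bdd_integral_integrable[OF assms(2)]
    by (auto simp: bdd_integral_def bounded_iff)
qed

lemma bdd_integral_cmult:
  assumes "bdd_integral \<phi>"
  shows "bdd_integral (\<lambda>s t. c * \<phi> s t)"
proof -
  obtain C where C: "0 < C" "\<And>s. \<bar>LINT t|lborel. \<phi> s t\<bar> \<le> C"
    using bdd_integral_bound[OF assms] by blast
  have "\<bar>LINT t|lborel. c * \<phi> s t\<bar> \<le> \<bar>c\<bar> * C" for s
    using C(2)[of s] by (simp add: abs_mult mult_left_mono)
  then show ?thesis
    using bdd_integral_integrable[OF assms] by (auto simp: bdd_integral_def bounded_iff)
qed

text \<open>
  The sampling model at a fixed point \<open>x\<close>, without step size, bandwidth and weights.
\<close>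

locale revesz_model = prob_space M for M :: "'w measure" +
  fixes Xs Ys :: "nat \<Rightarrow> 'w \<Rightarrow> real"
    and g :: "real \<Rightarrow> real \<Rightarrow> real" and K :: "real \<Rightarrow> real" and x :: real
  assumes g_nonneg: "\<And>s t. 0 \<le> g s t"
    and ident: "\<And>n. 1 \<le> n \<Longrightarrow> distributed M (lborel \<Otimes>\<^sub>M lborel)
                  (\<lambda>\<omega>. (Xs n \<omega>, Ys n \<omega>)) (\<lambda>(s, t). ennreal (g s t))"
    and fx: "marginal_density g x \<noteq> 0"
    and K_nonneg: "\<And>z. 0 \<le> K z" and K_cont: "continuous_on UNIV K" and K_bdd: "bounded (range K)"
    and K_mass: "has_bochner_integral lborel K 1"
    and K_centered: "has_bochner_integral lborel (\<lambda>z. z * K z) 0"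
    and K_second: "integrable lborel (\<lambda>z. z\<^sup>2 * K z)"
    and g_C2: "C2_in_first g"
    and g_moments: "\<And>p. p \<in> {0, 1, 2 :: nat} \<Longrightarrow> bdd_cont_integral (\<lambda>s t. t ^ p * g s t) x"
    and g_third: "bdd_integral (\<lambda>s t. \<bar>t\<bar> powr 3 * g s t)"
    and g_diff2: "\<And>p. p \<in> {0, 1 :: nat} \<Longrightarrow> bdd_integral (\<lambda>s t. t ^ p * diff2 g s t)"
    and g_joint: "\<And>p. p \<in> {0, 1 :: nat} \<Longrightarrow> \<exists>\<delta>>0. set_integrable (lborel \<Otimes>\<^sub>M lborel)
           ({x - \<delta>..x + \<delta>} \<times> UNIV) (\<lambda>(s, t). t ^ p * diff2 g s t)"
begin

abbreviation "f \<equiv> marginal_density g"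
abbreviation "r \<equiv> regression g x"

lemma moment_integrable: "integrable lborel (g s)" "integrable lborel (\<lambda>t. t * g s t)" "integrable lborel (\<lambda>t. t\<^sup>2 * g s t)"
  using g_moments[of 0] g_moments[of 1] g_moments[of 2]
  by (auto simp: bdd_cont_integral_def dest: bdd_integral_integrable[of _ s])

lemma K_measurable [measurable]: "K \<in> borel_measurable borel"
  using K_cont by (rule borel_measurable_continuous_onI)

lemma g_section_measurable [measurable]: "g s \<in> borel_measurable borel"
  using moment_integrable(1)[of s] by auto

lemma g_measurable [measurable]: "case_prod g \<in> borel_measurable (borel \<Otimes>\<^sub>M borel)"
proof -
  have "distributed M (lborel \<Otimes>\<^sub>M lborel) (\<lambda>\<omega>. (Xs 1 \<omega>, Ys 1 \<omega>)) (\<lambda>p. ennreal (case_prod g p))"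
    using ident[of 1] by (simp add: case_prod_beta')
  then have "case_prod g \<in> borel_measurable (lborel \<Otimes>\<^sub>M lborel)"
    by (rule distributed_real_measurable[rotated]) (auto simp: g_nonneg)
  then show ?thesis by (simp cong: measurable_cong_sets)
qed

lemma f_pos: "0 < f x"
proof -
  have "0 \<le> f x" unfolding marginal_density_def by (intro Bochner_Integration.integral_nonneg) (simp add: g_nonneg)
  with fx show ?thesis by simp
qed

lemma K_power_integrable: "k \<ge> 1 \<Longrightarrow> integrable lborel (\<lambda>z. K z ^ k)"
proof -
  assume "k \<ge> 1"
  then obtain j where j: "k = Suc j" by (cases k) auto
  obtain C where C: "\<And>z. \<bar>K z\<bar> \<le> C" using K_bdd by (auto simp: bounded_iff)
  have "integrable lborel K" using K_mass by (simp add: has_bochner_integral_iff)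
  then have "integrable lborel (\<lambda>z. C ^ j * K z)" by simp
  then show ?thesis
  proof (rule Bochner_Integration.integrable_bound)
    have "K z ^ k \<le> C ^ j * K z" for z
      using K_nonneg[of z] C[of z] unfolding j power_Suc2 by (intro mult_right_mono power_mono) auto
    then show "AE z in lborel. norm (K z ^ k) \<le> norm (C ^ j * K z)"
      using K_nonneg by (auto intro!: AE_I2 order_trans[OF _ abs_ge_self])
  qed simp
qed

lemma K_sq_pos: "0 < (LINT z|lborel. (K z)\<^sup>2)"
proof -
  have "(LINT z|lborel. (K z)\<^sup>2) \<noteq> 0"
  proof
    assume "(LINT z|lborel. (K z)\<^sup>2) = 0"
    then have "AE z in lborel. (K z)\<^sup>2 = 0"
      using K_power_integrable[of 2] by (subst (asm) integral_nonneg_eq_0_iff_AE) auto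
    then have "(LINT z|lborel. K z) = 0"
      by (intro integral_eq_zero_AE) simp
    then show False using K_mass by (simp add: has_bochner_integral_iff)
  qed
  moreover have "0 \<le> (LINT z|lborel. (K z)\<^sup>2)" by simp
  ultimately show ?thesis by linarith
qed

lemma r_centers: "(LINT t|lborel. (t - r) * g x t) = 0"
proof -
  have "(LINT t|lborel. (t - r) * g x t) = (LINT t|lborel. t * g x t - r * g x t)"
    by (simp add: left_diff_distrib)
  also have "\<dots> = (LINT t|lborel. t * g x t) - r * f x"
    using moment_integrable[of x] by (simp add: marginal_density_def)
  finally show ?thesis using fx by (simp add: regression_def)
qed

text \<open>
  Absolute deviations are needed because integrability under the kernel is inherited from
  \<open>\<integral> \<bar>\<psi> t\<bar> g s t dt\<close>. All three follow from the moments of order 0, 2 and 3 about the origin.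
\<close>

lemma centered_moments:
  shows deviation_bdd: "bdd_integral (\<lambda>s t. \<bar>t - r\<bar> * g s t)"
    and square_deviation_bdd: "bdd_integral (\<lambda>s t. \<bar>(t - r)\<^sup>2\<bar> * g s t)"
    and cube_deviation_bdd: "bdd_integral (\<lambda>s t. \<bar>\<bar>t - r\<bar> ^ 3\<bar> * g s t)"
proof -
  have b0: "bdd_integral (\<lambda>s t. g s t)" and b2: "bdd_integral (\<lambda>s t. t\<^sup>2 * g s t)"
    using g_moments[of 0] g_moments[of 2] by (auto simp: bdd_cont_integral_def)
  have "\<bar>t\<bar> powr 3 = \<bar>t\<bar> ^ 3" for t :: real
    by (cases "t = 0") (auto simp: powr_numeral)
  with g_third have b3: "bdd_integral (\<lambda>s t. \<bar>t\<bar> ^ 3 * g s t)" by simp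
  have sq: "(t - r)\<^sup>2 \<le> 2 * t\<^sup>2 + 2 * r\<^sup>2" for t
  proof -
    have "0 \<le> (t + r)\<^sup>2" by simp
    then show ?thesis by (simp add: power2_eq_square algebra_simps)
  qed
  have "bdd_integral (\<lambda>s t. 2 * (t\<^sup>2 * g s t) + (2 * r\<^sup>2) * g s t)"
    by (intro bdd_integral_add bdd_integral_cmult b0 b2)
  then show d2: "bdd_integral (\<lambda>s t. \<bar>(t - r)\<^sup>2\<bar> * g s t)"
  proof (rule bdd_integral_dominated)
    fix s t
    show "\<bar>\<bar>(t - r)\<^sup>2\<bar> * g s t\<bar> \<le> 2 * (t\<^sup>2 * g s t) + (2 * r\<^sup>2) * g s t"
      using mult_right_mono[OF sq[of t] g_nonneg[of s t]] g_nonneg[of s t] by (simp add: abs_mult algebra_simps)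
  qed measurable
  have "bdd_integral (\<lambda>s t. \<bar>(t - r)\<^sup>2\<bar> * g s t + g s t)"
    by (intro bdd_integral_add d2 b0)
  then show "bdd_integral (\<lambda>s t. \<bar>t - r\<bar> * g s t)"
  proof (rule bdd_integral_dominated)
    fix s t
    have "0 \<le> (\<bar>t - r\<bar> - 1)\<^sup>2" by simp
    then have "\<bar>t - r\<bar> \<le> (t - r)\<^sup>2 + 1"
      using zero_le_power2[of "t - r"] by (simp add: power2_diff)
    from mult_right_mono[OF this g_nonneg[of s t]]
    show "\<bar>\<bar>t - r\<bar> * g s t\<bar> \<le> \<bar>(t - r)\<^sup>2\<bar> * g s t + g s t"
      using g_nonneg[of s t] by (simp add: abs_mult algebra_simps)
  qed measurable
  have "bdd_integral (\<lambda>s t. 4 * (\<bar>t\<bar> ^ 3 * g s t) + (4 * \<bar>r\<bar> ^ 3) * g s t)"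
    by (intro bdd_integral_add bdd_integral_cmult b0 b3)
  then show "bdd_integral (\<lambda>s t. \<bar>\<bar>t - r\<bar> ^ 3\<bar> * g s t)"
  proof (rule bdd_integral_dominated)
    fix s t
    have "\<bar>t - r\<bar> ^ 3 \<le> 4 * \<bar>t\<bar> ^ 3 + 4 * \<bar>r\<bar> ^ 3"
      by (rule abs_diff_cubed_le)
    from mult_right_mono[OF this g_nonneg[of s t]]
    show "\<bar>\<bar>\<bar>t - r\<bar> ^ 3\<bar> * g s t\<bar> \<le> 4 * (\<bar>t\<bar> ^ 3 * g s t) + (4 * \<bar>r\<bar> ^ 3) * g s t"
      using g_nonneg[of s t] by (simp add: abs_mult algebra_simps)
  qed measurable
qed

lemma cond_variance_eq: "(LINT t|lborel. (t - r)\<^sup>2 * g x t) = cond_variance g x * f x"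
  using fx by (simp add: cond_variance_def)

text \<open>
  Otherwise \<open>g x\<close> would vanish almost everywhere off the single point \<open>r\<close>, contradicting \<open>f x \<noteq> 0\<close>.
\<close>

lemma cond_variance_pos: "0 < cond_variance g x"
proof -
  have int: "integrable lborel (\<lambda>t. (t - r)\<^sup>2 * g x t)"
    using bdd_integral_integrable[OF square_deviation_bdd, of x] by simp
  have "(LINT t|lborel. (t - r)\<^sup>2 * g x t) \<noteq> 0"
  proof
    assume "(LINT t|lborel. (t - r)\<^sup>2 * g x t) = 0"
    then have "AE t in lborel. (t - r)\<^sup>2 * g x t = 0"
      using int by (subst (asm) integral_nonneg_eq_0_iff_AE) (auto simp: g_nonneg)
    moreover have "AE t in lborel. t \<noteq> r"
      by (rule AE_lborel_singleton)
    ultimately have "AE t in lborel. g x t = 0"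
      by eventually_elim simp
    then have "f x = 0"
      unfolding marginal_density_def by (rule integral_eq_zero_AE)
    with fx show False by simp
  qed
  moreover have "0 \<le> (LINT t|lborel. (t - r)\<^sup>2 * g x t)"
    by (intro Bochner_Integration.integral_nonneg) (simp add: g_nonneg)
  ultimately have "0 < cond_variance g x * f x"
    unfolding cond_variance_eq by linarith
  then show ?thesis using f_pos by (simp add: zero_less_mult_iff)
qed

lemma density_expansion: "second_order_at f x"
proof -
  obtain \<delta> where \<delta>: "\<delta> > 0" "set_integrable (lborel \<Otimes>\<^sub>M lborel) ({x - \<delta>..x + \<delta>} \<times> UNIV) (\<lambda>(s, t). 1 * diff2 g s t)"
    using g_joint[of 0] by auto
  have "bdd_integral (\<lambda>s t. 1 * g s t)" "bdd_integral (\<lambda>s t. 1 * diff2 g s t)"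
    using g_moments[of 0] g_diff2[of 0] by (auto simp: bdd_cont_integral_def)
  from second_order_at_moment[OF g_C2 this \<delta>] show ?thesis
    by (simp add: marginal_density_def[abs_def])
qed

lemma regression_deviation_expansion: "second_order_at (\<lambda>s. LINT t|lborel. (t - r) * g s t) x"
proof -
  obtain \<delta> where \<delta>: "\<delta> > 0" "set_integrable (lborel \<Otimes>\<^sub>M lborel) ({x - \<delta>..x + \<delta>} \<times> UNIV) (\<lambda>(s, t). t * diff2 g s t)"
    using g_joint[of 1] by auto
  have "bdd_integral (\<lambda>s t. t * g s t)" "bdd_integral (\<lambda>s t. t * diff2 g s t)"
    using g_moments[of 1] g_diff2[of 1] by (auto simp: bdd_cont_integral_def)
  from second_order_at_diff[OF second_order_at_moment[OF g_C2 this \<delta>] density_expansion, of r]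
  show ?thesis
    using moment_integrable by (simp add: left_diff_distrib marginal_density_def)
qed

lemma second_deviation_continuous: "isCont (\<lambda>s. LINT t|lborel. (t - r)\<^sup>2 * g s t) x"
proof -
  have eq: "(LINT t|lborel. (t - r)\<^sup>2 * g s t)
      = (LINT t|lborel. t ^ 2 * g s t) - 2 * r * (LINT t|lborel. t ^ 1 * g s t) + r\<^sup>2 * (LINT t|lborel. t ^ 0 * g s t)" for s
  proof -
    have "(t - r)\<^sup>2 * g s t = t\<^sup>2 * g s t - 2 * r * (t * g s t) + r\<^sup>2 * g s t" for t
      by (simp add: power2_eq_square algebra_simps)
    then show ?thesis using moment_integrable[of s] by simp
  qed
  have "isCont (\<lambda>s. LINT t|lborel. t ^ p * g s t) x" if "p \<in> {0, 1, 2}" for p :: nat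
    using g_moments[OF that] by (simp add: bdd_cont_integral_def)
  from this[of 0] this[of 1] this[of 2] show ?thesis
    unfolding eq by (intro continuous_intros) auto
qed

text \<open>
  The variables \<open>Z\<^sub>n(x)\<close> and \<open>W\<^sub>n(x) - r Z\<^sub>n(x)\<close>, as functions of the bandwidth.
\<close>

definition weight :: "real \<Rightarrow> nat \<Rightarrow> 'w \<Rightarrow> real" where
  "weight h n \<omega> = K ((x - Xs n \<omega>) / h) / h"

definition residual :: "real \<Rightarrow> nat \<Rightarrow> 'w \<Rightarrow> real" where
  "residual h n \<omega> = (Ys n \<omega> - r) * K ((x - Xs n \<omega>) / h) / h"

lemmas smoothed = kernel_expectation[OF prob_space_axioms g_nonneg ident]

lemma g_integrable_bdd: "bdd_integral g"
  using g_moments[of 0] by (auto simp: bdd_cont_integral_def)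

lemma K_integrable: "integrable lborel K"
  using K_mass by (simp add: has_bochner_integral_iff)

lemma f_measurable: "f \<in> borel_measurable borel"
  unfolding marginal_density_def[abs_def] by measurable

lemma f_bound:
  obtains C where "0 < C" "\<And>s. \<bar>f s\<bar> \<le> C"
  using bdd_integral_bound[OF g_integrable_bdd] unfolding marginal_density_def by blast

lemma weight_mean:
  obtains B where "0 < B" "\<And>n h. 1 \<le> n \<Longrightarrow> 0 < h \<Longrightarrow> \<bar>expectation (weight h n) - f x\<bar> \<le> B * h\<^sup>2"
proof -
  obtain C where C: "0 < C" "\<And>s. \<bar>f s\<bar> \<le> C" using f_bound by blast
  obtain B where B: "0 < B" "\<And>h. \<bar>(LINT z|lborel. K z * f (x - h * z)) - f x\<bar> \<le> B * h\<^sup>2"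
    using kernel_smoothing_bias[OF K_nonneg K_mass K_centered K_second f_measurable C(2) density_expansion] by blast
  have "expectation (weight h n) = (LINT z|lborel. K z * f (x - h * z))" if "1 \<le> n" "0 < h" for n h
    using smoothed(2)[OF that(1) K_integrable, of "\<lambda>_. 1" h x] g_integrable_bdd that(2)
    by (simp add: weight_def[abs_def] marginal_density_def)
  with B that show thesis by simp
qed

lemma weight_square:
  assumes "1 \<le> n" "0 < h"
  shows "integrable M (\<lambda>\<omega>. (weight h n \<omega>)\<^sup>2)"
    and "expectation (\<lambda>\<omega>. (weight h n \<omega>)\<^sup>2) = (LINT z|lborel. (K z)\<^sup>2 * f (x - h * z)) / h"
proof -
  have eq: "(weight h n \<omega>)\<^sup>2 = (K ((x - Xs n \<omega>) / h))\<^sup>2 * 1 / h\<^sup>2" for \<omega>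
    by (simp add: weight_def power_divide)
  have b: "bdd_integral (\<lambda>s t. \<bar>1\<bar> * g s t)" using g_integrable_bdd by simp
  note sm = smoothed[OF assms(1) K_power_integrable[of 2] _ b assms(2), where x = x]
  show "integrable M (\<lambda>\<omega>. (weight h n \<omega>)\<^sup>2)"
    unfolding eq using sm(1) by simp
  show "expectation (\<lambda>\<omega>. (weight h n \<omega>)\<^sup>2) = (LINT z|lborel. (K z)\<^sup>2 * f (x - h * z)) / h"
    unfolding eq using sm(2) assms(2) by (simp add: marginal_density_def power2_eq_square)
qed

lemma weight_second_moment:
  obtains B where "0 < B" "\<And>n h. 1 \<le> n \<Longrightarrow> 0 < h \<Longrightarrow> expectation (\<lambda>\<omega>. (weight h n \<omega>)\<^sup>2) \<le> B / h"
proof -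
  obtain C where C: "0 < C" "\<And>s. \<bar>f s\<bar> \<le> C" using f_bound by blast
  show thesis
  proof (rule that)
    show "0 < C * (LINT z|lborel. (K z)\<^sup>2)" using C(1) K_sq_pos by simp
    fix n h assume "1 \<le> (n :: nat)" "0 < (h :: real)"
    then show "expectation (\<lambda>\<omega>. (weight h n \<omega>)\<^sup>2) \<le> C * (LINT z|lborel. (K z)\<^sup>2) / h"
      unfolding weight_square(2)[OF \<open>1 \<le> n\<close> \<open>0 < h\<close>]
      using kernel_smoothing_bound[OF K_power_integrable[of 2] _ f_measurable C(2), where x = x and h = h]
      by (intro divide_right_mono) auto
  qed
qed

text \<open>
  The regression value \<open>r\<close> is what makes \<open>\<integral> (t - r) g s t dt\<close> vanish at \<open>s = x\<close>; the mean is pure kernel bias.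
\<close>

lemma residual_mean:
  obtains B where "0 < B" "\<And>n h. 1 \<le> n \<Longrightarrow> 0 < h \<Longrightarrow> \<bar>expectation (residual h n)\<bar> \<le> B * h\<^sup>2"
proof -
  have b: "bdd_integral (\<lambda>s t. (t - r) * g s t)"
    by (rule bdd_integral_dominated[OF deviation_bdd]) (auto simp: abs_mult g_nonneg)
  obtain C where C: "0 < C" "\<And>s. \<bar>LINT t|lborel. (t - r) * g s t\<bar> \<le> C"
    using bdd_integral_bound[OF b] by blast
  have meas: "(\<lambda>s. LINT t|lborel. (t - r) * g s t) \<in> borel_measurable borel" by measurable
  obtain B where B: "0 < B" "\<And>h. \<bar>(LINT z|lborel. K z * (LINT t|lborel. (t - r) * g (x - h * z) t))
      - (LINT t|lborel. (t - r) * g x t)\<bar> \<le> B * h\<^sup>2"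
    using kernel_smoothing_bias[OF K_nonneg K_mass K_centered K_second meas C(2) regression_deviation_expansion] by blast
  have "expectation (residual h n) = (LINT z|lborel. K z * (LINT t|lborel. (t - r) * g (x - h * z) t))"
    if "1 \<le> n" "0 < h" for n h
    using smoothed(2)[OF that(1) K_integrable _ deviation_bdd that(2), where x = x] that(2)
    by (simp add: residual_def[abs_def] mult.commute)
  with B that show thesis by (simp add: r_centers)
qed

lemma residual_square:
  assumes "1 \<le> n" "0 < h"
  shows "h * expectation (\<lambda>\<omega>. (residual h n \<omega>)\<^sup>2)
    = (LINT z|lborel. (K z)\<^sup>2 * (LINT t|lborel. (t - r)\<^sup>2 * g (x - h * z) t))"
proof -
  have eq: "(residual h n \<omega>)\<^sup>2 = (K ((x - Xs n \<omega>) / h))\<^sup>2 * (Ys n \<omega> - r)\<^sup>2 / h\<^sup>2" for \<omega>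
    by (simp add: residual_def power_divide power_mult_distrib)
  show ?thesis
    unfolding eq using smoothed(2)[OF assms(1) K_power_integrable[of 2] _ square_deviation_bdd assms(2), where x = x] assms(2)
    by (simp add: power2_eq_square)
qed

lemma residual_second_moment:
  assumes h: "h \<longlonglongrightarrow> 0" "\<And>n. 1 \<le> n \<Longrightarrow> 0 < h n"
  shows "(\<lambda>n. h n * expectation (\<lambda>\<omega>. (residual (h n) n \<omega>)\<^sup>2))
    \<longlonglongrightarrow> cond_variance g x * f x * (LINT z|lborel. (K z)\<^sup>2)"
proof -
  have b: "bdd_integral (\<lambda>s t. (t - r)\<^sup>2 * g s t)" using square_deviation_bdd by simp
  obtain C where C: "0 < C" "\<And>s. \<bar>LINT t|lborel. (t - r)\<^sup>2 * g s t\<bar> \<le> C"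
    using bdd_integral_bound[OF b] by blast
  have meas: "(\<lambda>s. LINT t|lborel. (t - r)\<^sup>2 * g s t) \<in> borel_measurable borel" by measurable
  have "(\<lambda>n. LINT z|lborel. (K z)\<^sup>2 * (LINT t|lborel. (t - r)\<^sup>2 * g (x - h n * z) t))
      \<longlonglongrightarrow> (LINT t|lborel. (t - r)\<^sup>2 * g x t) * (LINT z|lborel. (K z)\<^sup>2)"
    by (rule kernel_smoothing_limit[OF K_power_integrable[of 2] meas C(2) second_deviation_continuous h(1)]) simp
  moreover have "\<forall>\<^sub>F n in sequentially. (LINT z|lborel. (K z)\<^sup>2 * (LINT t|lborel. (t - r)\<^sup>2 * g (x - h n * z) t))
      = h n * expectation (\<lambda>\<omega>. (residual (h n) n \<omega>)\<^sup>2)"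
    using eventually_ge_at_top[of 1] by eventually_elim (simp add: residual_square h(2))
  ultimately show ?thesis
    unfolding cond_variance_eq by (rule Lim_transform_eventually)
qed

lemma residual_cube:
  assumes "1 \<le> n" "0 < h"
  shows "integrable M (\<lambda>\<omega>. \<bar>residual h n \<omega>\<bar> ^ 3)"
    and "expectation (\<lambda>\<omega>. \<bar>residual h n \<omega>\<bar> ^ 3)
      = (LINT z|lborel. K z ^ 3 * (LINT t|lborel. \<bar>t - r\<bar> ^ 3 * g (x - h * z) t)) / h\<^sup>2"
proof -
  have eq: "\<bar>residual h n \<omega>\<bar> ^ 3 = K ((x - Xs n \<omega>) / h) ^ 3 * \<bar>Ys n \<omega> - r\<bar> ^ 3 / h ^ 3" for \<omega>
    using assms(2) by (simp add: residual_def power_divide power_mult_distrib abs_mult K_nonneg)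
  note sm = smoothed[OF assms(1) K_power_integrable[of 3] _ cube_deviation_bdd assms(2), where x = x]
  show "integrable M (\<lambda>\<omega>. \<bar>residual h n \<omega>\<bar> ^ 3)"
    unfolding eq using sm(1) by simp
  show "expectation (\<lambda>\<omega>. \<bar>residual h n \<omega>\<bar> ^ 3)
      = (LINT z|lborel. K z ^ 3 * (LINT t|lborel. \<bar>t - r\<bar> ^ 3 * g (x - h * z) t)) / h\<^sup>2"
    unfolding eq using sm(2) assms(2) by (simp add: power2_eq_square power3_eq_cube)
qed

lemma residual_third_moment:
  obtains B where "0 < B" "\<And>n h. 1 \<le> n \<Longrightarrow> 0 < h \<Longrightarrow> expectation (\<lambda>\<omega>. \<bar>residual h n \<omega>\<bar> ^ 3) \<le> B / h\<^sup>2"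
proof -
  have b: "bdd_integral (\<lambda>s t. \<bar>t - r\<bar> ^ 3 * g s t)" using cube_deviation_bdd by simp
  obtain C where C: "0 < C" "\<And>s. \<bar>LINT t|lborel. \<bar>t - r\<bar> ^ 3 * g s t\<bar> \<le> C"
    using bdd_integral_bound[OF b] by blast
  have meas: "(\<lambda>s. LINT t|lborel. \<bar>t - r\<bar> ^ 3 * g s t) \<in> borel_measurable borel" by measurable
  have K3: "0 \<le> (LINT z|lborel. K z ^ 3)"
    by (intro Bochner_Integration.integral_nonneg) (simp add: K_nonneg)
  show thesis
  proof (rule that)
    show "0 < C * (LINT z|lborel. K z ^ 3) + 1" using C(1) K3 by (simp add: add_nonneg_pos)
    fix n h assume nh: "1 \<le> (n :: nat)" "0 < (h :: real)"
    have "(LINT z|lborel. K z ^ 3 * (LINT t|lborel. \<bar>t - r\<bar> ^ 3 * g (x - h * z) t)) \<le> C * (LINT z|lborel. K z ^ 3)"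
      by (rule kernel_smoothing_bound[OF K_power_integrable[of 3] _ meas C(2)]) (auto simp: K_nonneg)
    then show "expectation (\<lambda>\<omega>. \<bar>residual h n \<omega>\<bar> ^ 3) \<le> (C * (LINT z|lborel. K z ^ 3) + 1) / h\<^sup>2"
      unfolding residual_cube(2)[OF nh] by (intro divide_right_mono) auto
  qed
qed

text \<open>
  The error \<open>revesz - r\<close> obeys the linear recursion studied above, with \<open>\<zeta> = weight\<close>, \<open>\<xi> = residual\<close> and
  \<open>\<tau> = Var[Y | X = x] f x \<integral>K\<^sup>2\<close>.
\<close>

theorem averaged_revesz_clt:
  fixes \<gamma> h qs :: "nat \<Rightarrow> real" and \<alpha> a :: real
  assumes indep: "indep_vars (\<lambda>_. borel :: (real \<times> real) measure) (\<lambda>n \<omega>. (Xs n \<omega>, Ys n \<omega>)) {1..}"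
    and GS: "\<gamma> \<in> GS (- \<alpha>)" "h \<in> GS (- a)" "qs \<in> GS (- a)"
    and a: "0 < a" "a < \<alpha>" "a < 1 / 3"
    and n\<gamma>: "filterlim (\<lambda>n. real n * \<gamma> n) at_top sequentially"
    and nh5: "(\<lambda>n. real n * h n ^ 5) \<longlonglongrightarrow> 0"
  shows "weak_conv_m
    (\<lambda>n. distr M borel (\<lambda>\<omega>. sqrt (real n * h n) * (averaged_revesz qs K \<gamma> h Xs Ys r0 x n \<omega> - r)))
    (gaussian 0 ((1 - a) * (cond_variance g x / f x) * (LINT z|lborel. (K z)\<^sup>2)))"
proof -
  define \<tau> where "\<tau> = cond_variance g x * f x * (LINT z|lborel. (K z)\<^sup>2)"
  define e where "e n \<omega> = revesz K \<gamma> h Xs Ys r0 x n \<omega> - r" for n \<omega>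
  note h_pos = GS_pos[OF GS(2)]
  obtain B1 where B1: "0 < B1" "\<And>n h. 1 \<le> n \<Longrightarrow> 0 < h \<Longrightarrow> \<bar>expectation (weight h n) - f x\<bar> \<le> B1 * h\<^sup>2"
    using weight_mean by blast
  obtain B2 where B2: "0 < B2" "\<And>n h. 1 \<le> n \<Longrightarrow> 0 < h \<Longrightarrow> expectation (\<lambda>\<omega>. (weight h n \<omega>)\<^sup>2) \<le> B2 / h"
    using weight_second_moment by blast
  obtain B3 where B3: "0 < B3" "\<And>n h. 1 \<le> n \<Longrightarrow> 0 < h \<Longrightarrow> \<bar>expectation (residual h n)\<bar> \<le> B3 * h\<^sup>2"
    using residual_mean by blast
  obtain B4 where B4: "0 < B4" "\<And>n h. 1 \<le> n \<Longrightarrow> 0 < h \<Longrightarrow> expectation (\<lambda>\<omega>. \<bar>residual h n \<omega>\<bar> ^ 3) \<le> B4 / h\<^sup>2"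
    using residual_third_moment by blast
  define B where "B = B1 + B2 + B3 + B4"
  have B: "B1 \<le> B" "B2 \<le> B" "B3 \<le> B" "B4 \<le> B" "0 < B"
    using B1(1) B2(1) B3(1) B4(1) by (auto simp: B_def)
  interpret R: averaged_linear_recursion M "\<lambda>n. weight (h n) n" "\<lambda>n. residual (h n) n" e \<gamma> "r0 x - r"
    h qs \<alpha> a "f x" \<tau> B
  proof
    have "indep_vars (\<lambda>_. borel) (\<lambda>n \<omega>. (\<lambda>p. (K ((x - fst p) / h n) / h n, (snd p - r) * K ((x - fst p) / h n) / h n))
        (Xs n \<omega>, Ys n \<omega>)) {1..}"
      by (rule indep_vars_compose2[OF indep]) (unfold borel_prod[symmetric], measurable)
    then show "indep_vars (\<lambda>_. borel) (\<lambda>n \<omega>. (weight (h n) n \<omega>, residual (h n) n \<omega>)) {1..}"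
      by (simp add: weight_def residual_def)
    show "e 0 \<omega> = r0 x - r" for \<omega> by (simp add: e_def)
    show "e (Suc n) \<omega> = (1 - \<gamma> (Suc n) * weight (h (Suc n)) (Suc n) \<omega>) * e n \<omega>
        + \<gamma> (Suc n) * residual (h (Suc n)) (Suc n) \<omega>" for n \<omega>
      using h_pos[of "Suc n"]
      by (simp add: e_def weight_def residual_def W_def Z_def field_simps)
    show "integrable M (\<lambda>\<omega>. (weight (h n) n \<omega>)\<^sup>2)" if "1 \<le> n" for n
      by (rule weight_square(1)[OF that h_pos[OF that]])
    show "integrable M (\<lambda>\<omega>. \<bar>residual (h n) n \<omega>\<bar> ^ 3)" if "1 \<le> n" for n
      by (rule residual_cube(1)[OF that h_pos[OF that]])
    show "0 < f x" by (rule f_pos)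
    show "0 < \<tau>" using f_pos cond_variance_pos K_sq_pos by (simp add: \<tau>_def)
    show "\<bar>expectation (weight (h n) n) - f x\<bar> \<le> B * (h n)\<^sup>2" if n: "1 \<le> n" for n
      by (rule order_trans[OF B1(2)[OF n h_pos[OF n]]]) (intro mult_right_mono B, simp)
    show "expectation (\<lambda>\<omega>. (weight (h n) n \<omega>)\<^sup>2) \<le> B / h n" if n: "1 \<le> n" for n
      by (rule order_trans[OF B2(2)[OF n h_pos[OF n]]]) (intro divide_right_mono B less_imp_le[OF h_pos[OF n]])
    show "\<bar>expectation (residual (h n) n)\<bar> \<le> B * (h n)\<^sup>2" if n: "1 \<le> n" for n
      by (rule order_trans[OF B3(2)[OF n h_pos[OF n]]]) (intro mult_right_mono B, simp)
    show "expectation (\<lambda>\<omega>. \<bar>residual (h n) n \<omega>\<bar> ^ 3) \<le> B / (h n)\<^sup>2" if n: "1 \<le> n" for n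
      by (rule order_trans[OF B4(2)[OF n h_pos[OF n]]]) (intro divide_right_mono B, simp)
    show "(\<lambda>n. h n * expectation (\<lambda>\<omega>. (residual (h n) n \<omega>)\<^sup>2)) \<longlonglongrightarrow> \<tau>"
      unfolding \<tau>_def using a by (intro residual_second_moment h_pos GS_tendsto_0[OF GS(2)]) auto
  qed (use assms B in auto)
  have "(1 - a) * \<tau> / (f x)\<^sup>2 = (1 - a) * (cond_variance g x / f x) * (LINT z|lborel. (K z)\<^sup>2)"
    using f_pos by (simp add: \<tau>_def power2_eq_square)
  moreover have "sqrt (real n * h n) * ((\<Sum>k=1..n. qs k * e k \<omega>) / (\<Sum>k=1..n. qs k))
      = sqrt (real n * h n) * (averaged_revesz qs K \<gamma> h Xs Ys r0 x n \<omega> - r)" for n \<omega>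
  proof (cases "n = 0")
    case False
    then have "0 < (\<Sum>k=1..n. qs k)" by (intro sum_pos) (auto intro: R.q_pos)
    moreover have "(\<Sum>k=1..n. qs k * e k \<omega>)
        = (\<Sum>k=1..n. qs k * revesz K \<gamma> h Xs Ys r0 x k \<omega>) - r * (\<Sum>k=1..n. qs k)"
      by (simp add: e_def right_diff_distrib sum_subtractf sum_distrib_left mult.commute)
    ultimately show ?thesis by (simp add: averaged_revesz_def diff_divide_distrib)
  qed simp
  ultimately show ?thesis
    using R.averaged_recursion_clt by simp
qed

end

theorem corollary1:
  fixes M :: "'w measure"
    and X Y :: "'w \<Rightarrow> real" and Xs Ys :: "nat \<Rightarrow> 'w \<Rightarrow> real"
    and g :: "real \<Rightarrow> real \<Rightarrow> real" and K :: "real \<Rightarrow> real" and r0 :: "real \<Rightarrow> real"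
    and \<gamma> h qs :: "nat \<Rightarrow> real" and \<alpha> a q x :: real
  assumes M: "prob_space M"
    and indep: "prob_space.indep_vars M (\<lambda>_. borel :: (real \<times> real) measure)
                  (\<lambda>n \<omega>. if n = 0 then (X \<omega>, Y \<omega>) else (Xs n \<omega>, Ys n \<omega>)) (UNIV :: nat set)"
    and g_nonneg: "\<And>s t. 0 \<le> g s t"
    and density: "distributed M (lborel \<Otimes>\<^sub>M lborel) (\<lambda>\<omega>. (X \<omega>, Y \<omega>)) (\<lambda>(s, t). ennreal (g s t))"
    and ident: "\<And>n. 1 \<le> n \<Longrightarrow> distributed M (lborel \<Otimes>\<^sub>M lborel)
                  (\<lambda>\<omega>. (Xs n \<omega>, Ys n \<omega>)) (\<lambda>(s, t). ennreal (g s t))"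
    and fx: "marginal_density g x \<noteq> 0"
    \<comment> \<open>(i) kernel\<close>
    and "\<And>z. 0 \<le> K z" and "continuous_on UNIV K" and "bounded (range K)"
    and "has_bochner_integral lborel K 1"
    and "has_bochner_integral lborel (\<lambda>z. z * K z) 0"
    and "integrable lborel (\<lambda>z. z\<^sup>2 * K z)"
    \<comment> \<open>(ii) stepsize and bandwidth\<close>
    and "\<gamma> \<longlonglongrightarrow> 0" and "h \<longlonglongrightarrow> 0"
    and "\<gamma> \<in> GS (- \<alpha>)" and "\<alpha> \<in> {3/4<..1}"
    and "convergent (\<lambda>n. inverse (real n * \<gamma> n))"
    and "h \<in> GS (- a)" and "a \<in> {(1 - \<alpha>) / 4<..<\<alpha> / 3}" and "1/5 \<le> a"
    \<comment> \<open>(iii) joint density\<close>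
    and "C2_in_first g"
    and "\<And>p. p \<in> {0, 1, 2 :: nat} \<Longrightarrow> bdd_cont_integral (\<lambda>s t. t ^ p * g s t) x"
    and "\<And>p. p \<in> {2..3 :: real} \<Longrightarrow> bdd_integral (\<lambda>s t. \<bar>t\<bar> powr p * g s t)"
    and "\<And>p. p \<in> {0, 1 :: nat} \<Longrightarrow> integrable lborel (\<lambda>t. \<bar>t\<bar> ^ p * \<bar>diff1 g x t\<bar>)"
    and "\<And>p. p \<in> {0, 1 :: nat} \<Longrightarrow> bdd_cont_integral (\<lambda>s t. t ^ p * diff2 g s t) x"
    \<comment> \<open>local joint integrability, which licenses the Taylor expansion at x under the integral sign\<close>
    and "\<And>p. p \<in> {0, 1 :: nat} \<Longrightarrow> \<exists>\<delta>>0. set_integrable (lborel \<Otimes>\<^sub>M lborel)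
           ({x - \<delta>..x + \<delta>} \<times> UNIV) (\<lambda>(s, t). t ^ p * diff2 g s t)"
    \<comment> \<open>(iv)\<close>
    and "filterlim (\<lambda>n. real n * \<gamma> n * inverse (ln (\<Sum>k=1..n. \<gamma> k))) at_top sequentially"
    and "a \<in> {1 - \<alpha><..<(4 * \<alpha> - 3) / 2}"
    \<comment> \<open>(v) weights\<close>
    and "\<not> summable qs"
    and "qs \<in> GS (- q)" and "q < min (1 - 2 * a) ((1 + a) / 2)"
  shows "(\<forall>p. is_arg_min (asymptotic_variance g K x a)
                (\<lambda>p. p < min (1 - 2 * a) ((1 + a) / 2)) p \<longleftrightarrow> p = a)
       \<and> is_arg_min (variance_factor a) (\<lambda>p. p < min (1 - 2 * a) ((1 + a) / 2)) a
       \<and> (q = a \<and> (\<lambda>n. real n * h n ^ 5) \<longlonglongrightarrow> 0 \<longrightarrow>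
            weak_conv_m
              (\<lambda>n. distr M borel (\<lambda>\<omega>. sqrt (real n * h n) *
                     (averaged_revesz qs K \<gamma> h Xs Ys r0 x n \<omega> - regression g x)))
              (gaussian 0 ((1 - a) * (cond_variance g x / marginal_density g x)
                             * (LINT z|lborel. (K z)\<^sup>2))))"
proof -
  interpret prob_space M by fact
  interpret revesz_model M Xs Ys g K x
  proof
    show "bdd_integral (\<lambda>s t. \<bar>t\<bar> powr 3 * g s t)"
      by (rule assms(23)) simp
    show "bdd_integral (\<lambda>s t. t ^ p * diff2 g s t)" if "p \<in> {0, 1 :: nat}" for p
      using assms(25)[OF that] by (simp add: bdd_cont_integral_def)
  qed fact+
  have a: "1 / 5 \<le> a" "a < 1 / 3" "a < \<alpha>"
    using assms by auto
  have pos: "0 < cond_variance g x / f x * (LINT z|lborel. (K z)\<^sup>2)"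
    using cond_variance_pos f_pos K_sq_pos by simp
  have first: "is_arg_min (asymptotic_variance g K x a) (\<lambda>p. p < min (1 - 2 * a) ((1 + a) / 2)) p \<longleftrightarrow> p = a" for p
    using is_arg_min_variance_factor[OF a(2) pos, of p]
    by (simp add: asymptotic_variance_def[abs_def] mult.assoc)
  have second: "is_arg_min (variance_factor a) (\<lambda>p. p < min (1 - 2 * a) ((1 + a) / 2)) a"
    using is_arg_min_variance_factor[OF a(2) zero_less_one, of a] by simp
  have third: "weak_conv_m
      (\<lambda>n. distr M borel (\<lambda>\<omega>. sqrt (real n * h n) *
         (averaged_revesz qs K \<gamma> h Xs Ys r0 x n \<omega> - regression g x)))
      (gaussian 0 ((1 - a) * (cond_variance g x / marginal_density g x) * (LINT z|lborel. (K z)\<^sup>2)))"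
    if qa: "q = a" and nh5: "(\<lambda>n. real n * h n ^ 5) \<longlonglongrightarrow> 0"
  proof (rule averaged_revesz_clt)
    have "indep_vars (\<lambda>_. borel :: (real \<times> real) measure)
        (\<lambda>n \<omega>. if n = 0 then (X \<omega>, Y \<omega>) else (Xs n \<omega>, Ys n \<omega>)) {1..}"
      by (rule indep_vars_subset[OF indep]) simp
    then show "indep_vars (\<lambda>_. borel :: (real \<times> real) measure) (\<lambda>n \<omega>. (Xs n \<omega>, Ys n \<omega>)) {1..}"
      by (rule indep_vars_cong[THEN iffD1, rotated -1]) auto
    show "filterlim (\<lambda>n. real n * \<gamma> n) at_top sequentially"
      by (rule step_size_at_top) (use GS_pos[OF \<open>\<gamma> \<in> GS (- \<alpha>)\<close>] in simp, fact)
    show "qs \<in> GS (- a)" using \<open>qs \<in> GS (- q)\<close> qa by simp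
  qed (use a nh5 assms in auto)
  from first second third show ?thesis by blast
qed

end
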